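(* Let $G$ be the labeled graph whose underlying simple graph is the wheel $W_5$ (the first Bouchet graph: a $5$-cycle together with one further vertex adjacent to all five vertices of the cycle), with each vertex having framing $1$ and with the signs of the vertices chosen arbitrarily. Then the graph-knot $\mathfrak{F}$ generated by $G$ (i.e. the equivalence class of $G$ modulo the graph-moves $\Omega_g1$--$\Omega_g4'$) is non-realisable.
   Context: All graphs are finite and are considered up to label-preserving isomorphism. Matrices and coranks are over $\mathbb{Z}_2$; $E$ is the identity matrix. $N(v)$ is the set of vertices adjacent to $v$. **Labeled graphs.** A labeled graph is a simple graph in which every vertex $v$ carries a pair $(a,\alpha)$, with $a\in\{0,1\}$ the framing and $\alpha\in\{+,-\}$ the sign of $v$. Its adjacency matrix $A(G)=(a_{ij})$ over $\mathbb{Z}_2$ has $a_{ii}$ = framing of $v_i$ and, for $i\neq j$, $a_{ij}=1$ iff $v_i,v_j$ are adjacent. $\operatorname{LC}(G;v)$ is obtained from $G$ by toggling the adjacency of $a,b$ for all $a\ne b$ in $N(v)$. $\operatorname{piv}(G;u,v)$ ($u\neq v$) is obtained from $G$ by toggling the adjacency of all pairs $x,y\notin\{u,v\}$ such that $x\in N(u)$, $y\in N(v)$ and either $x\notin N(v)$ or $y\notin N(u)$. **Graph-moves.** - $\Omega_g1$: addition/removal of an isolated vertex labeled $(0,\alpha)$, $\alpha\in\{\pm\}$. - $\Omega_g2$: addition/removal of two non-adjacent vertices labeled $(0,\alpha),(0,-\alpha)$, or of two adjacent vertices labeled $(1,\alpha),(1,-\alpha)$, which have the same adjacencies with all other vertices.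 - $\Omega_g3$: let $u,v,w$ be three vertices all labeled $(0,-)$ such that $u$ is adjacent only to $v$ and $w$, and $v,w$ are not adjacent. Toggle the adjacency of $u$ with $v$, with $w$, and with each $t\in (N(v)\setminus N(w))\cup(N(w)\setminus N(v))$, $t\neq u$; no other adjacencies change; switch the signs of $v$ and $w$ to $+$. The inverse operation is also an $\Omega_g3$ move. - $\Omega_g4$: for adjacent vertices $u,v$ labeled $(0,\alpha)$, $(0,\beta)$, replace $G$ by $\operatorname{piv}(G;u,v)$ and change the sign of $u$ to $-\beta$ and the sign of $v$ to $-\alpha$. - $\Omega_g4'$: for a vertex $v$ labeled $(1,\alpha)$, replace $G$ by $\operatorname{LC}(G;v)$, change the sign of $v$, and change the framing of each $u\in N(v)$. A graph-link is an equivalence class of labeled simple graphs modulo these moves. The number $\operatorname{corank}(A(G)+E)$ depends only on the graph-link of $G$; a graph-knot is a graph-link whose representatives $G$ satisfy $\operatorname{corank}(A(G)+E)=0$. **Realisability.** A labeled chord diagram is a circle together with finitely many chords with pairwise distinct endpoints on the circle, each chord carrying a label $(a,\alpha)$, $a\in\{0,1\}$, $\alpha\in\{\pm\}$. Two chords are linked if their endpoints alternate on the circle. Its labeled intersection graph has one vertex per chord, with the label of the chord, two vertices being adjacent iff the chords are linked. A labeled simple graph is realisable if it is the labeled intersection graph of some labeled chord diagram. A graph-link is non-realisable if it has no realisable representative. *)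

theory Defs
  imports Complex_Main "HOL-Library.Z2" "Jordan_Normal_Form.DL_Rank"
begin

section \<open>Labeled graphs\<close>

datatype sign = Plus | Minus

primrec opp :: "sign \<Rightarrow> sign" where
  "opp Plus = Minus"
| "opp Minus = Plus"

text \<open>The values of \<^term>\<open>framing\<close> and \<^term>\<open>vsign\<close> outside the vertex set carry no meaning;
  isomorphism, defined below, ignores them. Framings live in \<^typ>\<open>bit\<close>, the field
  with two elements.\<close>

record 'v lgraph =
  verts :: "'v set"
  adj :: "'v \<Rightarrow> 'v \<Rightarrow> bool"
  framing :: "'v \<Rightarrow> bit"
  vsign :: "'v \<Rightarrow> sign"

definition labeled_graph :: "'v lgraph \<Rightarrow> bool" where
  "labeled_graph G \<longleftrightarrow>
     finite (verts G) \<and>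
     (\<forall>x y. adj G x y \<longrightarrow> x \<in> verts G \<and> y \<in> verts G) \<and>
     (\<forall>x y. adj G x y \<longrightarrow> adj G y x) \<and>
     (\<forall>x. \<not> adj G x x)"

definition nbhd :: "'v lgraph \<Rightarrow> 'v \<Rightarrow> 'v set" where
  "nbhd G v = {x. adj G v x}"

definition lgraph_iso :: "'v lgraph \<Rightarrow> 'w lgraph \<Rightarrow> bool" where
  "lgraph_iso G H \<longleftrightarrow>
     (\<exists>f. bij_betw f (verts G) (verts H) \<and>
          (\<forall>x\<in>verts G. \<forall>y\<in>verts G. adj H (f x) (f y) \<longleftrightarrow> adj G x y) \<and>
          (\<forall>x\<in>verts G. framing H (f x) = framing G x \<and> vsign H (f x) = vsign G x))"

text \<open>The matrix depends on an enumeration of the vertices, here the increasing one;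
  another enumeration would only conjugate it by a permutation matrix.\<close>

definition adj_matrix :: "'v::linorder lgraph \<Rightarrow> bit mat" where
  "adj_matrix G =
     (let vs = sorted_list_of_set (verts G); n = card (verts G)
      in mat n n (\<lambda>(i, j). if i = j then framing G (vs ! i)
                          else of_bool (adj G (vs ! i) (vs ! j))))"

definition corank :: "'a::field mat \<Rightarrow> nat" where
  "corank A = dim_row A - vec_space.rank (dim_row A) A"

section \<open>Graph-moves\<close>

definition toggle :: "'v lgraph \<Rightarrow> ('v \<Rightarrow> 'v \<Rightarrow> bool) \<Rightarrow> 'v lgraph" where
  "toggle G T = G\<lparr>adj := (\<lambda>x y. adj G x y \<noteq> (T x y \<or> T y x))\<rparr>"

definition del_verts :: "'v lgraph \<Rightarrow> 'v set \<Rightarrow> 'v lgraph" where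
  "del_verts G S = G\<lparr>verts := verts G - S, adj := (\<lambda>x y. adj G x y \<and> x \<notin> S \<and> y \<notin> S)\<rparr>"

definition LC :: "'v lgraph \<Rightarrow> 'v \<Rightarrow> 'v lgraph" where
  "LC G v = toggle G (\<lambda>a b. a \<noteq> b \<and> a \<in> nbhd G v \<and> b \<in> nbhd G v)"

definition piv :: "'v lgraph \<Rightarrow> 'v \<Rightarrow> 'v \<Rightarrow> 'v lgraph" where
  "piv G u v = toggle G (\<lambda>x y. x \<notin> {u, v} \<and> y \<notin> {u, v} \<and> x \<in> nbhd G u \<and> y \<in> nbhd G v \<and>
                              (x \<notin> nbhd G v \<or> y \<notin> nbhd G u))"

text \<open>The first two moves are written as removals, and the third in one direction;
  the inverses enter through the symmetric closure in \<open>graph_equiv\<close>.\<close>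

definition Omega_g1 :: "'v lgraph \<Rightarrow> 'v lgraph \<Rightarrow> bool" where
  "Omega_g1 G H \<longleftrightarrow>
     (\<exists>v\<in>verts G. nbhd G v = {} \<and> framing G v = 0 \<and> H = del_verts G {v})"

definition Omega_g2 :: "'v lgraph \<Rightarrow> 'v lgraph \<Rightarrow> bool" where
  "Omega_g2 G H \<longleftrightarrow>
     (\<exists>u\<in>verts G. \<exists>v\<in>verts G. u \<noteq> v \<and>
        (\<not> adj G u v \<and> framing G u = 0 \<and> framing G v = 0 \<or>
         adj G u v \<and> framing G u = 1 \<and> framing G v = 1) \<and>
        vsign G v = opp (vsign G u) \<and>
        (\<forall>t\<in>verts G - {u, v}. adj G u t \<longleftrightarrow> adj G v t) \<and>
        H = del_verts G {u, v})"

definition Omega_g3 :: "'v lgraph \<Rightarrow> 'v lgraph \<Rightarrow> bool" where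
  "Omega_g3 G H \<longleftrightarrow>
     (\<exists>u\<in>verts G. \<exists>v\<in>verts G. \<exists>w\<in>verts G.
        u \<noteq> v \<and> u \<noteq> w \<and> v \<noteq> w \<and>
        (\<forall>x\<in>{u, v, w}. framing G x = 0 \<and> vsign G x = Minus) \<and>
        nbhd G u = {v, w} \<and> \<not> adj G v w \<and>
        H = (toggle G (\<lambda>x t. x = u \<and>
               t \<in> {v, w} \<union> (((nbhd G v - nbhd G w) \<union> (nbhd G w - nbhd G v)) - {u})))
            \<lparr>vsign := (vsign G)(v := Plus, w := Plus)\<rparr>)"

definition Omega_g4 :: "'v lgraph \<Rightarrow> 'v lgraph \<Rightarrow> bool" where
  "Omega_g4 G H \<longleftrightarrow>
     (\<exists>u\<in>verts G. \<exists>v\<in>verts G. adj G u v \<and> framing G u = 0 \<and> framing G v = 0 \<and>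
        H = (piv G u v)\<lparr>vsign := (vsign G)(u := opp (vsign G v), v := opp (vsign G u))\<rparr>)"

definition Omega_g4' :: "'v lgraph \<Rightarrow> 'v lgraph \<Rightarrow> bool" where
  "Omega_g4' G H \<longleftrightarrow>
     (\<exists>v\<in>verts G. framing G v = 1 \<and>
        H = (LC G v)\<lparr>framing := (\<lambda>x. if x \<in> nbhd G v then framing G x + 1 else framing G x),
                      vsign := (vsign G)(v := opp (vsign G v))\<rparr>)"

section \<open>Graph-links and graph-knots\<close>

text \<open>Every finite labeled graph is isomorphic to one whose vertices are natural numbers,
  so graph-links are formed over \<^typ>\<open>nat\<close>. Isomorphism is one of the steps, which
  identifies isomorphic graphs and provides fresh vertices for the additions.\<close>

definition graph_step :: "nat lgraph \<Rightarrow> nat lgraph \<Rightarrow> bool" where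
  "graph_step G H \<longleftrightarrow>
     labeled_graph G \<and> labeled_graph H \<and>
     (lgraph_iso G H \<or> Omega_g1 G H \<or> Omega_g2 G H \<or> Omega_g3 G H \<or> Omega_g4 G H \<or> Omega_g4' G H)"

definition graph_equiv :: "(nat lgraph \<times> nat lgraph) set" where
  "graph_equiv = {(G, H). labeled_graph G \<and> labeled_graph H \<and> equivclp graph_step G H}"

definition graph_links :: "nat lgraph set set" where
  "graph_links = {G. labeled_graph G} // graph_equiv"

definition graph_link_of :: "nat lgraph \<Rightarrow> nat lgraph set" where
  "graph_link_of G = graph_equiv `` {G}"

definition graph_knot :: "nat lgraph set \<Rightarrow> bool" where
  "graph_knot F \<longleftrightarrow> F \<in> graph_links \<and>
     (\<forall>G\<in>F. corank (adj_matrix G + 1\<^sub>m (card (verts G))) = 0)"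

section \<open>Chord diagrams and realisability\<close>

text \<open>The circle is the unit circle of the complex plane. A chord is given by an index
  and its unordered pair of endpoints.\<close>

record 'c chord_diagram =
  chords :: "'c set"
  endpoints :: "'c \<Rightarrow> complex set"
  chord_framing :: "'c \<Rightarrow> bit"
  chord_sign :: "'c \<Rightarrow> sign"

definition chord_diagram :: "'c chord_diagram \<Rightarrow> bool" where
  "chord_diagram D \<longleftrightarrow>
     finite (chords D) \<and>
     (\<forall>c\<in>chords D. card (endpoints D c) = 2 \<and> (\<forall>z\<in>endpoints D c. cmod z = 1)) \<and>
     (\<forall>c\<in>chords D. \<forall>d\<in>chords D. c \<noteq> d \<longrightarrow> endpoints D c \<inter> endpoints D d = {})"

definition ccw_order :: "complex \<Rightarrow> complex \<Rightarrow> complex \<Rightarrow> complex \<Rightarrow> bool" where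
  "ccw_order z1 z2 z3 z4 \<longleftrightarrow>
     (\<exists>t1 t2 t3 t4. t1 < t2 \<and> t2 < t3 \<and> t3 < t4 \<and> t4 < t1 + 2 * pi \<and>
        z1 = cis t1 \<and> z2 = cis t2 \<and> z3 = cis t3 \<and> z4 = cis t4)"

definition linked :: "'c chord_diagram \<Rightarrow> 'c \<Rightarrow> 'c \<Rightarrow> bool" where
  "linked D c d \<longleftrightarrow>
     (\<exists>p q r s. endpoints D c = {p, q} \<and> endpoints D d = {r, s} \<and> ccw_order p r q s)"

definition intersection_graph :: "'c chord_diagram \<Rightarrow> 'c lgraph" where
  "intersection_graph D =
     \<lparr>verts = chords D,
      adj = (\<lambda>c d. c \<in> chords D \<and> d \<in> chords D \<and> linked D c d),
      framing = chord_framing D,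
      vsign = chord_sign D\<rparr>"

definition realisable :: "'v lgraph \<Rightarrow> bool" where
  "realisable G \<longleftrightarrow>
     (\<exists>D :: nat chord_diagram. chord_diagram D \<and> lgraph_iso (intersection_graph D) G)"

definition non_realisable :: "nat lgraph set \<Rightarrow> bool" where
  "non_realisable F \<longleftrightarrow> \<not> (\<exists>G\<in>F. realisable G)"

section \<open>The wheel\<close>

text \<open>The rim is 0, ..., 4 in cyclic order and the hub is 5.\<close>

definition W5_adj :: "nat \<Rightarrow> nat \<Rightarrow> bool" where
  "W5_adj i j \<longleftrightarrow>
     (i < 5 \<and> j < 5 \<and> (j = (i + 1) mod 5 \<or> i = (j + 1) mod 5)) \<or>
     (i = 5 \<and> j < 5) \<or> (i < 5 \<and> j = 5)"

definition underlying_W5 :: "'v lgraph \<Rightarrow> bool" where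
  "underlying_W5 G \<longleftrightarrow>
     (\<exists>f. bij_betw f {..5::nat} (verts G) \<and>
          (\<forall>i\<le>5. \<forall>j\<le>5. adj G (f i) (f j) \<longleftrightarrow> W5_adj i j))"

end

theory Submission
  imports Defs
begin

text \<open>
  The matrix \<open>M = A(G) + E\<close> stays invertible under the graph-moves, and off the diagonal its inverse
  \<open>B\<close> behaves like the interlacement graph of a Gauss diagram: \<open>\<Omega>\<^sub>g4\<close> and \<open>\<Omega>\<^sub>g4'\<close> change only the
  diagonal (up to a transposition), while \<open>\<Omega>\<^sub>g1\<close>, \<open>\<Omega>\<^sub>g2\<close>, \<open>\<Omega>\<^sub>g3\<close> delete an isolated vertex, delete
  a pair of twins, and complement a triangle whose three columns cancel elsewhere. Hence Manturov's
  parity bracket is available: sum modulo 2 over all choices of diagonal entries at the vertices of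
  even degree for which that principal block is invertible, and take the graph of its Schur
  complement on the odd vertices modulo cancellation of twins. Instead of the graph itself we only
  record whether it cancels to a graph for which Naji's linear equations are solvable.

  Naji's equations are solvable for circle graphs, and solvability is inherited by inverses and
  Schur complements, so the bracket of a realisable graph vanishes. For the wheel with all framings
  1 the inverse is again a wheel; all its degrees are odd, so there is a single state, which has no
  twins and violates Naji's equations.
\<close>

text \<open>Solvability of Naji's equations cannot serve as the invariant by itself, since
  \<open>\<Omega>\<^sub>g2\<close> attaches twins with arbitrary adjacencies to any graph. The
  bracket is a way to detect the wheel inside every representative. The inverse has a geometric
  origin: for chord diagrams, \<open>A(G) + E\<close> belongs to a rotating circuit and its inverse,
  up to the diagonal, to the Gauss circuit of the same diagram, which is where the parity of a
  crossing makes sense. The full bracket would be a linear combination of graphs modulo cancellation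
  of twins. Composing it with the linear map that sends a graph to 1 exactly when it does not reduce
  to a solvable one leaves a single number to follow, and the comparison of normal forms shrinks to
  one confluence statement. Working modulo 2 is forced by the third move: if its three vertices are
  even, three states on either side coincide with a single state on the other. The two deleted rules
  would rewrite sums and products of bits into Boolean operations, out of reach of ring
  normalisation.\<close>

declare add_bit_eq_xor [simp del] mult_bit_eq_and [simp del]

section \<open>Naji's equations\<close>

text \<open>For oriented chords, \<open>\<beta> x y\<close> says whether the tail of \<open>y\<close> lies to the right of \<open>x\<close>;
  the three clauses are Naji's equations over the field with two elements.\<close>

definition naji_solution :: "'a set \<Rightarrow> ('a \<Rightarrow> 'a \<Rightarrow> bool) \<Rightarrow> ('a \<Rightarrow> 'a \<Rightarrow> bool) \<Rightarrow> bool" where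
  "naji_solution S a \<beta> \<longleftrightarrow>
     (\<forall>x\<in>S. \<forall>y\<in>S. x \<noteq> y \<longrightarrow> a x y \<longrightarrow> \<beta> x y \<noteq> \<beta> y x) \<and>
     (\<forall>x\<in>S. \<forall>y\<in>S. \<forall>z\<in>S. x \<noteq> y \<longrightarrow> z \<noteq> x \<longrightarrow> z \<noteq> y \<longrightarrow>
        a x y \<longrightarrow> \<not> a z x \<longrightarrow> \<not> a z y \<longrightarrow> \<beta> z x = \<beta> z y) \<and>
     (\<forall>x\<in>S. \<forall>y\<in>S. \<forall>z\<in>S. x \<noteq> y \<longrightarrow> z \<noteq> x \<longrightarrow> z \<noteq> y \<longrightarrow>
        \<not> a x y \<longrightarrow> a z x \<longrightarrow> a z y \<longrightarrow> (\<beta> x y = \<beta> y x) = (\<beta> z x \<noteq> \<beta> z y))"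

definition naji :: "'a set \<Rightarrow> ('a \<Rightarrow> 'a \<Rightarrow> bool) \<Rightarrow> bool" where
  "naji S a \<longleftrightarrow> (\<exists>\<beta>. naji_solution S a \<beta>)"

lemma naji_solutionI:
  assumes "\<And>x y. x \<in> S \<Longrightarrow> y \<in> S \<Longrightarrow> x \<noteq> y \<Longrightarrow> a x y \<Longrightarrow> \<beta> x y \<noteq> \<beta> y x"
    and "\<And>x y z. x \<in> S \<Longrightarrow> y \<in> S \<Longrightarrow> z \<in> S \<Longrightarrow> x \<noteq> y \<Longrightarrow> z \<noteq> x \<Longrightarrow> z \<noteq> y \<Longrightarrow>
          a x y \<Longrightarrow> \<not> a z x \<Longrightarrow> \<not> a z y \<Longrightarrow> \<beta> z x = \<beta> z y"
    and "\<And>x y z. x \<in> S \<Longrightarrow> y \<in> S \<Longrightarrow> z \<in> S \<Longrightarrow> x \<noteq> y \<Longrightarrow> z \<noteq> x \<Longrightarrow> z \<noteq> y \<Longrightarrow>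
          \<not> a x y \<Longrightarrow> a z x \<Longrightarrow> a z y \<Longrightarrow> (\<beta> x y = \<beta> y x) = (\<beta> z x \<noteq> \<beta> z y)"
  shows "naji_solution S a \<beta>"
  unfolding naji_solution_def by (intro conjI ballI impI) (rule assms; assumption)+

lemma naji_solutionD:
  assumes "naji_solution S a \<beta>"
  shows "x \<in> S \<Longrightarrow> y \<in> S \<Longrightarrow> x \<noteq> y \<Longrightarrow> a x y \<Longrightarrow> \<beta> x y \<noteq> \<beta> y x"
    and "x \<in> S \<Longrightarrow> y \<in> S \<Longrightarrow> z \<in> S \<Longrightarrow> x \<noteq> y \<Longrightarrow> z \<noteq> x \<Longrightarrow> z \<noteq> y \<Longrightarrow>
          a x y \<Longrightarrow> \<not> a z x \<Longrightarrow> \<not> a z y \<Longrightarrow> \<beta> z x = \<beta> z y"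
    and "x \<in> S \<Longrightarrow> y \<in> S \<Longrightarrow> z \<in> S \<Longrightarrow> x \<noteq> y \<Longrightarrow> z \<noteq> x \<Longrightarrow> z \<noteq> y \<Longrightarrow>
          \<not> a x y \<Longrightarrow> a z x \<Longrightarrow> a z y \<Longrightarrow> (\<beta> x y = \<beta> y x) = (\<beta> z x \<noteq> \<beta> z y)"
proof -
  note a = assms[unfolded naji_solution_def]
  note a1 = conjunct1[OF a, rule_format] and a2 = conjunct1[OF conjunct2[OF a], rule_format]
    and a3 = conjunct2[OF conjunct2[OF a], rule_format]
  show "x \<in> S \<Longrightarrow> y \<in> S \<Longrightarrow> x \<noteq> y \<Longrightarrow> a x y \<Longrightarrow> \<beta> x y \<noteq> \<beta> y x"
    by (rule a1)
  show "x \<in> S \<Longrightarrow> y \<in> S \<Longrightarrow> z \<in> S \<Longrightarrow> x \<noteq> y \<Longrightarrow> z \<noteq> x \<Longrightarrow> z \<noteq> y \<Longrightarrow>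
          a x y \<Longrightarrow> \<not> a z x \<Longrightarrow> \<not> a z y \<Longrightarrow> \<beta> z x = \<beta> z y"
    by (rule a2)
  show "x \<in> S \<Longrightarrow> y \<in> S \<Longrightarrow> z \<in> S \<Longrightarrow> x \<noteq> y \<Longrightarrow> z \<noteq> x \<Longrightarrow> z \<noteq> y \<Longrightarrow>
          \<not> a x y \<Longrightarrow> a z x \<Longrightarrow> a z y \<Longrightarrow> (\<beta> x y = \<beta> y x) = (\<beta> z x \<noteq> \<beta> z y)"
    by (rule a3)
qed

text \<open>The equations mention only distinct vertices, so agreement off the diagonal is enough.
  With \<open>f = id\<close> this is how diagonal entries get discarded later.\<close>

lemma naji_pull:
  assumes "naji S' a'" "inj_on f S" "f ` S \<subseteq> S'"
    and a: "\<And>x y. x \<in> S \<Longrightarrow> y \<in> S \<Longrightarrow> x \<noteq> y \<Longrightarrow> a' (f x) (f y) = a x y"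
  shows "naji S a"
proof -
  obtain \<beta> where b: "naji_solution S' a' \<beta>"
    using assms(1) unfolding naji_def by blast
  have inj: "f x \<noteq> f y" if "x \<in> S" "y \<in> S" "x \<noteq> y" for x y
    using that assms(2) by (auto simp: inj_on_def)
  have mem: "f x \<in> S'" if "x \<in> S" for x using that assms(3) by auto
  have "naji_solution S a (\<lambda>x y. \<beta> (f x) (f y))"
    by (rule naji_solutionI) (rule naji_solutionD[OF b]; simp add: mem inj a)+
  then show ?thesis unfolding naji_def by blast
qed

lemma naji_mono: "naji S' a \<Longrightarrow> S \<subseteq> S' \<Longrightarrow> naji S a"
  by (rule naji_pull[where f = id]) auto

text \<open>On chord diagrams, complementing at \<open>v\<close> reverses the arc to the right of \<open>v\<close>; following
  the tails through this reversal yields the new solution \<open>\<gamma>\<close>.\<close>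

lemma naji_local_complement:
  assumes "naji S a" "v \<in> S" and sym: "\<And>x y. x \<in> S \<Longrightarrow> y \<in> S \<Longrightarrow> a x y = a y x"
  shows "naji S (\<lambda>x y. a x y \<noteq> (x \<noteq> v \<and> y \<noteq> v \<and> a x v \<and> a v y))"
proof -
  obtain \<beta> where b: "naji_solution S a \<beta>"
    using assms(1) unfolding naji_def by blast
  note b1 = naji_solutionD(1)[OF b] and b2 = naji_solutionD(2)[OF b] and b3 = naji_solutionD(3)[OF b]
  \<comment> \<open>\<open>\<rho> x\<close> says that the tail of \<open>x\<close> is on the
    reversed arc. The vertex \<open>v\<close> is excluded because the equations leave
    \<open>\<beta> v v\<close> free.\<close>
  define \<rho> where "\<rho> x \<longleftrightarrow> x \<noteq> v \<and> \<beta> v x" for x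
  \<comment> \<open>A chord crossing \<open>v\<close> has one end on the reversed arc, so exactly
    the tails on that arc change sides of it. A chord not crossing \<open>v\<close> lies on the arc
    iff its tail does; it is then turned around as a whole and every tail changes sides.\<close>
  define \<gamma> where "\<gamma> x y \<longleftrightarrow> (if x = v then \<beta> x y else \<beta> x y \<noteq> (if a x v then \<rho> y else \<rho> x))" for x y
  define a' where "a' x y \<longleftrightarrow> a x y \<noteq> (x \<noteq> v \<and> y \<noteq> v \<and> a x v \<and> a v y)" for x y
  note defs = \<gamma>_def \<rho>_def a'_def
  have "naji_solution S a' \<gamma>"
  proof (rule naji_solutionI)
    fix x y assume xy: "x \<in> S" "y \<in> S" "x \<noteq> y" and a': "a' x y"
    have s: "a y x = a x y" "a v x = a x v" "a v y = a y v" using sym assms(2) xy by auto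
    show "\<gamma> x y \<noteq> \<gamma> y x"
    proof (cases "x = v \<or> y = v")
      case True
      then show ?thesis using a' xy s b1[OF xy] unfolding defs by auto
    next
      case False
      then have ne: "x \<noteq> v" "y \<noteq> v" by auto
      then show ?thesis using a' xy(3) s b1[OF xy] b2[OF xy(1,2) assms(2)] b3[OF xy(1,2) assms(2)]
        unfolding defs by (cases "a x v"; cases "a y v") auto
    qed
  next
    fix x y z assume S: "x \<in> S" "y \<in> S" "z \<in> S" and ne: "x \<noteq> y" "z \<noteq> x" "z \<noteq> y"
    and a': "a' x y" "\<not> a' z x" "\<not> a' z y"
    have s: "a y x = a x y" "a v x = a x v" "a v y = a y v" "a v z = a z v" "a x z = a z x" "a y z = a z y"
      using sym assms(2) S by auto
    consider "z = v" | "x = v" | "y = v" | "x \<noteq> v" "y \<noteq> v" "z \<noteq> v" by blast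
    then show "\<gamma> z x = \<gamma> z y"
    proof cases
      case 4
      \<comment> \<open>Exactly one of the two vertices meets \<open>v\<close>. The third equation
        centred at \<open>x\<close>, once for the pair \<open>y, v\<close> and once for
        \<open>y, z\<close>, makes the link. \<open>x\<close> and \<open>y\<close> are generalised
        because both orders occur below.\<close>
      have *: "(\<beta> z x = \<beta> z y) = (\<beta> v x = \<beta> v y)" if h: "a x v" "\<not> a y v" "a z v" "a x y" "a z x" "\<not> a z y" 
        and S: "x \<in> S" "y \<in> S" and n: "x \<noteq> y" "z \<noteq> x" "z \<noteq> y" "x \<noteq> v" "y \<noteq> v" for x y
      proof -
        have s: "a y x" "a v x" "\<not> a v y" "a v z" "a x z" "\<not> a y z"
          using sym[OF assms(2)] sym[OF \<open>z \<in> S\<close>] sym S \<open>z \<in> S\<close> h by auto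
        have "\<beta> x v \<noteq> \<beta> v x" "\<beta> x z \<noteq> \<beta> z x" "\<beta> y v = \<beta> y z" 
          using b1[of x v] b1[of x z] b2[of v z y] h s n S assms(2) \<open>z \<in> S\<close> \<open>z \<noteq> v\<close> by auto
        moreover have "(\<beta> y v = \<beta> v y) = (\<beta> x y \<noteq> \<beta> x v)" "(\<beta> y z = \<beta> z y) = (\<beta> x y \<noteq> \<beta> x z)"
          using b3[of y v x] b3[of y z x] h s n S assms(2) \<open>z \<in> S\<close> by auto
        ultimately show ?thesis by argo
      qed
      note d = b2[OF S ne] b2[OF S(1,2) assms(2) ne(1)] b3[OF S ne] b3[OF S(1,2) assms(2) ne(1)]
      show ?thesis
      proof (cases "a z v")
        case True
        then have g: "\<gamma> z x = (\<beta> z x \<noteq> \<beta> v x)" "\<gamma> z y = (\<beta> z y \<noteq> \<beta> v y)" using 4 by (auto simp: defs)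
        have "a z x = a x v" "a z y = a y v" using a' 4 s True by (auto simp: defs)
        then consider "a x v" "a y v" "a z x" "a z y" "\<not> a x y" | "a x v" "\<not> a y v" "a z x" "\<not> a z y" "a x y"
          | "\<not> a x v" "a y v" "\<not> a z x" "a z y" "a x y" | "\<not> a x v" "\<not> a y v" "\<not> a z x" "\<not> a z y" "a x y"
          using a' 4 s by (auto simp: defs)
        then show ?thesis
        proof cases
          case 1 then show ?thesis using d 4 s unfolding g by auto
        next
          case 2 then show ?thesis using *[of x y] True S 4 ne unfolding g by auto
        next
          case 3 then show ?thesis using *[of y x] True S 4 ne s unfolding g by auto
        next
          case 4 then show ?thesis using d \<open>x \<noteq> v\<close> \<open>y \<noteq> v\<close> s unfolding g by auto
        qed
      next
        case False
        then have g: "\<gamma> z x = (\<beta> z x \<noteq> \<beta> v z)" "\<gamma> z y = (\<beta> z y \<noteq> \<beta> v z)" using 4 by (auto simp: defs)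
        have h: "\<not> a z x" "\<not> a z y" using a' False by (auto simp: defs)
        show ?thesis
        proof (cases "a x y")
          case True then show ?thesis using d h unfolding g by auto
        next
          case xy: False
          then have "a x v" "a y v" using a' s by (auto simp: defs)
          then show ?thesis using b2[OF S(1) assms(2) S(3)] b2[OF S(2) assms(2) S(3)] 4 ne h False
            unfolding g by auto
        qed
      qed
    qed (use a' ne s b2[OF S] in \<open>auto simp: defs\<close>)
  next
    fix x y z assume S: "x \<in> S" "y \<in> S" "z \<in> S" and ne: "x \<noteq> y" "z \<noteq> x" "z \<noteq> y"
    and a': "\<not> a' x y" "a' z x" "a' z y"
    have s: "a y x = a x y" "a v x = a x v" "a v y = a y v" "a v z = a z v" "a x z = a z x" "a y z = a z y"
      using sym assms(2) S by auto
    consider "z = v" | "x = v" | "y = v" | "x \<noteq> v" "y \<noteq> v" "z \<noteq> v" by blast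
    then show "(\<gamma> x y = \<gamma> y x) = (\<gamma> z x \<noteq> \<gamma> z y)"
    proof cases
      case 1 then show ?thesis using a' ne s b1[OF S(1,2)] by (auto simp: defs)
    next
      case 2 then show ?thesis using a' ne s b3[OF S] by (auto simp: defs)
    next
      case 3 then show ?thesis using a' ne s b3[OF S] by (auto simp: defs)
    next
      case 4
      \<comment> \<open>The mixed case again; this time the third equation is used at
        \<open>v\<close> for the pair \<open>x, z\<close> and at \<open>z\<close> for the pair
        \<open>v, y\<close>.\<close>
      have *: "(\<beta> x y = \<beta> y x) = ((\<beta> z x \<noteq> \<beta> v x) \<noteq> (\<beta> z y \<noteq> \<beta> v y))" 
        if h: "a x v" "\<not> a y v" "a z v" "\<not> a x y" "\<not> a z x" "a z y" 
        and S: "x \<in> S" "y \<in> S" and n: "x \<noteq> y" "z \<noteq> x" "z \<noteq> y" "x \<noteq> v" "y \<noteq> v" for x y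
      proof -
        have s: "\<not> a y x" "a v x" "\<not> a v y" "a v z" "\<not> a x z" "a y z"
          using sym[OF assms(2)] sym[OF \<open>z \<in> S\<close>] sym S \<open>z \<in> S\<close> h by auto
        have "\<beta> z v \<noteq> \<beta> v z" "\<beta> x z = \<beta> x y" "\<beta> y v = \<beta> y x" 
          using b1[of z v] b2[of z y x] b2[of v x y] h s n S assms(2) \<open>z \<in> S\<close> \<open>z \<noteq> v\<close> by auto
        moreover have "(\<beta> x z = \<beta> z x) = (\<beta> v x \<noteq> \<beta> v z)" "(\<beta> v y = \<beta> y v) = (\<beta> z v \<noteq> \<beta> z y)"
          using b3[of x z v] b3[of v y z] h s n S assms(2) \<open>z \<in> S\<close> \<open>z \<noteq> v\<close> by auto
        ultimately show ?thesis by argo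
      qed
      have g: "\<gamma> x y = (\<beta> x y \<noteq> (if a x v then \<beta> v y else \<beta> v x))" 
        "\<gamma> y x = (\<beta> y x \<noteq> (if a y v then \<beta> v x else \<beta> v y))" 
        "\<gamma> z x = (\<beta> z x \<noteq> (if a z v then \<beta> v x else \<beta> v z))" 
        "\<gamma> z y = (\<beta> z y \<noteq> (if a z v then \<beta> v y else \<beta> v z))" using 4 by (auto simp: defs)
      have n: "a x y = (a x v \<and> a y v)" "a z x = (\<not> (a x v \<and> a z v))" "a z y = (\<not> (a y v \<and> a z v))"
        using a' 4 s by (auto simp: defs)
      show ?thesis
      proof (cases "a z v")
        case z: True
        consider "a x v" "a y v" "\<not> a z x" "\<not> a z y" "a x y" | "a x v" "\<not> a y v" "\<not> a z x" "a z y" "\<not> a x y"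
          | "\<not> a x v" "a y v" "a z x" "\<not> a z y" "\<not> a x y" | "\<not> a x v" "\<not> a y v" "a z x" "a z y" "\<not> a x y"
          using n z by auto
        then show ?thesis
        proof cases
          case 1 then show ?thesis using b1[OF S(1,2)] b2[OF S] z ne unfolding g by auto
        next
          case 2 then show ?thesis using *[of x y] S 4 ne z unfolding g by auto
        next
          case 3 then show ?thesis using *[of y x] S 4 ne z s unfolding g by auto
        next
          case 4 then show ?thesis using b3[OF S] ne z unfolding g by auto
        qed
      next
        case z: False
        then have zz: "a z x" "a z y" using n by auto
        show ?thesis
        proof (cases "a x v \<and> a y v")
          case True
          then have "a x y" using n by auto
          have "(\<beta> v z = \<beta> z v) = (\<beta> x v \<noteq> \<beta> x z)" "(\<beta> v z = \<beta> z v) = (\<beta> y v \<noteq> \<beta> y z)" 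
            using b3[OF assms(2) S(3) S(1)] b3[OF assms(2) S(3) S(2)] 4 ne z zz s True by auto
          moreover have "\<beta> x y \<noteq> \<beta> y x" "\<beta> x v \<noteq> \<beta> v x" "\<beta> y v \<noteq> \<beta> v y" "\<beta> x z \<noteq> \<beta> z x" "\<beta> y z \<noteq> \<beta> z y"
            using b1[OF S(1,2) ne(1) \<open>a x y\<close>] b1[OF S(1) assms(2)] b1[OF S(2) assms(2)]
              b1[OF S(1,3)] b1[OF S(2,3)] True zz s 4 ne by auto
          moreover have "\<gamma> x y = (\<beta> x y \<noteq> \<beta> v y)" "\<gamma> y x = (\<beta> y x \<noteq> \<beta> v x)" 
             "\<gamma> z x = (\<beta> z x \<noteq> \<beta> v z)" "\<gamma> z y = (\<beta> z y \<noteq> \<beta> v z)" using g True z by auto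
          ultimately show ?thesis by argo
        next
          case False
          then have "\<not> a x y" using n by auto
          have "\<beta> v x = \<beta> v y" if "\<not> a x v" "\<not> a y v"
            using b2[OF S(3) S(1) assms(2)] b2[OF S(3) S(2) assms(2)] that 4 ne z zz s by auto
          then show ?thesis using b3[OF S ne \<open>\<not> a x y\<close> zz] False z unfolding g by auto
        qed
      qed
    qed
  qed
  then show ?thesis unfolding naji_def a'_def by blast
qed

fun pendant_adj :: "('a \<Rightarrow> 'a \<Rightarrow> bool) \<Rightarrow> 'a + 'a \<Rightarrow> 'a + 'a \<Rightarrow> bool" where
  "pendant_adj a (Inl x) (Inl y) = a x y"
| "pendant_adj a (Inl x) (Inr y) = (x = y)"
| "pendant_adj a (Inr x) (Inl y) = (x = y)"
| "pendant_adj a (Inr x) (Inr y) = False"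

text \<open>The new chord at \<open>x\<close> is a short one around the tail of \<open>x\<close>.\<close>

lemma naji_pendants:
  assumes "naji V a" and sym: "\<And>x y. x \<in> V \<Longrightarrow> y \<in> V \<Longrightarrow> a x y = a y x"
  shows "naji (Inl ` V \<union> Inr ` V) (pendant_adj a)"
proof -
  obtain \<beta> where b: "naji_solution V a \<beta>"
    using assms(1) unfolding naji_def by blast
  note b1 = naji_solutionD(1)[OF b] and b2 = naji_solutionD(2)[OF b] and b3 = naji_solutionD(3)[OF b]
  \<comment> \<open>The short chord at \<open>y\<close> lies next to the tail of \<open>y\<close>,
    hence on the same side of any other \<open>x\<close>; it is oriented so that the only tail to
    its right is that of \<open>y\<close>.\<close>
  define \<gamma> where "\<gamma> p q = (case p of Inl x \<Rightarrow> (case q of Inl y \<Rightarrow> \<beta> x y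
     | Inr y \<Rightarrow> x \<noteq> y \<and> \<beta> x y) | Inr x \<Rightarrow> q = Inl x)" 
    for p q :: "'a + 'a"
  have [simp]: "\<gamma> (Inl x) (Inl y) = \<beta> x y" "\<gamma> (Inl x) (Inr y) = (x \<noteq> y \<and> \<beta> x y)" 
     "\<gamma> (Inr x) (Inl y) = (x = y)" "\<gamma> (Inr x) (Inr y) = False" for x y
    unfolding \<gamma>_def by auto
  have "naji_solution (Inl ` V \<union> Inr ` V) (pendant_adj a) \<gamma>"
  proof (rule naji_solutionI)
    fix p q :: "'a + 'a"
    assume "p \<in> Inl ` V \<union> Inr ` V" "q \<in> Inl ` V \<union> Inr ` V" "p \<noteq> q" "pendant_adj a p q"
    then show "\<gamma> p q \<noteq> \<gamma> q p" using b1 by (cases p; cases q) auto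
  next
    fix p q r :: "'a + 'a"
    assume "p \<in> Inl ` V \<union> Inr ` V" "q \<in> Inl ` V \<union> Inr ` V" "r \<in> Inl ` V \<union> Inr ` V" "p \<noteq> q" "r \<noteq> p" "r \<noteq> q"
      "pendant_adj a p q" "\<not> pendant_adj a r p" "\<not> pendant_adj a r q"
    note H = this
    consider x y z where "p = Inl x" "q = Inl y" "r = Inl z" | "\<not> isl p \<or> \<not> isl q \<or> \<not> isl r"
      by (cases p; cases q; cases r) auto
    then show "\<gamma> r p = \<gamma> r q"
    proof cases
      case 1
      then show ?thesis using b2[of x y z] H by auto
    next
      case 2
      then show ?thesis using H by (cases p; cases q; cases r) auto
    qed
  next
    fix p q r :: "'a + 'a"
    assume "p \<in> Inl ` V \<union> Inr ` V" "q \<in> Inl ` V \<union> Inr ` V" "r \<in> Inl ` V \<union> Inr ` V" "p \<noteq> q" "r \<noteq> p" "r \<noteq> q"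
      "\<not> pendant_adj a p q" "pendant_adj a r p" "pendant_adj a r q"
    note H = this
    then obtain z where r: "r = Inl z" by (cases p; cases q; cases r) auto
    consider x y where "p = Inl x" "q = Inl y" | x y where "p = Inl x" "q = Inr y"
      | x y where "p = Inr x" "q = Inl y" | x y where "p = Inr x" "q = Inr y"
      by (cases p; cases q) auto
    then show "(\<gamma> p q = \<gamma> q p) = (\<gamma> r p \<noteq> \<gamma> r q)"
    proof cases
      case 1
      then show ?thesis using b3[of x y z] H r by auto
    next
      case 2
      then show ?thesis using b1[of z x] H r by auto
    next
      case 3
      then show ?thesis using b1[of z y] H r by auto
    next
      case 4
      then show ?thesis using H r by auto
    qed
  qed
  then show ?thesis unfolding naji_def by blast
qed

section \<open>Cancellation of twins\<close>

definition twins :: "('a \<Rightarrow> 'a \<Rightarrow> bool) \<Rightarrow> 'a set \<Rightarrow> 'a \<Rightarrow> 'a \<Rightarrow> bool" where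
  "twins a S u v \<longleftrightarrow> u \<in> S \<and> v \<in> S \<and> u \<noteq> v \<and> (\<forall>t\<in>S - {u, v}. a u t = a v t \<and> a t u = a t v)"

text \<open>A second Reidemeister move cancels a pair of twins. Arbitrary twin pairs can be added, so the
  property of satisfying Naji's equations has to be taken up to cancellation.\<close>

inductive naji_reducible :: "('a \<Rightarrow> 'a \<Rightarrow> bool) \<Rightarrow> 'a set \<Rightarrow> bool" for a where
  base: "naji S a \<Longrightarrow> naji_reducible a S"
| step: "twins a S u v \<Longrightarrow> naji_reducible a (S - {u, v}) \<Longrightarrow> naji_reducible a S"

lemma naji_reducible_pull:
  assumes "naji_reducible a' S'" "bij_betw f S S'"
    and "\<And>x y. x \<in> S \<Longrightarrow> y \<in> S \<Longrightarrow> x \<noteq> y \<Longrightarrow> a' (f x) (f y) = a x y"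
  shows "naji_reducible a S"
  using assms
proof (induction arbitrary: S rule: naji_reducible.induct)
  case (base S')
  then have "naji S a"
    by (intro naji_pull[OF base(1), of f]) (auto simp: bij_betw_def)
  then show ?case by (rule naji_reducible.base)
next
  case (step S' u v)
  from step.hyps(1) have uv: "u \<in> S'" "v \<in> S'" "u \<noteq> v" unfolding twins_def by auto
  with step.prems(1) obtain u0 v0 where 0: "u0 \<in> S" "v0 \<in> S" "f u0 = u" "f v0 = v"
    by (metis bij_betw_def image_iff)
  have inj: "inj_on f S" and im: "f ` S = S'" using step.prems(1) by (auto simp: bij_betw_def)
  have fne: "f t \<noteq> u \<and> f t \<noteq> v \<and> f t \<in> S'" if "t \<in> S" "t \<noteq> u0" "t \<noteq> v0" for t
    using that 0 inj im by (metis imageI inj_onD)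
  have "twins a S u0 v0"
    unfolding twins_def
  proof (intro conjI ballI)
    fix t assume t: "t \<in> S - {u0, v0}"
    then have "f t \<in> S' - {u, v}" using fne by auto
    then have "a' u (f t) = a' v (f t)" "a' (f t) u = a' (f t) v" using step.hyps(1) unfolding twins_def by auto
    then show "a u0 t = a v0 t" "a t u0 = a t v0"
      using step.prems(2)[of u0 t] step.prems(2)[of t u0] step.prems(2)[of v0 t] step.prems(2)[of t v0] t 0 by auto
  qed (use 0 uv in auto)
  moreover have "bij_betw f (S - {u0, v0}) (S' - {u, v})"
  proof -
    have "f ` (S - {u0, v0}) = S' - {u, v}"
      using inj im 0 by (auto simp: inj_on_def)
    then show ?thesis using inj by (auto simp: bij_betw_def intro: inj_on_subset)
  qed
  then have "naji_reducible a (S - {u0, v0})"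
    using step.IH step.prems(2) by auto
  ultimately show ?case by (rule naji_reducible.step)
qed

lemma naji_reducible_cong:
  assumes "\<And>x y. x \<in> S \<Longrightarrow> y \<in> S \<Longrightarrow> x \<noteq> y \<Longrightarrow> a' x y = a x y"
  shows "naji_reducible a' S = naji_reducible a S"
  using naji_reducible_pull[of a' S id S a] naji_reducible_pull[of a S id S a'] assms by auto

lemma twins_subset:
  "twins a S u v \<Longrightarrow> T \<subseteq> S \<Longrightarrow> u \<in> T \<Longrightarrow> v \<in> T \<Longrightarrow> twins a T u v"
  unfolding twins_def by blast

lemma twins_sym: "twins a S u v \<Longrightarrow> twins a S v u"
  unfolding twins_def by blast

text \<open>Two twins \<open>v\<close>, \<open>x\<close> of the same \<open>u\<close> have equal
  rows and columns away from \<open>u\<close>, so renaming one into the other identifies the two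
  remainders.\<close>

lemma naji_reducible_shift:
  assumes "naji_reducible a (S - {u, v})" "twins a S u v" "twins a S u x" "x \<noteq> v"
  shows "naji_reducible a (S - {u, x})"
proof (rule naji_reducible_pull[OF assms(1), where f = "\<lambda>t. if t = v then x else t"])
  show "bij_betw (\<lambda>t. if t = v then x else t) (S - {u, x}) (S - {u, v})"
    by (rule bij_betw_byWitness[where f' = "\<lambda>t. if t = x then v else t"])
      (use assms in \<open>auto simp: twins_def\<close>)
  have e: "a v t = a x t" "a t v = a t x" if "t \<in> S" "t \<noteq> u" "t \<noteq> v" "t \<noteq> x" for t
    using that assms(2,3) unfolding twins_def by blast+
  show "a (if s = v then x else s) (if t = v then x else t) = a s t"
    if "s \<in> S - {u, x}" "t \<in> S - {u, x}" "s \<noteq> t" for s t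
    using that e by auto
qed

text \<open>Confluence of the cancellation: disjoint pairs commute, and pairs sharing one vertex are
  covered by \<open>naji_reducible_shift\<close>. Consequently the order of cancellations is
  immaterial, which replaces uniqueness of an irreducible form.\<close>

lemma naji_reducible_delete_twins:
  assumes "naji_reducible a S" "twins a S x y"
  shows "naji_reducible a (S - {x, y})"
  using assms
proof (induction arbitrary: x y rule: naji_reducible.induct)
  case (base S)
  then show ?case by (intro naji_reducible.base naji_mono[OF base(1)]) auto
next
  case (step S u v)
  consider "{x, y} = {u, v}" | "{x, y} \<inter> {u, v} = {}" | "x = u" "y \<noteq> v" | "x = v" "y \<noteq> u"
    | "y = u" "x \<noteq> v" | "y = v" "x \<noteq> u" by blast
  then show ?case
  proof cases
    case 1
    then show ?thesis using step by simp
  next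
    case 2
    have ne: "x \<in> S" "y \<in> S" "u \<in> S" "v \<in> S" using step.hyps step.prems by (auto simp: twins_def)
    have "naji_reducible a (S - {u, v} - {x, y})"
      by (rule step.IH, rule twins_subset[OF step.prems]) (use 2 ne in auto)
    moreover have "S - {u, v} - {x, y} = S - {x, y} - {u, v}" by auto
    moreover have "twins a (S - {x, y}) u v"
      by (rule twins_subset[OF step.hyps(1)]) (use 2 ne in auto)
    ultimately show ?thesis using naji_reducible.step by metis
  next
    case 3
    then show ?thesis using naji_reducible_shift[OF step.hyps(2,1), of y] step.prems by simp
  next
    case 4
    then show ?thesis using naji_reducible_shift[of a S v u y] step.hyps step.prems twins_sym
      by (metis insert_commute)
  next
    case 5
    then show ?thesis using naji_reducible_shift[of a S u v x] step.hyps step.prems twins_sym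
      by (metis insert_commute)
  next
    case 6
    then show ?thesis using naji_reducible_shift[of a S v u x] step.hyps step.prems twins_sym
      by (metis insert_commute)
  qed
qed

lemma naji_reducible_twins_iff:
  "twins a S u v \<Longrightarrow> naji_reducible a (S - {u, v}) = naji_reducible a S"
  using naji_reducible_delete_twins naji_reducible.step by metis

section \<open>Schur complements over the field with two elements\<close>

lemma bit_add_self [simp]: "(x :: bit) + x = 0" "x + (x + y) = y"
  by (cases x; cases y; simp)+

lemma bit_add_eq_0: "(x :: bit) + y = 0 \<longleftrightarrow> x = y"
  by (cases x; cases y; simp)

lemma bit_mult_self [simp]: "(x :: bit) * x = x" "x * (x * y) = x * y"
  by (cases x; simp)+

lemma bit_add_move: "(x :: bit) + y = z \<longleftrightarrow> x = y + z"
  by (cases x; cases y; cases z; simp)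

text \<open>Matrices are functions on an arbitrary index set: passing to a principal submatrix only
  shrinks \<open>V\<close>, and no reindexing occurs when vertices are deleted.\<close>

definition mulv :: "'a set \<Rightarrow> ('a \<Rightarrow> 'a \<Rightarrow> bit) \<Rightarrow> ('a \<Rightarrow> bit) \<Rightarrow> 'a \<Rightarrow> bit" where
  "mulv V N x i = (\<Sum>k\<in>V. N i k * x k)"

lemma mulv_cong:
  "(\<And>k. k \<in> V \<Longrightarrow> N i k = N' i k) \<Longrightarrow> (\<And>k. k \<in> V \<Longrightarrow> x k = x' k) \<Longrightarrow> mulv V N x i = mulv V N' x' i"
  unfolding mulv_def by (intro sum.cong) auto

lemma mulv_upd [simp]: "v \<notin> V \<Longrightarrow> mulv V N (x(v := c)) i = mulv V N x i"
  by (rule mulv_cong) auto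

lemma mulv_remove:
  "finite V \<Longrightarrow> v \<in> V \<Longrightarrow> mulv V N x i = N i v * x v + mulv (V - {v}) N x i"
  unfolding mulv_def by (simp add: sum.remove)

lemma mulv_restrict:
  "finite V \<Longrightarrow> E \<subseteq> V \<Longrightarrow> (\<And>k. k \<in> V - E \<Longrightarrow> x k = 0) \<Longrightarrow> mulv V N x i = mulv E N x i"
  unfolding mulv_def by (intro sum.mono_neutral_right) auto

lemma mulv_add: "mulv V N (\<lambda>k. x k + y k) i = mulv V N x i + mulv V N y i"
  unfolding mulv_def by (simp add: distrib_left sum.distrib)

lemma mulv_mat_add: "mulv V (\<lambda>i j. M i j + N i j) x i = mulv V M x i + mulv V N x i"
  unfolding mulv_def by (simp add: distrib_right sum.distrib)

lemma mulv_outer: "mulv V (\<lambda>i j. a i * b j) x i = a i * (\<Sum>k\<in>V. b k * x k)"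
  unfolding mulv_def by (simp add: sum_distrib_left mult.assoc)

lemma mulv_unit:
  assumes "finite V" "j \<in> V" "\<And>k. k \<in> V \<Longrightarrow> x k = of_bool (k = j)"
  shows "mulv V N x i = N i j"
proof -
  have "mulv V N x i = (\<Sum>k\<in>V. if k = j then N i k else 0)"
    unfolding mulv_def by (rule sum.cong) (auto simp: assms)
  then show ?thesis using assms by simp
qed

definition nonsing :: "'a set \<Rightarrow> ('a \<Rightarrow> 'a \<Rightarrow> bit) \<Rightarrow> bool" where
  "nonsing E N \<longleftrightarrow> (\<forall>x. (\<forall>i\<in>E. mulv E N x i = 0) \<longrightarrow> (\<forall>i\<in>E. x i = 0))"

text \<open>The graph of the Schur complement \<open>N / N\<^sub>E\<^sub>E\<close>, described by extending the unit vector of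
  \<open>j\<close> to a vector that \<open>N\<close> maps to 0 on \<open>E\<close>.\<close>

definition schur :: "'a set \<Rightarrow> 'a set \<Rightarrow> ('a \<Rightarrow> 'a \<Rightarrow> bit) \<Rightarrow> 'a \<Rightarrow> 'a \<Rightarrow> bool" where
  "schur V E N i j \<longleftrightarrow>
     (\<exists>x. (\<forall>k\<in>E. mulv V N x k = 0) \<and> (\<forall>k\<in>V - E. x k = of_bool (k = j)) \<and> mulv V N x i = 1)"

text \<open>Extension by zero. It brings \<open>nonsing\<close> into the form used for
  \<open>schur\<close>, vectors on all of \<open>V\<close> with prescribed values off
  \<open>E\<close>, so that one correspondence of vectors can transfer both.\<close>

lemma nonsing_extend:
  assumes "finite V" "E \<subseteq> V"
  shows "nonsing E N \<longleftrightarrow>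
    (\<forall>x. (\<forall>i\<in>E. mulv V N x i = 0) \<longrightarrow> (\<forall>i\<in>V - E. x i = 0) \<longrightarrow> (\<forall>i\<in>V. x i = 0))"
proof
  assume n: "nonsing E N"
  show "\<forall>x. (\<forall>i\<in>E. mulv V N x i = 0) \<longrightarrow> (\<forall>i\<in>V - E. x i = 0) \<longrightarrow> (\<forall>i\<in>V. x i = 0)"
  proof (intro allI impI)
    fix x assume x: "\<forall>i\<in>E. mulv V N x i = 0" "\<forall>i\<in>V - E. x i = 0"
    then have "\<forall>i\<in>E. mulv E N x i = 0" using mulv_restrict[OF assms, of x] by simp
    then show "\<forall>i\<in>V. x i = 0" using n x(2) unfolding nonsing_def by blast
  qed
next
  assume r: "\<forall>x. (\<forall>i\<in>E. mulv V N x i = 0) \<longrightarrow> (\<forall>i\<in>V - E. x i = 0) \<longrightarrow> (\<forall>i\<in>V. x i = 0)"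
  show "nonsing E N" unfolding nonsing_def
  proof (intro allI impI)
    fix x assume x: "\<forall>i\<in>E. mulv E N x i = 0"
    define y where "y k = (if k \<in> E then x k else 0)" for k
    have "mulv V N y i = mulv E N x i" for i
      using mulv_restrict[OF assms, of y N i] mulv_cong[of E N i N y x] by (simp add: y_def)
    then have "\<forall>i\<in>V. y i = 0" using r[rule_format, of y] x by (simp add: y_def)
    then show "\<forall>i\<in>E. x i = 0" using assms(2) unfolding y_def by (metis subsetD)
  qed
qed

text \<open>Both notions concern only the vectors mapped to 0 on \<open>E\<close>, so it suffices to
  match these, preserving their values outside \<open>E\<close> and their images there. The slack
  \<open>d i * x i\<close> admits changes of the diagonal outside \<open>E\<close>; it vanishes in
  the entry \<open>i, j\<close> because \<open>x\<close> is the unit vector of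
  \<open>j \<noteq> i\<close> there.\<close>

lemma schur_transfer:
  fixes d :: "'a \<Rightarrow> bit"
  assumes V: "finite V1" "finite V2" "E1 \<subseteq> V1" "E2 \<subseteq> V2" "V1 - E1 = V2 - E2"
    and 12: "\<And>x. (\<And>i. i \<in> E1 \<Longrightarrow> mulv V1 N1 x i = 0) \<Longrightarrow>
      \<exists>y. (\<forall>i\<in>E2. mulv V2 N2 y i = 0) \<and>
          (\<forall>i\<in>V1 - E1. y i = x i \<and> mulv V2 N2 y i = mulv V1 N1 x i + d i * x i) \<and>
          ((\<forall>i\<in>V2. y i = 0) \<longrightarrow> (\<forall>i\<in>V1. x i = 0))"
    and 21: "\<And>x. (\<And>i. i \<in> E2 \<Longrightarrow> mulv V2 N2 x i = 0) \<Longrightarrow>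
      \<exists>y. (\<forall>i\<in>E1. mulv V1 N1 y i = 0) \<and>
          (\<forall>i\<in>V1 - E1. y i = x i \<and> mulv V1 N1 y i = mulv V2 N2 x i + d i * x i) \<and>
          ((\<forall>i\<in>V1. y i = 0) \<longrightarrow> (\<forall>i\<in>V2. x i = 0))"
  shows "nonsing E1 N1 = nonsing E2 N2"
    and "i \<in> V1 - E1 \<Longrightarrow> j \<in> V1 - E1 \<Longrightarrow> i \<noteq> j \<Longrightarrow> schur V1 E1 N1 i j = schur V2 E2 N2 i j"
proof -
  show "nonsing E1 N1 = nonsing E2 N2"
  proof
    assume n: "nonsing E1 N1"
    show "nonsing E2 N2"
      unfolding nonsing_extend[OF V(2,4)]
    proof (rule allI, rule impI, rule impI)
      fix x assume x: "\<forall>i\<in>E2. mulv V2 N2 x i = 0" "\<forall>i\<in>V2 - E2. x i = 0"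
      from 21[of x] x(1) obtain y where y: "\<forall>i\<in>E1. mulv V1 N1 y i = 0" "\<forall>i\<in>V1 - E1. y i = x i"
        "(\<forall>i\<in>V1. y i = 0) \<longrightarrow> (\<forall>i\<in>V2. x i = 0)" by blast
      then show "\<forall>i\<in>V2. x i = 0" using n[unfolded nonsing_extend[OF V(1,3)]] x(2) V(5) by metis
    qed
  next
    assume n: "nonsing E2 N2"
    show "nonsing E1 N1"
      unfolding nonsing_extend[OF V(1,3)]
    proof (rule allI, rule impI, rule impI)
      fix x assume x: "\<forall>i\<in>E1. mulv V1 N1 x i = 0" "\<forall>i\<in>V1 - E1. x i = 0"
      from 12[of x] x(1) obtain y where y: "\<forall>i\<in>E2. mulv V2 N2 y i = 0" "\<forall>i\<in>V1 - E1. y i = x i"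
        "(\<forall>i\<in>V2. y i = 0) \<longrightarrow> (\<forall>i\<in>V1. x i = 0)" by blast
      then show "\<forall>i\<in>V1. x i = 0" using n[unfolded nonsing_extend[OF V(2,4)]] x(2) V(5) by metis
    qed
  qed
  assume ij: "i \<in> V1 - E1" "j \<in> V1 - E1" "i \<noteq> j"
  show "schur V1 E1 N1 i j = schur V2 E2 N2 i j"
  proof
    assume "schur V1 E1 N1 i j"
    then obtain x where x: "\<forall>k\<in>E1. mulv V1 N1 x k = 0" "\<forall>k\<in>V1 - E1. x k = of_bool (k = j)" "mulv V1 N1 x i = 1"
      unfolding schur_def by blast
    from 12[of x] x(1) obtain y where y: "\<forall>i\<in>E2. mulv V2 N2 y i = 0"
       "\<forall>i\<in>V1 - E1. y i = x i \<and> mulv V2 N2 y i = mulv V1 N1 x i + d i * x i" by blast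
    have "x i = 0" using x(2) ij by auto
    then have "mulv V2 N2 y i = 1" using y(2) ij x(3) by auto
    moreover have "\<forall>k\<in>V2 - E2. y k = of_bool (k = j)" using y(2) x(2) V(5) by auto
    ultimately show "schur V2 E2 N2 i j" unfolding schur_def using y(1) by blast
  next
    assume "schur V2 E2 N2 i j"
    then obtain x where x: "\<forall>k\<in>E2. mulv V2 N2 x k = 0" "\<forall>k\<in>V2 - E2. x k = of_bool (k = j)" "mulv V2 N2 x i = 1"
      unfolding schur_def by blast
    from 21[of x] x(1) obtain y where y: "\<forall>i\<in>E1. mulv V1 N1 y i = 0"
       "\<forall>i\<in>V1 - E1. y i = x i \<and> mulv V1 N1 y i = mulv V2 N2 x i + d i * x i" by blast
    have "x i = 0" using x(2) ij V(5) by auto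
    then have "mulv V1 N1 y i = 1" using y(2) ij x(3) by auto
    moreover have "\<forall>k\<in>V1 - E1. y k = of_bool (k = j)" using y(2) x(2) V(5) by auto
    ultimately show "schur V1 E1 N1 i j" unfolding schur_def using y(1) by blast
  qed
qed

text \<open>One step of Gaussian elimination: the equation at \<open>v\<close> determines
  \<open>x v\<close> from the other coordinates, and substituting it gives
  \<open>N'\<close>.\<close>

lemma schur_eliminate:
  fixes N :: "'a \<Rightarrow> 'a \<Rightarrow> bit"
  assumes V: "finite V" "E \<subseteq> V" and v: "v \<in> E" "N v v = 1"
  defines "N' \<equiv> \<lambda>i j. N i j + N i v * N v j"
  shows "nonsing E N = nonsing (E - {v}) N'"
    and "i \<in> V - E \<Longrightarrow> j \<in> V - E \<Longrightarrow> i \<noteq> j \<Longrightarrow> schur V E N i j = schur (V - {v}) (E - {v}) N' i j"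
proof -
  let ?W = "V - {v}"
  have m: "mulv V N x i = N i v * x v + mulv ?W N x i" for x i
    using V v by (intro mulv_remove) auto
  have m': "mulv ?W N' x i = mulv ?W N x i + N i v * mulv ?W N x v" for x i
    unfolding N'_def mulv_mat_add mulv_outer by (simp add: mulv_def)
  have A: "finite V" "finite ?W" "E \<subseteq> V" "E - {v} \<subseteq> ?W" "V - E = ?W - (E - {v})"
    using V v by auto
  have 12: "\<exists>y. (\<forall>i\<in>E - {v}. mulv ?W N' y i = 0) \<and>
          (\<forall>i\<in>V - E. y i = x i \<and> mulv ?W N' y i = mulv V N x i + 0 * x i) \<and>
          ((\<forall>i\<in>?W. y i = 0) \<longrightarrow> (\<forall>i\<in>V. x i = 0))"
    if x: "\<And>i. i \<in> E \<Longrightarrow> mulv V N x i = 0" for x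
  proof -
    have xv: "x v = mulv ?W N x v" using x[OF v(1)] v(2) by (simp add: m bit_add_eq_0)
    have "x v = 0" if "\<forall>i\<in>?W. x i = 0"
      unfolding xv using that by (simp add: mulv_def)
    moreover have "mulv ?W N' x i = mulv V N x i" for i unfolding m m' xv by (simp add: add.commute)
    ultimately show ?thesis using x by (intro exI[of _ x]) auto
  qed
  have 21: "\<exists>y. (\<forall>i\<in>E. mulv V N y i = 0) \<and>
          (\<forall>i\<in>V - E. y i = x i \<and> mulv V N y i = mulv ?W N' x i + 0 * x i) \<and>
          ((\<forall>i\<in>V. y i = 0) \<longrightarrow> (\<forall>i\<in>?W. x i = 0))"
    if x: "\<And>i. i \<in> E - {v} \<Longrightarrow> mulv ?W N' x i = 0" for x
  proof -
    let ?y = "x(v := mulv ?W N x v)"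
    have "mulv V N ?y i = mulv ?W N' x i" for i unfolding m m' by (simp add: add.commute)
    moreover have "mulv ?W N' x v = 0" unfolding m' using v(2) by simp
    ultimately have "\<forall>i\<in>E. mulv V N ?y i = 0" using x by auto
    moreover have "\<forall>i\<in>V - E. ?y i = x i" using v by auto
    moreover have "(\<forall>i\<in>V. ?y i = 0) \<longrightarrow> (\<forall>i\<in>?W. x i = 0)" by auto
    ultimately show ?thesis using \<open>\<And>i. mulv V N ?y i = mulv ?W N' x i\<close> by (intro exI[of _ ?y]) auto
  qed
  show "nonsing E N = nonsing (E - {v}) N'"
    using schur_transfer(1)[OF A 12 21] .
  show "i \<in> V - E \<Longrightarrow> j \<in> V - E \<Longrightarrow> i \<noteq> j \<Longrightarrow> schur V E N i j = schur ?W (E - {v}) N' i j"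
    using schur_transfer(2)[OF A 12 21] .
qed

text \<open>The companion for a zero diagonal, with the block of \<open>u\<close> and
  \<open>v\<close> hyperbolic: the equations at \<open>u\<close> and \<open>v\<close> determine
  \<open>x v\<close> and \<open>x u\<close> respectively.\<close>

lemma schur_eliminate_pair:
  fixes N :: "'a \<Rightarrow> 'a \<Rightarrow> bit"
  assumes V: "finite V" "E \<subseteq> V" and u: "u \<in> E" "N u u = 0" and v: "v \<in> E" "N v v = 0"
    and uv: "N u v = 1" "N v u = 1"
  defines "N' \<equiv> \<lambda>i j. N i j + N i u * N v j + N i v * N u j"
  shows "nonsing E N = nonsing (E - {u, v}) N'"
    and "i \<in> V - E \<Longrightarrow> j \<in> V - E \<Longrightarrow> i \<noteq> j \<Longrightarrow> schur V E N i j = schur (V - {u, v}) (E - {u, v}) N' i j"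
proof -
  let ?W = "V - {u, v}"
  have ne: "u \<noteq> v" using uv u by auto
  have m: "mulv V N x i = N i u * x u + N i v * x v + mulv ?W N x i" for x i
  proof -
    have "mulv V N x i = N i u * x u + mulv (V - {u}) N x i"
      using V u by (intro mulv_remove) auto
    also have "mulv (V - {u}) N x i = N i v * x v + mulv (V - {u} - {v}) N x i"
      using V v ne by (intro mulv_remove) auto
    also have "V - {u} - {v} = ?W" by auto
    finally show ?thesis by (simp add: add.assoc)
  qed
  have m': "mulv ?W N' x i = mulv ?W N x i + N i u * mulv ?W N x v + N i v * mulv ?W N x u" for x i
    unfolding N'_def mulv_mat_add mulv_outer by (simp add: mulv_def)
  have A: "finite V" "finite ?W" "E \<subseteq> V" "E - {u, v} \<subseteq> ?W" "V - E = ?W - (E - {u, v})"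
    using V v u by auto
  have 12: "\<exists>y. (\<forall>i\<in>E - {u, v}. mulv ?W N' y i = 0) \<and>
          (\<forall>i\<in>V - E. y i = x i \<and> mulv ?W N' y i = mulv V N x i + 0 * x i) \<and>
          ((\<forall>i\<in>?W. y i = 0) \<longrightarrow> (\<forall>i\<in>V. x i = 0))"
    if x: "\<And>i. i \<in> E \<Longrightarrow> mulv V N x i = 0" for x
  proof -
    have xv: "x v = mulv ?W N x u" "x u = mulv ?W N x v" 
      using x[OF v(1)] x[OF u(1)] v(2) u(2) uv by (simp_all add: m bit_add_eq_0)
    have "x v = 0 \<and> x u = 0" if "\<forall>i\<in>?W. x i = 0"
      unfolding xv using that by (simp add: mulv_def)
    moreover have "mulv ?W N' x i = mulv V N x i" for i unfolding m m' xv by (simp add: ac_simps)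
    ultimately show ?thesis using x by (intro exI[of _ x]) auto
  qed
  have 21: "\<exists>y. (\<forall>i\<in>E. mulv V N y i = 0) \<and>
          (\<forall>i\<in>V - E. y i = x i \<and> mulv V N y i = mulv ?W N' x i + 0 * x i) \<and>
          ((\<forall>i\<in>V. y i = 0) \<longrightarrow> (\<forall>i\<in>?W. x i = 0))"
    if x: "\<And>i. i \<in> E - {u, v} \<Longrightarrow> mulv ?W N' x i = 0" for x
  proof -
    let ?y = "x(v := mulv ?W N x u, u := mulv ?W N x v)"
    have y: "mulv V N ?y i = mulv ?W N' x i" for i unfolding m m' using ne by (simp add: ac_simps)
    moreover have "mulv ?W N' x v = 0" "mulv ?W N' x u = 0" unfolding m' using v(2) u(2) uv by simp_all
    ultimately have "\<forall>i\<in>E. mulv V N ?y i = 0" using x by auto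
    moreover have "\<forall>i\<in>V - E. ?y i = x i" using v u by auto
    moreover have "(\<forall>i\<in>V. ?y i = 0) \<longrightarrow> (\<forall>i\<in>?W. x i = 0)" by auto
    ultimately show ?thesis using y by (intro exI[of _ ?y]) auto
  qed
  show "nonsing E N = nonsing (E - {u, v}) N'"
    using schur_transfer(1)[OF A 12 21] .
  show "i \<in> V - E \<Longrightarrow> j \<in> V - E \<Longrightarrow> i \<noteq> j \<Longrightarrow> schur V E N i j = schur ?W (E - {u, v}) N' i j"
    using schur_transfer(2)[OF A 12 21] .
qed

section \<open>Naji's equations under elimination, Schur complements and inversion\<close>

lemma naji_eliminate:
  fixes N :: "'a \<Rightarrow> 'a \<Rightarrow> bit"
  assumes "naji V (\<lambda>i j. N i j = 1)" "v \<in> V" and sym: "\<And>i j. i \<in> V \<Longrightarrow> j \<in> V \<Longrightarrow> N i j = N j i"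
  shows "naji (V - {v}) (\<lambda>i j. N i j + N i v * N v j = 1)"
proof -
  \<comment> \<open>Eliminating a vertex with diagonal entry 1 is local complementation there
    followed by deletion.\<close>
  have "naji V (\<lambda>i j. (N i j = 1) \<noteq> (i \<noteq> v \<and> j \<noteq> v \<and> N i v = 1 \<and> N v j = 1))"
    by (rule naji_local_complement[OF assms(1,2)]) (simp add: sym)
  then show ?thesis
  proof (rule naji_pull[where f = id])
    fix x y assume "x \<in> V - {v}" "y \<in> V - {v}"
    then show "((N (id x) (id y) = 1) \<noteq> (id x \<noteq> v \<and> id y \<noteq> v \<and> N (id x) v = 1 \<and> N v (id y) = 1))
      = (N x y + N x v * N v y = 1)"
      unfolding id_apply by (cases "N x y"; cases "N x v"; cases "N v y") auto
  qed auto
qed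

text \<open>Local complementation at \<open>u\<close>, \<open>v\<close> and again \<open>u\<close>
  is the pivot on the edge \<open>u, v\<close>, which on the remaining vertices is exactly the
  rank-two update of the elimination.\<close>

lemma naji_eliminate_pair:
  fixes N :: "'a \<Rightarrow> 'a \<Rightarrow> bit"
  assumes "naji V (\<lambda>i j. N i j = 1)" "u \<in> V" "v \<in> V" "u \<noteq> v" "N u v = 1"
    and sym: "\<And>i j. i \<in> V \<Longrightarrow> j \<in> V \<Longrightarrow> N i j = N j i"
  shows "naji (V - {u, v}) (\<lambda>i j. N i j + N i u * N v j + N i v * N u j = 1)"
proof -
  define a where "a i j \<longleftrightarrow> N i j = 1" for i j
  define lc where "lc b w i j \<longleftrightarrow> b i j \<noteq> (i \<noteq> w \<and> j \<noteq> w \<and> b i w \<and> b w j)" for b w and i j :: 'a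
  have asym: "a i j = a j i" if "i \<in> V" "j \<in> V" for i j using sym that by (simp add: a_def)
  have 1: "naji V (lc a u)" "\<And>i j. i \<in> V \<Longrightarrow> j \<in> V \<Longrightarrow> lc a u i j = lc a u j i"
    unfolding lc_def using naji_local_complement[of V a u] assms(1,2) asym unfolding a_def by auto
  have 2: "naji V (lc (lc a u) v)" "\<And>i j. i \<in> V \<Longrightarrow> j \<in> V \<Longrightarrow> lc (lc a u) v i j = lc (lc a u) v j i"
    using naji_local_complement[of V "lc a u" v] assms(3) 1 unfolding lc_def[of "lc a u"] by auto
  have 3: "naji V (lc (lc (lc a u) v) u)"
    using naji_local_complement[of V "lc (lc a u) v" u] assms(2) 2 unfolding lc_def[of "lc (lc a u) v"] by auto
  show ?thesis
  proof (rule naji_pull[OF 3, where f = id])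
    fix x y assume xy: "x \<in> V - {u, v}" "y \<in> V - {u, v}"
    have s: "N u x = N x u" "N u y = N y u" "N v x = N x v" "N v y = N y v" "N v u = 1"
      using sym assms xy by auto
    show "lc (lc (lc a u) v) u (id x) (id y) = (N x y + N x u * N v y + N x v * N u y = 1)"
      using xy assms(4,5) s unfolding lc_def a_def id_apply
      by (cases "N x y"; cases "N x u"; cases "N x v"; cases "N y u"; cases "N y v") simp_all
  qed auto
qed

lemma schur_empty:
  assumes "finite V" "i \<in> V" "j \<in> V"
  shows "schur V {} N i j \<longleftrightarrow> N i j = 1"
proof -
  have "mulv V N f i = N i j" if "\<forall>k\<in>V. f k = of_bool (k = j)" for f
    by (rule mulv_unit) (use assms that in auto)
  then show ?thesis
    unfolding schur_def by (auto intro!: exI[of _ "\<lambda>k. of_bool (k = j)"])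
qed

lemma naji_schur:
  fixes N :: "'a \<Rightarrow> 'a \<Rightarrow> bit"
  assumes "finite V" "E \<subseteq> V" "nonsing E N" "naji V (\<lambda>i j. N i j = 1)"
    and "\<And>i j. i \<in> V \<Longrightarrow> j \<in> V \<Longrightarrow> N i j = N j i"
  shows "naji (V - E) (schur V E N)"
  using assms
proof (induction "card E" arbitrary: V E N rule: less_induct)
  case less
  note sym = less.prems(5)
  have fE: "finite E" using less.prems finite_subset by blast
  \<comment> \<open>Over the field with two elements a nonsingular symmetric block has a pivot 1 on
    its diagonal or else a hyperbolic pair; the two elimination lemmas match this dichotomy.\<close>
  consider "E = {}" | v where "v \<in> E" "N v v = 1" | v where "v \<in> E" "\<forall>v\<in>E. N v v = 0"
    by (metis all_not_in_conv bit_not_one_iff)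
  then show ?case
  proof cases
    case 1
    then show ?thesis
      using less.prems(1) by (intro naji_pull[OF less.prems(4), where f = id]) (auto simp: schur_empty)
  next
    case (2 v)
    define N' where "N' = (\<lambda>i j. N i j + N i v * N v j)"
    have vV: "v \<in> V" using 2 less.prems by auto
    have "naji (V - {v} - (E - {v})) (schur (V - {v}) (E - {v}) N')"
    proof (rule less.hyps)
      show "card (E - {v}) < card E" using 2 fE by (meson card_Diff1_less)
      show "nonsing (E - {v}) N'"
        using schur_eliminate(1)[of V E v N] less.prems(1-3) 2 unfolding N'_def by simp
      show "naji (V - {v}) (\<lambda>i j. N' i j = 1)"
        unfolding N'_def by (rule naji_eliminate[OF less.prems(4) vV sym])
      show "N' i j = N' j i" if "i \<in> V - {v}" "j \<in> V - {v}" for i j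
        using sym[of i j] sym[of i v] sym[of v j] that vV unfolding N'_def by (simp add: mult.commute)
    qed (use less.prems in auto)
    then show ?thesis
    proof (rule naji_pull[where f = id])
      fix x y assume "x \<in> V - E" "y \<in> V - E" "x \<noteq> y"
      then show "schur (V - {v}) (E - {v}) N' (id x) (id y) = schur V E N x y"
        using schur_eliminate(2)[of V E v N x y] less.prems(1-2) 2 unfolding N'_def by simp
    qed (use 2 in auto)
  next
    case (3 v)
    have vV: "v \<in> V" using 3 less.prems by auto
    \<comment> \<open>Otherwise column \<open>v\<close> of the block is zero and the unit vector of
      \<open>v\<close> lies in its kernel.\<close>
    have "\<exists>u\<in>E. N u v = 1"
    proof (rule ccontr)
      assume c: "\<not> ?thesis"
      have "mulv E N (\<lambda>k. of_bool (k = v)) i = N i v" for i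
        by (rule mulv_unit) (use fE 3 in auto)
      then have "\<forall>i\<in>E. mulv E N (\<lambda>k. of_bool (k = v)) i = 0"
        using c by auto
      then have "of_bool (v = v) = (0::bit)" using less.prems(3) 3(1) unfolding nonsing_def by fast
      then show False by simp
    qed
    then obtain u where u: "u \<in> E" "N u v = 1" by blast
    have uV: "u \<in> V" using u less.prems by auto
    have ne: "u \<noteq> v" using u 3 by auto
    have vu: "N v u = 1" using u sym[OF uV vV] by simp
    define N' where "N' = (\<lambda>i j. N i j + N i u * N v j + N i v * N u j)"
    have "naji (V - {u, v} - (E - {u, v})) (schur (V - {u, v}) (E - {u, v}) N')"
    proof (rule less.hyps)
      show "card (E - {u, v}) < card E" using 3 fE by (intro psubset_card_mono) auto
      show "nonsing (E - {u, v}) N'"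
        using schur_eliminate_pair(1)[of V E u N v] less.prems(1-3) 3 u vu unfolding N'_def by simp
      show "naji (V - {u, v}) (\<lambda>i j. N' i j = 1)"
        unfolding N'_def by (rule naji_eliminate_pair[OF less.prems(4) uV vV ne u(2) sym])
      show "N' i j = N' j i" if "i \<in> V - {u, v}" "j \<in> V - {u, v}" for i j
        using sym[of i j] sym[of i v] sym[of v j] sym[of i u] sym[of u j] that vV uV unfolding N'_def 
        by (simp add: ac_simps)
    qed (use less.prems in auto)
    then show ?thesis
    proof (rule naji_pull[where f = id])
      fix x y assume "x \<in> V - E" "y \<in> V - E" "x \<noteq> y"
      then show "schur (V - {u, v}) (E - {u, v}) N' (id x) (id y) = schur V E N x y"
        using schur_eliminate_pair(2)[of V E u N v x y] less.prems(1-2) 3 u vu unfolding N'_def by simp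
    qed (use 3 u in auto)
  qed
qed

section \<open>Inverses of symmetric matrices\<close>

lemma nonsing_solvable:
  assumes "finite E" "nonsing E N"
  shows "\<exists>x. \<forall>i\<in>E. mulv E N x i = b i"
proof -
  let ?S = "E \<rightarrow>\<^sub>E (UNIV :: bit set)"
  let ?f = "\<lambda>x. restrict (mulv E N x) E"
  have UB: "(UNIV :: bit set) = {0, 1}" using bit_not_zero_iff by blast
  have fin: "finite ?S" using assms(1) by (intro finite_PiE) (simp_all add: UB)
  \<comment> \<open>Vectors on \<open>E\<close> form a finite set once represented by extensional
    functions, so surjectivity follows from injectivity by counting.\<close>
  have "inj_on ?f ?S"
  proof (rule inj_onI)
    fix x y assume xy: "x \<in> ?S" "y \<in> ?S" "?f x = ?f y"
    have "mulv E N (\<lambda>k. x k + y k) i = 0" if "i \<in> E" for i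
      using fun_cong[OF xy(3), of i] that by (simp add: mulv_add bit_add_eq_0)
    then have "\<forall>i\<in>E. x i + y i = 0" using assms(2)[unfolded nonsing_def, rule_format, of "\<lambda>k. x k + y k"] by simp
    then show "x = y" using xy(1,2) by (intro PiE_ext[of x E "\<lambda>_. UNIV"]) (auto simp: bit_add_eq_0)
  qed
  then have "?f ` ?S = ?S" by (intro endo_inj_surj[OF fin]) auto
  moreover have "restrict b E \<in> ?S" by auto
  ultimately obtain x where "?f x = restrict b E" by (metis (no_types, lifting) imageE)
  then have "\<forall>i\<in>E. mulv E N x i = b i" by (metis restrict_apply')
  then show ?thesis by blast
qed

text \<open>One-sided, column by column: column \<open>j\<close> of \<open>B\<close> solves the
  system with right-hand side the unit vector of \<open>j\<close>. For symmetric \<open>M\<close>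
  the other side is recovered through \<open>mulv_adjoint\<close>.\<close>

definition is_inv :: "'a set \<Rightarrow> ('a \<Rightarrow> 'a \<Rightarrow> bit) \<Rightarrow> ('a \<Rightarrow> 'a \<Rightarrow> bit) \<Rightarrow> bool" where
  "is_inv V M B \<longleftrightarrow> (\<forall>i\<in>V. \<forall>j\<in>V. mulv V M (\<lambda>k. B k j) i = of_bool (i = j))"

lemma nonsing_inverse: 
  assumes "finite V" "nonsing V M"
  obtains B where "is_inv V M B"
proof -
  have "\<forall>j. \<exists>x. \<forall>i\<in>V. mulv V M x i = of_bool (i = j)"
    by (intro allI nonsing_solvable[OF assms])
  then obtain X where "\<forall>j. \<forall>i\<in>V. mulv V M (X j) i = of_bool (i = j)" by metis
  then have "is_inv V M (\<lambda>k j. X j k)" unfolding is_inv_def by simp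
  then show ?thesis using that by blast
qed

definition symm :: "'a set \<Rightarrow> ('a \<Rightarrow> 'a \<Rightarrow> 'b) \<Rightarrow> bool" where
  "symm V N \<longleftrightarrow> (\<forall>i\<in>V. \<forall>j\<in>V. N i j = N j i)"

lemma symmD: "symm V N \<Longrightarrow> i \<in> V \<Longrightarrow> j \<in> V \<Longrightarrow> N i j = N j i"
  unfolding symm_def by blast

lemma mulv_adjoint:
  assumes "symm V N"
  shows "(\<Sum>i\<in>V. y i * mulv V N x i) = (\<Sum>i\<in>V. mulv V N y i * x i)"
proof -
  have "(\<Sum>i\<in>V. y i * mulv V N x i) = (\<Sum>i\<in>V. \<Sum>k\<in>V. y i * (N i k * x k))"
    unfolding mulv_def by (simp add: sum_distrib_left)
  also have "\<dots> = (\<Sum>k\<in>V. \<Sum>i\<in>V. y i * (N i k * x k))" by (rule sum.swap)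
  also have "\<dots> = (\<Sum>k\<in>V. \<Sum>i\<in>V. N k i * y i * x k)"
    by (intro sum.cong refl) (use symmD[OF assms] in \<open>simp add: ac_simps\<close>)
  also have "\<dots> = (\<Sum>k\<in>V. mulv V N y k * x k)" unfolding mulv_def by (simp add: sum_distrib_right)
  finally show ?thesis .
qed

lemma sum_unit: "finite V \<Longrightarrow> j \<in> V \<Longrightarrow> (\<Sum>i\<in>V. f i * of_bool (i = j)) = (f j :: bit)"
  "finite V \<Longrightarrow> j \<in> V \<Longrightarrow> (\<Sum>i\<in>V. of_bool (i = j) * f i) = (f j :: bit)"
proof -
  assume "finite V" "j \<in> V"
  moreover have "f i * of_bool (i = j) = (if i = j then f i else 0)" "of_bool (i = j) * f i = (if i = j then f i else 0)" for i
    by auto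
  ultimately show "(\<Sum>i\<in>V. f i * of_bool (i = j)) = f j" "(\<Sum>i\<in>V. of_bool (i = j) * f i) = f j"
    by simp_all
qed

text \<open>Pair a kernel vector \<open>x\<close> with \<open>M\<close> times column
  \<open>j\<close> of \<open>B\<close>: this is \<open>x j\<close> by the choice of
  \<open>B\<close>, and 0 after moving \<open>M\<close> over to \<open>x\<close>.\<close>

lemma is_inv_nonsing:
  assumes "finite V" "symm V M" "is_inv V M B"
  shows "nonsing V M"
  unfolding nonsing_def
proof (intro allI impI ballI)
  fix x j assume x: "\<forall>i\<in>V. mulv V M x i = 0" and j: "j \<in> V"
  have "x j = (\<Sum>i\<in>V. x i * mulv V M (\<lambda>k. B k j) i)"
    using assms(1,3) j by (subst sum.cong[OF refl, of V _ "\<lambda>i. x i * of_bool (i = j)"])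
      (auto simp: is_inv_def sum_unit)
  also have "\<dots> = 0" unfolding mulv_adjoint[OF assms(2)] using x by simp
  finally show "x j = 0" .
qed

lemma is_inv_unique:
  assumes "finite V" "nonsing V M" "is_inv V M B" "is_inv V M B'" "i \<in> V" "j \<in> V"
  shows "B i j = B' i j"
proof -
  have "mulv V M (\<lambda>k. B k j + B' k j) i = 0" if "i \<in> V" for i
    using assms(3,4,6) that unfolding is_inv_def mulv_add by (simp add: bit_add_eq_0)
  then have "\<forall>i\<in>V. B i j + B' i j = 0"
    using assms(2)[unfolded nonsing_def, rule_format, of "\<lambda>k. B k j + B' k j"] by simp
  then show ?thesis using assms(5) by (simp add: bit_add_eq_0)
qed

lemma is_inv_symm:
  assumes "finite V" "symm V M" "is_inv V M B"
  shows "symm V B"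
  unfolding symm_def
proof (intro ballI)
  fix i j assume ij: "i \<in> V" "j \<in> V"
  have "B j i = (\<Sum>k\<in>V. B k i * mulv V M (\<lambda>k. B k j) k)"
    using assms ij by (subst sum.cong[OF refl, of V _ "\<lambda>k. B k i * of_bool (k = j)"])
      (auto simp: is_inv_def sum_unit)
  also have "\<dots> = (\<Sum>k\<in>V. mulv V M (\<lambda>k. B k i) k * B k j)" by (rule mulv_adjoint[OF assms(2)])
  also have "\<dots> = B i j"
    using assms ij by (subst sum.cong[OF refl, of V _ "\<lambda>k. of_bool (k = i) * B k j"])
      (auto simp: is_inv_def sum_unit)
  finally show "B i j = B j i" by simp
qed

text \<open>The inverse of \<^term>\<open>M\<close> is the Schur complement of the doubled matrix with blocks
  \<^term>\<open>M\<close>, 1, 1, 0; its graph is that of \<^term>\<open>M\<close> with a pendant vertex at every vertex.\<close>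

lemma naji_inverse:
  fixes M :: "'a \<Rightarrow> 'a \<Rightarrow> bit"
  assumes V: "finite V" "symm V M" and inv: "is_inv V M B" and n: "naji V (\<lambda>i j. M i j = 1)"
  shows "naji V (\<lambda>i j. B i j = 1)"
proof -
  define W :: "('a + 'a) set" where "W = Inl ` V \<union> Inr ` V"
  define E :: "('a + 'a) set" where "E = Inl ` V"
  define N :: "'a + 'a \<Rightarrow> 'a + 'a \<Rightarrow> bit" 
    where "N p q = of_bool (pendant_adj (\<lambda>i j. M i j = 1) p q)" for p q
  have N[simp]: "N (Inl i) (Inl j) = M i j" "N (Inl i) (Inr j) = of_bool (i = j)"
    "N (Inr i) (Inl j) = of_bool (i = j)" "N (Inr i) (Inr j) = 0" for i j
    unfolding N_def by (cases "M i j"; simp)+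
  have W: "finite W" "E \<subseteq> W" "W - E = Inr ` V" using V unfolding W_def E_def by auto
  have mE: "mulv E N x (Inl i) = mulv V M (x \<circ> Inl) i" for x i
    unfolding mulv_def E_def by (subst sum.reindex) (auto simp: inj_on_def)
  have mW: "mulv W N x p = mulv E N x p + (\<Sum>k\<in>V. N p (Inr k) * x (Inr k))" for x p
  proof -
    have "mulv W N x p = (\<Sum>k\<in>Inl ` V. N p k * x k) + (\<Sum>k\<in>Inr ` V. N p k * x k)"
      unfolding mulv_def W_def using V by (intro sum.union_disjoint) auto
    then show ?thesis unfolding E_def mulv_def by (simp add: sum.reindex)
  qed
  have nons: "nonsing E N"
    unfolding nonsing_def
  proof (intro allI impI)
    fix x assume "\<forall>i\<in>E. mulv E N x i = 0"
    then have "\<forall>i\<in>V. mulv V M (x \<circ> Inl) i = 0" unfolding E_def by (simp add: mE[unfolded E_def])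
    then have "\<forall>i\<in>V. (x \<circ> Inl) i = 0" using is_inv_nonsing[OF V inv] unfolding nonsing_def by blast
    then show "\<forall>i\<in>E. x i = 0" unfolding E_def by simp
  qed
  have "naji (W - E) (schur W E N)"
  proof (rule naji_schur[OF W(1,2) nons])
    have "naji W (pendant_adj (\<lambda>i j. M i j = 1))"
      unfolding W_def by (rule naji_pendants[OF n]) (use symmD[OF V(2)] in auto)
    then show "naji W (\<lambda>i j. N i j = 1)" unfolding N_def by simp
    show "N p q = N q p" if "p \<in> W" "q \<in> W" for p q
      using that symmD[OF V(2)] unfolding W_def by auto
  qed
  then show ?thesis
  proof (rule naji_pull[where f = Inr])
    fix i j assume ij: "i \<in> V" "j \<in> V"
    \<comment> \<open>The rows in \<open>E\<close> say that \<open>M\<close> maps the first half of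
      \<open>x\<close> to the unit vector of \<open>j\<close>, so this half is column
      \<open>j\<close> of \<open>B\<close>; the row of \<open>Inr i\<close> reads off its entry at
      \<open>i\<close>.\<close>
    have *: "mulv W N x (Inr i) = B i j" 
      if x: "\<forall>k\<in>E. mulv W N x k = 0" "\<forall>k\<in>W - E. x k = of_bool (k = Inr j)" for x
    proof -
      have xr: "x (Inr k) = of_bool (k = j)" if "k \<in> V" for k using x(2) that W(3) by auto
      have "mulv V M (x \<circ> Inl) k = of_bool (k = j)" if "k \<in> V" for k
      proof -
        have "0 = mulv W N x (Inl k)" using x(1) that unfolding E_def by simp
        also have "\<dots> = mulv V M (x \<circ> Inl) k + x (Inr k)" 
          unfolding mW mE using V that by (simp add: sum_unit eq_commute[of k])
        finally show ?thesis using xr[OF that] by (metis bit_add_eq_0)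
      qed
      then have "mulv V M (\<lambda>k. (x \<circ> Inl) k + B k j) k = 0" if "k \<in> V" for k
        unfolding mulv_add \<open>\<And>k. k \<in> V \<Longrightarrow> mulv V M (x \<circ> Inl) k = of_bool (k = j)\<close>[OF that]
        using inv ij that unfolding is_inv_def by simp
      then have "\<forall>k\<in>V. (x \<circ> Inl) k + B k j = 0"
        using is_inv_nonsing[OF V inv, unfolded nonsing_def, rule_format, of "\<lambda>k. (x \<circ> Inl) k + B k j"] by simp
      then have "x (Inl i) = B i j" using ij by (simp add: bit_add_eq_0)
      moreover have "mulv W N x (Inr i) = x (Inl i)"
        unfolding mW using V ij unfolding mulv_def E_def 
        by (subst sum.reindex) (simp_all add: sum_unit eq_commute[of i])
      ultimately show ?thesis by simp
    qed
    show "schur W E N (Inr i) (Inr j) = (B i j = 1)"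
    proof
      assume "schur W E N (Inr i) (Inr j)"
      then show "B i j = 1" unfolding schur_def using * by auto
    next
      assume b: "B i j = 1"
      define x where "x p = (case p of Inl k \<Rightarrow> B k j | Inr k \<Rightarrow> of_bool (k = j))" for p
      have "mulv W N x k = 0" if kE: "k \<in> E" for k
      proof -
        obtain l where l: "k = Inl l" "l \<in> V" using kE unfolding E_def by blast
        have "mulv W N x (Inl l) = mulv V M (\<lambda>k. B k j) l + of_bool (l = j)"
          unfolding mW mE using V l by (simp add: sum_unit eq_commute[of l] x_def o_def)
        then show ?thesis using inv l ij unfolding is_inv_def by simp
      qed
      moreover have "\<forall>k\<in>W - E. x k = of_bool (k = Inr j)" unfolding W(3) x_def by auto
      moreover from calculation have "mulv W N x (Inr i) = 1" using *[of x] b by auto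
      ultimately show "schur W E N (Inr i) (Inr j)"
        unfolding schur_def by blast
    qed
  qed (use W(3) in auto)
qed

section \<open>The contribution of a single state\<close>

definition obstructed :: "'a set \<Rightarrow> 'a set \<Rightarrow> ('a \<Rightarrow> 'a \<Rightarrow> bit) \<Rightarrow> bool" where
  "obstructed V E N \<longleftrightarrow> nonsing E N \<and> \<not> naji_reducible (schur V E N) (V - E)"

lemma obstructed_transfer:
  fixes d :: "'a \<Rightarrow> bit"
  assumes V: "finite V1" "finite V2" "E1 \<subseteq> V1" "E2 \<subseteq> V2" "V1 - E1 = V2 - E2"
    and 12: "\<And>x. (\<And>i. i \<in> E1 \<Longrightarrow> mulv V1 N1 x i = 0) \<Longrightarrow>
      \<exists>y. (\<forall>i\<in>E2. mulv V2 N2 y i = 0) \<and>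
          (\<forall>i\<in>V1 - E1. y i = x i \<and> mulv V2 N2 y i = mulv V1 N1 x i + d i * x i) \<and>
          ((\<forall>i\<in>V2. y i = 0) \<longrightarrow> (\<forall>i\<in>V1. x i = 0))"
    and 21: "\<And>x. (\<And>i. i \<in> E2 \<Longrightarrow> mulv V2 N2 x i = 0) \<Longrightarrow>
      \<exists>y. (\<forall>i\<in>E1. mulv V1 N1 y i = 0) \<and>
          (\<forall>i\<in>V1 - E1. y i = x i \<and> mulv V1 N1 y i = mulv V2 N2 x i + d i * x i) \<and>
          ((\<forall>i\<in>V1. y i = 0) \<longrightarrow> (\<forall>i\<in>V2. x i = 0))"
  shows "obstructed V1 E1 N1 = obstructed V2 E2 N2"
proof -
  have "naji_reducible (schur V1 E1 N1) (V1 - E1) = naji_reducible (schur V2 E2 N2) (V1 - E1)"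
    by (rule naji_reducible_cong) (rule schur_transfer(2)[OF V 12 21])
  then show ?thesis
    unfolding obstructed_def using schur_transfer(1)[OF V 12 21] V(5) by simp
qed

text \<open>Changing \<open>N i i\<close> at a vertex outside \<open>E\<close> alters the image at
  \<open>i\<close> by a multiple of \<open>x i\<close>, which is absorbed by the term
  \<open>d\<close> of \<open>obstructed_transfer\<close>.\<close>

lemma obstructed_cong:
  assumes "finite V" "E \<subseteq> V"
    and "\<And>i j. i \<in> V \<Longrightarrow> j \<in> V \<Longrightarrow> i \<noteq> j \<or> i \<in> E \<Longrightarrow> N i j = N' i j"
  shows "obstructed V E N = obstructed V E N'"
proof (rule obstructed_transfer[where d = "\<lambda>i. N i i + N' i i"])
  have e: "mulv V N x i = mulv V N' x i" if "i \<in> E" for x i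
    by (rule mulv_cong) (use assms that in auto)
  have o: "mulv V N x i = mulv V N' x i + (N i i + N' i i) * x i" if "i \<in> V - E" for x i
  proof -
    have "mulv (V - {i}) N x i = mulv (V - {i}) N' x i"
      by (rule mulv_cong) (use assms that in auto)
    then show ?thesis using mulv_remove[OF assms(1), of i N x i] mulv_remove[OF assms(1), of i N' x i] that
      by (simp add: algebra_simps)
  qed
  have o': "mulv V N' x i = mulv V N x i + (N i i + N' i i) * x i" if "i \<in> V - E" for x i
    unfolding o[OF that] by (simp add: algebra_simps)
  show "\<exists>y. (\<forall>i\<in>E. mulv V N' y i = 0) \<and>
          (\<forall>i\<in>V - E. y i = x i \<and> mulv V N' y i = mulv V N x i + (N i i + N' i i) * x i) \<and>
          ((\<forall>i\<in>V. y i = 0) \<longrightarrow> (\<forall>i\<in>V. x i = 0))" 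
    if "\<And>i. i \<in> E \<Longrightarrow> mulv V N x i = 0" for x
    using that e o' by (intro exI[of _ x]) auto
  show "\<exists>y. (\<forall>i\<in>E. mulv V N y i = 0) \<and>
          (\<forall>i\<in>V - E. y i = x i \<and> mulv V N y i = mulv V N' x i + (N i i + N' i i) * x i) \<and>
          ((\<forall>i\<in>V. y i = 0) \<longrightarrow> (\<forall>i\<in>V. x i = 0))" 
    if "\<And>i. i \<in> E \<Longrightarrow> mulv V N' x i = 0" for x
    using that e o by (intro exI[of _ x]) auto
qed (use assms in auto)

lemma obstructed_eliminate:
  assumes "finite V" "E \<subseteq> V" "v \<in> E" "N v v = 1"
  shows "obstructed V E N = obstructed (V - {v}) (E - {v}) (\<lambda>i j. N i j + N i v * N v j)"
proof -
  let ?N' = "\<lambda>i j. N i j + N i v * N v j"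
  have O: "V - {v} - (E - {v}) = V - E" using assms by auto
  have "naji_reducible (schur V E N) (V - E) = naji_reducible (schur (V - {v}) (E - {v}) ?N') (V - E)"
    by (rule naji_reducible_cong) (rule schur_eliminate(2)[where N = N, OF assms])
  then show ?thesis unfolding obstructed_def O using schur_eliminate(1)[where N = N, OF assms] by simp
qed

lemma obstructed_eliminate_pair:
  assumes "finite V" "E \<subseteq> V" "u \<in> E" "N u u = 0" "v \<in> E" "N v v = 0" "N u v = 1" "N v u = 1"
  shows "obstructed V E N = obstructed (V - {u, v}) (E - {u, v}) (\<lambda>i j. N i j + N i u * N v j + N i v * N u j)"
proof -
  let ?N' = "\<lambda>i j. N i j + N i u * N v j + N i v * N u j"
  have O: "V - {u, v} - (E - {u, v}) = V - E" using assms by auto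
  have "naji_reducible (schur V E N) (V - E) = naji_reducible (schur (V - {u, v}) (E - {u, v}) ?N') (V - E)"
    by (rule naji_reducible_cong) (rule schur_eliminate_pair(2)[where N = N, OF assms])
  then show ?thesis unfolding obstructed_def O using schur_eliminate_pair(1)[where N = N, OF assms] by simp
qed

lemma obstructed_pull:
  assumes "bij_betw f V V'" "finite V" "E \<subseteq> V"
    and N: "\<And>i j. i \<in> V \<Longrightarrow> j \<in> V \<Longrightarrow> N' (f i) (f j) = N i j"
    and "obstructed V E N"
  shows "obstructed V' (f ` E) N'"
proof -
  have inj: "inj_on f V" and V': "V' = f ` V" using assms(1) by (auto simp: bij_betw_def)
  define g where "g = inv_into V f"
  have g: "g (f i) = i" if "i \<in> V" for i using that inj by (simp add: g_def)
  have m: "mulv (f ` W) N' x (f i) = mulv W N (x \<circ> f) i" if "W \<subseteq> V" "i \<in> V" for W x i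
    unfolding mulv_def using that N inj_on_subset[OF inj that(1)]
    by (subst sum.reindex) (auto intro!: sum.cong)
  have O: "V' - f ` E = f ` (V - E)" unfolding V' using inj assms(3) by (simp add: inj_on_image_set_diff)
  have n: "nonsing E N" and r: "\<not> naji_reducible (schur V E N) (V - E)"
    using assms(5) unfolding obstructed_def by auto
  have "nonsing (f ` E) N'"
    unfolding nonsing_def
  proof (intro allI impI)
    fix x assume "\<forall>i\<in>f ` E. mulv (f ` E) N' x i = 0"
    then have "\<forall>i\<in>E. mulv E N (x \<circ> f) i = 0" using m[OF assms(3), of _ x] subsetD[OF assms(3)] by simp
    then have "\<forall>i\<in>E. (x \<circ> f) i = 0" using n unfolding nonsing_def by blast
    then show "\<forall>i\<in>f ` E. x i = 0" by simp
  qed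
  moreover have "\<not> naji_reducible (schur V' (f ` E) N') (V' - f ` E)"
  proof
    assume "naji_reducible (schur V' (f ` E) N') (V' - f ` E)"
    then have "naji_reducible (schur V E N) (V - E)"
    proof (rule naji_reducible_pull)
      show "bij_betw f (V - E) (V' - f ` E)"
        unfolding O bij_betw_def using inj_on_subset[OF inj] by auto
      fix i j assume ij: "i \<in> V - E" "j \<in> V - E"
      have eq: "f k = f l \<longleftrightarrow> k = l" if "k \<in> V" "l \<in> V" for k l
        using inj that by (auto simp: inj_on_def)
      show "schur V' (f ` E) N' (f i) (f j) = schur V E N i j"
      proof
        assume "schur V' (f ` E) N' (f i) (f j)"
        then obtain x where "\<forall>k\<in>f ` E. mulv V' N' x k = 0" "\<forall>k\<in>V' - f ` E. x k = of_bool (k = f j)" "mulv V' N' x (f i) = 1"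
          unfolding schur_def by blast
        then have x: "\<forall>k\<in>E. mulv (f ` V) N' x (f k) = 0" "\<forall>k\<in>V - E. x (f k) = of_bool (f k = f j)" 
          "mulv (f ` V) N' x (f i) = 1" unfolding O unfolding V' by auto
        show "schur V E N i j"
          unfolding schur_def
        proof (intro exI[of _ "x \<circ> f"] conjI ballI)
          show "mulv V N (x \<circ> f) k = 0" if "k \<in> E" for k
            using x(1) that m[of V k x] assms(3) by auto
          show "(x \<circ> f) k = of_bool (k = j)" if "k \<in> V - E" for k
            using x(2) that eq[of k j] ij by simp
          show "mulv V N (x \<circ> f) i = 1" using x(3) m[of V i x] ij by simp
        qed
      next
        assume "schur V E N i j"
        then obtain x where x: "\<forall>k\<in>E. mulv V N x k = 0" "\<forall>k\<in>V - E. x k = of_bool (k = j)" "mulv V N x i = 1"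
          unfolding schur_def by blast
        have xg: "mulv V N (x \<circ> g \<circ> f) k = mulv V N x k" for k
          by (rule mulv_cong) (use g in auto)
        show "schur V' (f ` E) N' (f i) (f j)"
          unfolding schur_def O unfolding V'
        proof (intro exI[of _ "x \<circ> g"] conjI ballI)
          show "mulv (f ` V) N' (x \<circ> g) (f i) = 1" using m[of V i "x \<circ> g"] xg x ij by simp
          show "mulv (f ` V) N' (x \<circ> g) k = 0" if "k \<in> f ` E" for k
            using that assms(3) m[of V _ "x \<circ> g"] xg x by auto
          show "(x \<circ> g) k = of_bool (k = f j)" if "k \<in> f ` (V - E)" for k
            using that x eq ij g by auto
        qed
      qed
    qed
    then show False using r by simp
  qed
  ultimately show ?thesis unfolding obstructed_def by simp
qed

lemma obstructed_iso:
  assumes "bij_betw f V V'" "finite V" "E \<subseteq> V"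
    and N: "\<And>i j. i \<in> V \<Longrightarrow> j \<in> V \<Longrightarrow> N' (f i) (f j) = N i j"
  shows "obstructed V E N = obstructed V' (f ` E) N'"
proof
  show "obstructed V E N \<Longrightarrow> obstructed V' (f ` E) N'" by (rule obstructed_pull[where N = N, OF assms])
  assume o: "obstructed V' (f ` E) N'"
  have b: "bij_betw (inv_into V f) V' V" using assms(1) by (rule bij_betw_inv_into)
  have inj: "inj_on f V" and V': "V' = f ` V" using assms(1) by (auto simp: bij_betw_def)
  have "obstructed V (inv_into V f ` f ` E) N"
    by (rule obstructed_pull[OF b _ _ _ o]) (use assms inj V' in \<open>auto intro!: N[symmetric]\<close>)
  moreover have "inv_into V f ` f ` E = E" using inj assms(3) by (simp add: inv_into_image_cancel)
  ultimately show "obstructed V E N" by simp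
qed

section \<open>The parity bracket\<close>

definition with_diag :: "('a \<Rightarrow> 'a \<Rightarrow> bit) \<Rightarrow> 'a set \<Rightarrow> 'a \<Rightarrow> 'a \<Rightarrow> bit" where
  "with_diag h D i j = (if i = j then of_bool (i \<in> D) else h i j)"

text \<open>The parity of the degree in the graph alone: the diagonal of \<open>h\<close> is left
  out, since the moves alter it.\<close>

definition even_verts :: "'a set \<Rightarrow> ('a \<Rightarrow> 'a \<Rightarrow> bit) \<Rightarrow> 'a set" where
  "even_verts V h = {v \<in> V. (\<Sum>j\<in>V - {v}. h v j) = 0}"

text \<open>The parity bracket of a free knot: \<open>h\<close> is the interlacement graph of a Gauss circuit,
  a subset \<open>D\<close> of the even crossings selects one of the two smoothings at each of them,
  and only the states with one component contribute.\<close>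

definition state_sum :: "'a set \<Rightarrow> ('a \<Rightarrow> 'a \<Rightarrow> bit) \<Rightarrow> bit" where
  "state_sum V h =
     (\<Sum>D\<in>Pow (even_verts V h). of_bool (obstructed V (even_verts V h) (with_diag h D)))"

section \<open>The state sum under renaming, isolated vertices and twins\<close>

lemma even_verts_subset: "even_verts V h \<subseteq> V"
  unfolding even_verts_def by auto

lemma sum_Pow_insert:
  fixes f :: "'a set \<Rightarrow> 'b::comm_monoid_add"
  assumes "finite A" "v \<notin> A"
  shows "(\<Sum>D\<in>Pow (insert v A). f D) = (\<Sum>D\<in>Pow A. f D + f (insert v D))"
proof -
  have "inj_on (insert v) (Pow A)"
    using assms(2) by (intro inj_onI) (metis PowD insert_ident subsetD)
  moreover have "Pow A \<inter> insert v ` Pow A = {}" using assms(2) by auto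
  ultimately show ?thesis
    unfolding Pow_insert using assms(1) by (simp add: sum.union_disjoint sum.reindex sum.distrib)
qed

lemma state_sum_iso:
  assumes f: "bij_betw f V V'" and "finite V"
    and h: "\<And>i j. i \<in> V \<Longrightarrow> j \<in> V \<Longrightarrow> i \<noteq> j \<Longrightarrow> h' (f i) (f j) = h i j"
  shows "state_sum V' h' = state_sum V h"
proof -
  have inj: "inj_on f V" and V': "V' = f ` V" using f by (auto simp: bij_betw_def)
  have deg: "(\<Sum>j\<in>V' - {f v}. h' (f v) j) = (\<Sum>j\<in>V - {v}. h v j)" if v: "v \<in> V" for v
  proof -
    have "V' - {f v} = f ` (V - {v})" using inj v V' by (auto simp: inj_on_def)
    then have "(\<Sum>j\<in>V' - {f v}. h' (f v) j) = (\<Sum>j\<in>V - {v}. h' (f v) (f j))"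
      using inj_on_subset[OF inj, of "V - {v}"] by (simp add: sum.reindex)
    also have "\<dots> = (\<Sum>j\<in>V - {v}. h v j)" by (rule sum.cong) (use h v in auto)
    finally show ?thesis .
  qed
  have "even_verts V' h' = {x \<in> f ` V. (\<Sum>j\<in>V' - {x}. h' x j) = 0}"
    unfolding even_verts_def V' ..
  also have "\<dots> = f ` even_verts V h"
    unfolding even_verts_def using deg by auto
  finally have E: "even_verts V' h' = f ` even_verts V h" .
  let ?E = "even_verts V h"
  have "bij_betw ((`) f) (Pow ?E) (Pow (f ` ?E))"
    by (rule bij_betw_Pow) (use inj_on_subset[OF inj even_verts_subset] in \<open>auto simp: bij_betw_def\<close>)
  then have "state_sum V' h' = (\<Sum>D\<in>Pow ?E. of_bool (obstructed V' (f ` ?E) (with_diag h' (f ` D))))"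
    unfolding state_sum_def E by (rule sum.reindex_bij_betw[symmetric])
  also have "\<dots> = state_sum V h"
    unfolding state_sum_def
  proof (rule sum.cong[OF refl])
    fix D assume D: "D \<in> Pow ?E"
    then have DV: "D \<subseteq> V" using even_verts_subset[of V h] by (meson PowD subset_trans)
    have "obstructed V ?E (with_diag h D) = obstructed V' (f ` ?E) (with_diag h' (f ` D))"
    proof (rule obstructed_iso[OF f \<open>finite V\<close> even_verts_subset])
      fix i j assume ij: "i \<in> V" "j \<in> V"
      have "f i \<in> f ` D \<longleftrightarrow> i \<in> D" "f i = f j \<longleftrightarrow> i = j"
        using inj ij DV by (auto simp: inj_on_def)
      then show "with_diag h' (f ` D) (f i) (f j) = with_diag h D i j"
        using h ij unfolding with_diag_def by auto
    qed
    then show "of_bool (obstructed V' (f ` ?E) (with_diag h' (f ` D))) = (of_bool (obstructed V ?E (with_diag h D)) :: bit)"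
      by simp
  qed
  finally show ?thesis .
qed

text \<open>An isolated vertex has even degree, so each state of the smaller graph extends in two
  ways. With diagonal entry 0 the block has a zero column and the state does not count; with 1 the
  vertex splits off without changing anything else.\<close>

lemma state_sum_isolated:
  assumes V: "finite V" "v \<in> V" and s: "symm V h" and h: "\<And>t. t \<in> V \<Longrightarrow> t \<noteq> v \<Longrightarrow> h v t = 0"
  shows "state_sum V h = state_sum (V - {v}) h"
proof -
  let ?W = "V - {v}" let ?E = "even_verts ?W h"
  have h': "h t v = 0" if "t \<in> ?W" for t using h[of t] symmD[OF s, of t v] V that by auto
  have deg: "(\<Sum>j\<in>V - {t}. h t j) = (\<Sum>j\<in>?W - {t}. h t j)" if "t \<in> ?W" for t
    using sum.remove[of "V - {t}" v "h t"] V that h' by (auto simp: insert_commute Diff_insert2[symmetric])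
  have E: "even_verts V h = insert v ?E"
    unfolding even_verts_def using V h deg by auto
  have vE: "v \<notin> ?E" "?E \<subseteq> ?W" "finite ?E" using even_verts_subset[of ?W h] V finite_subset by auto
  have "state_sum V h = (\<Sum>D\<in>Pow ?E. of_bool (obstructed V (insert v ?E) (with_diag h D)) + 
      of_bool (obstructed V (insert v ?E) (with_diag h (insert v D))))"
    unfolding state_sum_def E by (rule sum_Pow_insert) (use vE in auto)
  also have "\<dots> = state_sum ?W h"
    unfolding state_sum_def
  proof (rule sum.cong[OF refl])
    fix D assume D: "D \<in> Pow ?E"
    then have vD: "v \<notin> D" using vE by auto
    have "\<not> nonsing (insert v ?E) (with_diag h D)"
    proof
      assume n: "nonsing (insert v ?E) (with_diag h D)"
      have "mulv (insert v ?E) (with_diag h D) (\<lambda>k. of_bool (k = v)) i = with_diag h D i v" for i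
        by (rule mulv_unit) (use vE in auto)
      then have "\<forall>i\<in>insert v ?E. mulv (insert v ?E) (with_diag h D) (\<lambda>k. of_bool (k = v)) i = 0"
        using vD vE h' by (auto simp: with_diag_def)
      then have "of_bool (v = v) = (0::bit)" using n unfolding nonsing_def by fast
      then show False by simp
    qed
    moreover have "obstructed V (insert v ?E) (with_diag h (insert v D)) = obstructed ?W ?E (with_diag h D)"
    proof -
      let ?N = "with_diag h (insert v D)"
      have "obstructed V (insert v ?E) ?N =
        obstructed ?W (insert v ?E - {v}) (\<lambda>i j. ?N i j + ?N i v * ?N v j)"
        by (rule obstructed_eliminate) (use V vE in \<open>auto simp: with_diag_def\<close>)
      also have "insert v ?E - {v} = ?E" using vE by auto
      also have "obstructed ?W ?E (\<lambda>i j. ?N i j + ?N i v * ?N v j) = obstructed ?W ?E (with_diag h D)"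
        by (rule obstructed_cong) (use V vE h h' in \<open>auto simp: with_diag_def\<close>)
      finally show ?thesis .
    qed
    ultimately show "of_bool (obstructed V (insert v ?E) (with_diag h D)) + 
      of_bool (obstructed V (insert v ?E) (with_diag h (insert v D))) = (of_bool (obstructed ?W ?E (with_diag h D)) :: bit)"
      unfolding obstructed_def[of V "insert v ?E" "with_diag h D"] by simp
  qed
  finally show ?thesis .
qed

text \<open>Adding \<open>T\<close> exchanges the solutions for \<open>v\<close> and \<open>w\<close>.\<close>

lemma obstructed_remove_twins:
  assumes V: "finite V" "E \<subseteq> V" "v \<in> V - E" "w \<in> V - E" "v \<noteq> w" and s: "symm V N"
    and T: "T v = 1" "T w = 1" "\<And>k. k \<in> V - E \<Longrightarrow> k \<noteq> v \<Longrightarrow> k \<noteq> w \<Longrightarrow> T k = 0"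
    and NT: "\<And>k. k \<in> V \<Longrightarrow> k \<noteq> v \<Longrightarrow> k \<noteq> w \<Longrightarrow> mulv V N T k = 0"
  shows "obstructed V E N = obstructed (V - {v, w}) E N"
proof -
  have shift: "schur V E N t v' \<Longrightarrow> schur V E N t w'" 
    if "t \<in> V - E - {v, w}" and vw: "v' = v \<and> w' = w \<or> v' = w \<and> w' = v" for t v' w'
  proof -
    assume "schur V E N t v'"
    then obtain x where x: "\<forall>k\<in>E. mulv V N x k = 0" "\<forall>k\<in>V - E. x k = of_bool (k = v')" "mulv V N x t = 1"
      unfolding schur_def by blast
    show ?thesis
      unfolding schur_def
    proof (intro exI[of _ "\<lambda>k. x k + T k"] conjI ballI)
      show "mulv V N (\<lambda>k. x k + T k) t = 1" using x(3) NT[of t] that by (simp add: mulv_add)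
      show "mulv V N (\<lambda>k. x k + T k) k = 0" if "k \<in> E" for k
        using x(1) NT[of k] that V by (auto simp: mulv_add)
      show "x k + T k = of_bool (k = w')" if "k \<in> V - E" for k
        using x(2) T(3)[of k] that T(1,2) vw V(3,4,5) by (cases "k = v"; cases "k = w") auto
    qed
  qed
  \<comment> \<open>The rows need a dual argument: pair \<open>T\<close> with \<open>N x\<close> and
    use symmetry. Outside \<open>v\<close> and \<open>w\<close>, \<open>N T\<close> vanishes and
    \<open>T\<close> meets only rows where \<open>N x\<close> is 0, so just the entries at
    \<open>v\<close> and \<open>w\<close> survive.\<close>
  have tw: "schur V E N v t = schur V E N w t" if t: "t \<in> V - E - {v, w}" for t
  proof -
    have eq: "mulv V N x v = mulv V N x w" 
      if x: "\<forall>k\<in>E. mulv V N x k = 0" "\<forall>k\<in>V - E. x k = of_bool (k = t)" for x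
    proof -
      have split: "(\<Sum>k\<in>V. f k) = f v + f w" if "\<And>k. k \<in> V - {v, w} \<Longrightarrow> f k = 0" for f :: "'a \<Rightarrow> bit"
      proof -
        have "(\<Sum>k\<in>V. f k) = (\<Sum>k\<in>{v, w}. f k)"
          by (rule sum.mono_neutral_right) (use V that in auto)
        then show ?thesis using V(5) by simp
      qed
      have "(\<Sum>k\<in>V. mulv V N T k * x k) = mulv V N T v * x v + mulv V N T w * x w"
        by (rule split) (use NT in auto)
      also have "\<dots> = 0" using x(2) V t by auto
      finally have "0 = (\<Sum>k\<in>V. T k * mulv V N x k)" by (simp add: mulv_adjoint[OF s])
      also have "\<dots> = T v * mulv V N x v + T w * mulv V N x w"
      proof (rule split)
        fix k assume "k \<in> V - {v, w}"
        then show "T k * mulv V N x k = 0" using x(1) T(3)[of k] by (cases "k \<in> E") auto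
      qed
      finally have "mulv V N x v + mulv V N x w = 0" using T(1,2) by simp
      then show ?thesis by (simp only: bit_add_eq_0)
    qed
    then show ?thesis unfolding schur_def by metis
  qed
  have "twins (schur V E N) (V - E) v w"
    unfolding twins_def using V shift tw by blast
  then have "naji_reducible (schur V E N) (V - E - {v, w}) = naji_reducible (schur V E N) (V - E)"
    by (rule naji_reducible_twins_iff)
  moreover have "V - E - {v, w} = V - {v, w} - E" by auto
  moreover have "naji_reducible (schur V E N) (V - {v, w} - E) = naji_reducible (schur (V - {v, w}) E N) (V - {v, w} - E)"
  proof (rule naji_reducible_cong)
    fix i j assume ij: "i \<in> V - {v, w} - E" "j \<in> V - {v, w} - E"
    let ?W = "V - {v, w}"
    have m: "mulv V N x k = mulv ?W N x k" if "x v = 0" "x w = 0" for x k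
      by (rule mulv_restrict) (use V that in auto)
    show "schur V E N i j = schur ?W E N i j"
    proof
      assume "schur V E N i j"
      then obtain x where x: "\<forall>k\<in>E. mulv V N x k = 0" "\<forall>k\<in>V - E. x k = of_bool (k = j)" "mulv V N x i = 1"
        unfolding schur_def by blast
      have "x v = 0" "x w = 0" using x(2) ij V by auto
      then show "schur ?W E N i j" unfolding schur_def using x by (intro exI[of _ x]) (auto simp: m)
    next
      assume "schur ?W E N i j"
      then obtain x where x: "\<forall>k\<in>E. mulv ?W N x k = 0" "\<forall>k\<in>?W - E. x k = of_bool (k = j)" "mulv ?W N x i = 1"
        unfolding schur_def by blast
      let ?y = "x(v := 0, w := 0)"
      have "mulv V N ?y k = mulv ?W N x k" for k using m[of ?y] by simp
      then show "schur V E N i j" unfolding schur_def using x V ij by (intro exI[of _ ?y]) auto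
    qed
  qed
  ultimately show ?thesis unfolding obstructed_def by simp
qed

lemma mulv_pair:
  assumes "finite V" "u \<in> V" "v \<in> V" "u \<noteq> v"
  shows "mulv V N (\<lambda>k. of_bool (k = u \<or> k = v)) i = N i u + N i v"
proof -
  have "(\<lambda>k. of_bool (k = u \<or> k = v)) = (\<lambda>k. of_bool (k = u) + (of_bool (k = v) :: bit))"
    using assms(4) by (intro ext) auto
  then show ?thesis using assms by (simp add: mulv_add mulv_unit)
qed

lemma mulv_triple:
  assumes "finite V" "u \<in> V" "v \<in> V" "w \<in> V" "u \<noteq> v" "u \<noteq> w" "v \<noteq> w"
  shows "mulv V N (\<lambda>k. of_bool (k = u \<or> k = v \<or> k = w)) i = N i u + N i v + N i w"
proof -
  have "(\<lambda>k. of_bool (k = u \<or> k = v \<or> k = w)) =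
      (\<lambda>k. (of_bool (k = u \<or> k = v) :: bit) + of_bool (k = w))"
    using assms by (intro ext) auto
  then show ?thesis using assms by (simp add: mulv_add mulv_unit mulv_pair)
qed

lemma not_nonsingI:
  "(\<And>i. i \<in> E \<Longrightarrow> mulv E N x i = 0) \<Longrightarrow> j \<in> E \<Longrightarrow> x j \<noteq> 0 \<Longrightarrow> \<not> nonsing E N"
  unfolding nonsing_def by blast

lemma symm_with_diag: "symm V h \<Longrightarrow> symm V (with_diag h D)"
  unfolding symm_def with_diag_def by auto

text \<open>Twins have degrees of equal parity. If odd, they stay twins in every Schur complement
  and cancel there. If even, the four diagonal choices at \<open>u, v\<close> give two equal states,
  which cancel modulo 2, one singular state, and one whose elimination leaves the smaller graph
  unchanged. Which choice is which depends on \<open>h u v\<close>.\<close>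

lemma state_sum_twins:
  assumes V: "finite V" "u \<in> V" "v \<in> V" "u \<noteq> v" and s: "symm V h"
    and h: "\<And>t. t \<in> V \<Longrightarrow> t \<noteq> u \<Longrightarrow> t \<noteq> v \<Longrightarrow> h u t = h v t"
  shows "state_sum V h = state_sum (V - {u, v}) h"
proof -
  let ?W = "V - {u, v}" let ?E = "even_verts ?W h"
  have h': "h t u = h t v" if "t \<in> ?W" for t 
    using h[of t] symmD[OF s, of t v] symmD[OF s, of t u] V that by auto
  have vu: "h v u = h u v" using symmD[OF s] V by auto
  have deg: "(\<Sum>j\<in>V - {t}. h t j) = (\<Sum>j\<in>?W - {t}. h t j)" if t: "t \<in> ?W" for t
  proof -
    have "(\<Sum>j\<in>V - {t}. h t j) = h t u + (\<Sum>j\<in>V - {t} - {u}. h t j)"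
      by (rule sum.remove) (use V t in auto)
    also have "(\<Sum>j\<in>V - {t} - {u}. h t j) = h t v + (\<Sum>j\<in>V - {t} - {u} - {v}. h t j)"
      by (rule sum.remove) (use V t in auto)
    also have "V - {t} - {u} - {v} = ?W - {t}" by auto
    finally show ?thesis using h'[OF t] by simp
  qed
  have du: "(\<Sum>j\<in>V - {u}. h u j) = h u v + (\<Sum>j\<in>?W. h u j)"
  proof -
    have "V - {u} - {v} = ?W" by auto
    then show ?thesis using sum.remove[of "V - {u}" v "h u"] V by simp
  qed
  have dv: "(\<Sum>j\<in>V - {v}. h v j) = h u v + (\<Sum>j\<in>?W. h u j)"
  proof -
    have "V - {v} - {u} = ?W" by auto
    moreover have "(\<Sum>j\<in>?W. h v j) = (\<Sum>j\<in>?W. h u j)" by (rule sum.cong) (use h in auto)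
    ultimately show ?thesis using sum.remove[of "V - {v}" u "h v"] V vu by simp
  qed
  have EW: "?E \<subseteq> ?W" "finite ?E" "u \<notin> ?E" "v \<notin> ?E"
    using even_verts_subset[of ?W h] V finite_subset[of ?E ?W] by auto
  show ?thesis
  proof (cases "h u v + (\<Sum>j\<in>?W. h u j) = 0")
    case False
    have E: "even_verts V h = ?E"
    proof (rule Set.set_eqI)
      fix x show "x \<in> even_verts V h \<longleftrightarrow> x \<in> ?E"
        unfolding even_verts_def using V deg[of x] du dv False by (cases "x = u"; cases "x = v") auto
    qed
    have "obstructed V ?E (with_diag h D) = obstructed ?W ?E (with_diag h D)" for D
    proof (rule obstructed_remove_twins[where T = "\<lambda>k. of_bool (k = u \<or> k = v)"])
      show "mulv V (with_diag h D) (\<lambda>k. of_bool (k = u \<or> k = v)) k = 0" if "k \<in> V" "k \<noteq> u" "k \<noteq> v" for k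
        using h'[of k] that V by (simp add: mulv_pair with_diag_def)
    qed (use V EW s in \<open>auto intro: symm_with_diag\<close>)
    then show ?thesis unfolding state_sum_def E by simp
  next
    case True
    let ?F = "insert u (insert v ?E)"
    have E: "even_verts V h = ?F"
      unfolding even_verts_def using V deg du dv True by auto
    have FV: "?F \<subseteq> V" "finite ?F" using V EW by auto
    let ?ob = "\<lambda>D. of_bool (obstructed V ?F (with_diag h D)) :: bit"
    have "state_sum V h = (\<Sum>D\<in>Pow (insert v ?E). ?ob D + ?ob (insert u D))"
      unfolding state_sum_def E by (rule sum_Pow_insert) (use EW V in auto)
    also have "\<dots> = (\<Sum>D\<in>Pow ?E. ?ob D + ?ob (insert u D) + (?ob (insert v D) + ?ob (insert u (insert v D))))"
      by (rule sum_Pow_insert) (use EW V in auto)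
    also have "\<dots> = state_sum ?W h"
      unfolding state_sum_def
    proof (rule sum.cong[OF refl])
      fix D assume D: "D \<in> Pow ?E"
      then have uvD: "u \<notin> D" "v \<notin> D" using EW by auto
      \<comment> \<open>Exchanging \<open>u\<close> and \<open>v\<close> preserves \<open>h\<close>
        off the diagonal and so identifies the two states that select exactly one of them.\<close>
      let ?f = "\<lambda>k. if k = u then v else if k = v then u else k"
      have "obstructed V ?F (with_diag h (insert u D)) = obstructed V (?f ` ?F) (with_diag h (insert v D))"
      proof (rule obstructed_iso)
        show "bij_betw ?f V V" by (rule bij_betw_byWitness[where f' = ?f]) (use V in auto)
        show "with_diag h (insert v D) (?f i) (?f j) = with_diag h (insert u D) i j" if "i \<in> V" "j \<in> V" for i j
          using that V uvD h[of i] h[of j] h'[of i] h'[of j] vu unfolding with_diag_def by auto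
      qed (use V FV in auto)
      moreover have "?f ` ?F = ?F" using EW V by (auto simp: image_iff)
      ultimately have mid: "?ob (insert u D) = ?ob (insert v D)" by simp
      have row: "with_diag h D' i u + with_diag h D' i v = 0" if "i \<in> ?E" for i D'
        using that EW h'[of i] unfolding with_diag_def by auto
      \<comment> \<open>If both diagonal entries equal \<open>h u v\<close>, the columns of
        \<open>u\<close> and \<open>v\<close> in the block coincide.\<close>
      have sing: "\<not> nonsing ?F (with_diag h D')" 
        if "with_diag h D' u u = h u v" "with_diag h D' v v = h u v" for D'
      proof (rule not_nonsingI[where x = "\<lambda>k. of_bool (k = u \<or> k = v)" and j = u])
        show "mulv ?F (with_diag h D') (\<lambda>k. of_bool (k = u \<or> k = v)) i = 0" if iF: "i \<in> ?F" for i
        proof -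
          have "mulv ?F (with_diag h D') (\<lambda>k. of_bool (k = u \<or> k = v)) i 
             = with_diag h D' i u + with_diag h D' i v"
            by (rule mulv_pair) (use FV V in auto)
          moreover consider "i \<in> ?E" | "i = u" | "i = v" using iF by blast
          then have "with_diag h D' i u + with_diag h D' i v = 0"
          proof cases
            case 1 then show ?thesis by (rule row)
          next
            case 2 then show ?thesis using \<open>with_diag h D' u u = h u v\<close> V(4) by (simp add: with_diag_def)
          next
            case 3 then show ?thesis using \<open>with_diag h D' v v = h u v\<close> V(4) vu by (simp add: with_diag_def)
          qed
          ultimately show ?thesis by simp
        qed
      qed auto
      have O: "?F - {u} - {v} = ?E" "?F - {u, v} = ?E" "V - {u} - {v} = ?W" using EW by auto
      show "?ob D + ?ob (insert u D) + (?ob (insert v D) + ?ob (insert u (insert v D))) 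
          = of_bool (obstructed ?W ?E (with_diag h D))"
      proof (cases "h u v = 0")
        case h0: True
        have "?ob D = 0" using sing[of D] h0 uvD by (simp add: obstructed_def with_diag_def)
        let ?N = "with_diag h (insert u (insert v D))"
        let ?N' = "\<lambda>i j. ?N i j + ?N i u * ?N u j"
        have "obstructed V ?F ?N = obstructed (V - {u}) (?F - {u}) ?N'"
          by (rule obstructed_eliminate) (use V FV in \<open>auto simp: with_diag_def\<close>)
        also have "\<dots> = obstructed (V - {u} - {v}) (?F - {u} - {v}) (\<lambda>i j. ?N' i j + ?N' i v * ?N' v j)"
          by (rule obstructed_eliminate) (use V FV vu h0 in \<open>auto simp: with_diag_def\<close>)
        also have "\<dots> = obstructed ?W ?E (with_diag h D)"
          unfolding O
        proof (rule obstructed_cong)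
          fix i j assume ij: "i \<in> ?W" "j \<in> ?W"
          then show "?N' i j + ?N' i v * ?N' v j = with_diag h D i j"
            using h[of j] h'[of i] V h0 vu by (auto simp: with_diag_def algebra_simps)
        qed (use V EW in auto)
        finally show ?thesis using mid \<open>?ob D = 0\<close> by simp
      next
        case False
        then have h1: "h u v = 1" by simp
        have z: "?ob (insert u (insert v D)) = 0" 
          using sing[of "insert u (insert v D)"] h1 by (simp add: obstructed_def with_diag_def)
        let ?N = "with_diag h D"
        have "obstructed V ?F ?N = obstructed ?W (?F - {u, v}) (\<lambda>i j. ?N i j + ?N i u * ?N v j + ?N i v * ?N u j)"
          by (rule obstructed_eliminate_pair) (use V FV vu uvD h1 in \<open>auto simp: with_diag_def\<close>)
        also have "\<dots> = obstructed ?W ?E ?N"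
          unfolding O
        proof (rule obstructed_cong)
          fix i j assume ij: "i \<in> ?W" "j \<in> ?W"
          then show "?N i j + ?N i u * ?N v j + ?N i v * ?N u j = ?N i j"
            using h[of j] h'[of i] V by (auto simp: with_diag_def algebra_simps)
        qed (use V EW in auto)
        finally show ?thesis using mid z by simp
      qed
    qed
    finally show ?thesis .
  qed
qed

section \<open>The third Reidemeister move on the state sum\<close>

lemma mulv_remove3:
  assumes "finite V" "u \<in> V" "v \<in> V" "w \<in> V" "u \<noteq> v" "u \<noteq> w" "v \<noteq> w"
  shows "mulv V N x i = N i u * x u + N i v * x v + N i w * x w + mulv (V - {u, v, w}) N x i"
proof -
  have "mulv V N x i = N i u * x u + mulv (V - {u}) N x i"
    using assms by (intro mulv_remove) auto
  also have "mulv (V - {u}) N x i = N i v * x v + mulv (V - {u} - {v}) N x i"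
    using assms by (intro mulv_remove) auto
  also have "mulv (V - {u} - {v}) N x i = N i w * x w + mulv (V - {u} - {v} - {w}) N x i"
    using assms by (intro mulv_remove) auto
  also have "V - {u} - {v} - {w} = V - {u, v, w}" by auto
  finally show ?thesis by (simp add: add.assoc)
qed

text \<open>The diagonal of \<open>C\<close> is normalised so that the columns of \<open>u, v, w\<close> cancel; adding
  the all-one block \<open>T i * T j\<close> is the third Reidemeister move.\<close>

locale triangle =
  fixes V E :: "'a set" and C :: "'a \<Rightarrow> 'a \<Rightarrow> bit" and u v w :: 'a
  assumes V: "finite V" "E \<subseteq> V" and uvw: "u \<in> V" "v \<in> V" "w \<in> V" "u \<noteq> v" "u \<noteq> w" "v \<noteq> w"
    and s: "symm V C" and C: "\<And>i. i \<in> V \<Longrightarrow> C i u + C i v + C i w = 0"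
begin

definition T :: "'a \<Rightarrow> bit" where "T k = of_bool (k = u \<or> k = v \<or> k = w)"

lemma T_simps [simp]: "T u = 1" "T v = 1" "T w = 1" "i \<noteq> u \<Longrightarrow> i \<noteq> v \<Longrightarrow> i \<noteq> w \<Longrightarrow> T i = 0"
  by (simp_all add: T_def)

lemma mulv_T: "mulv V N T i = N i u + N i v + N i w"
  unfolding T_def by (rule mulv_triple) (use V uvw in auto)

lemma sum_C: "mulv V C x u + mulv V C x v + mulv V C x w = 0"
proof -
  have "mulv V C x u + mulv V C x v + mulv V C x w = (\<Sum>k\<in>V. (C k u + C k v + C k w) * x k)"
    unfolding mulv_def sum.distrib[symmetric] using symmD[OF s] uvw
    by (intro sum.cong refl) (simp add: distrib_right)
  also have "\<dots> = 0" using C by simp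
  finally show ?thesis .
qed

lemma mulv_shift: "i \<in> V \<Longrightarrow> mulv V C (\<lambda>k. x k + c * T k) i = mulv V C x i"
proof -
  assume i: "i \<in> V"
  have "mulv V C (\<lambda>k. c * T k) i = c * mulv V C T i"
    unfolding mulv_def by (simp add: sum_distrib_left ac_simps)
  then show ?thesis using C[OF i] by (simp add: mulv_add mulv_T)
qed

lemma mulv_J: "mulv V (\<lambda>i j. C i j + T i * T j) x i = mulv V C x i + T i * (x u + x v + x w)"
proof -
  have "(\<Sum>k\<in>V. T k * x k) = mulv V (\<lambda>_. x) T i" unfolding mulv_def by (simp add: mult.commute)
  then show ?thesis by (simp add: mulv_mat_add mulv_outer mulv_T)
qed

lemma mulv_diag:
  assumes "i \<in> V"
  shows "mulv V (\<lambda>i j. N i j + of_bool (i = j) * d j) x i = mulv V N x i + d i * x i"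
proof -
  have "mulv V (\<lambda>i j. of_bool (i = j) * d j) x i = (\<Sum>j\<in>V. of_bool (j = i) * (d j * x j))"
    unfolding mulv_def by (intro sum.cong) auto
  also have "\<dots> = d i * x i" using V assms by (simp add: sum_unit)
  finally show ?thesis by (simp add: mulv_mat_add)
qed

lemma singular: "u \<in> E \<Longrightarrow> v \<in> E \<Longrightarrow> w \<in> E \<Longrightarrow> \<not> obstructed V E C"
proof -
  assume uE: "u \<in> E" "v \<in> E" "w \<in> E"
  have "\<not> nonsing E C"
  proof (rule not_nonsingI[where x = T and j = u])
    fix i assume "i \<in> E"
    then have "i \<in> V" using V by auto
    have "finite E" using V finite_subset by auto
    then have "mulv E C T i = C i u + C i v + C i w"
      unfolding T_def by (intro mulv_triple) (use uE uvw in auto)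
    then show "mulv E C T i = 0" using C[OF \<open>i \<in> V\<close>] by simp
  qed (use uE in auto)
  then show ?thesis unfolding obstructed_def by simp
qed

text \<open>Adding the equations at \<open>u, v, w\<close> eliminates \<open>C\<close> and leaves
  \<open>x u = 0\<close> for the first matrix and \<open>x u + x v + x w = 0\<close> for the second.
  Under its condition each correction to \<open>C\<close> vanishes, and \<open>C\<close> does not
  see multiples of \<open>T\<close>, so a suitable multiple carries one kind of solution to the
  other. Values outside \<open>E\<close> are untouched since \<open>T\<close> is supported in
  \<open>E\<close>.\<close>

lemma one_vs_none:
  assumes uE: "u \<in> E" "v \<in> E" "w \<in> E"
  shows "obstructed V E (\<lambda>i j. C i j + of_bool (i = j) * of_bool (j = u))
       = obstructed V E (\<lambda>i j. C i j + T i * T j)"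
proof (rule obstructed_transfer[where d = "\<lambda>_. 0"])
  let ?N1 = "\<lambda>i j. C i j + of_bool (i = j) * of_bool (j = u)" and ?N2 = "\<lambda>i j. C i j + T i * T j"
  { fix x assume x: "\<And>i. i \<in> E \<Longrightarrow> mulv V ?N1 x i = 0"
    have "mulv V ?N1 x u + mulv V ?N1 x v + mulv V ?N1 x w = 0" using x uE by simp
    then have "(mulv V C x u + mulv V C x v + mulv V C x w) + x u = 0" 
      using uvw by (simp add: mulv_diag algebra_simps)
    then have xu: "x u = 0" unfolding sum_C by simp
    let ?y = "\<lambda>k. x k + (x v + x w) * T k"
    have y: "mulv V ?N2 ?y i = mulv V ?N1 x i" if "i \<in> V" for i
      using xu that by (simp add: mulv_J mulv_diag mulv_shift)
    show "\<exists>y. (\<forall>i\<in>E. mulv V ?N2 y i = 0) \<and>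
          (\<forall>i\<in>V - E. y i = x i \<and> mulv V ?N2 y i = mulv V ?N1 x i + 0 * x i) \<and>
          ((\<forall>i\<in>V. y i = 0) \<longrightarrow> (\<forall>i\<in>V. x i = 0))"
    proof (intro exI[of _ ?y] conjI ballI impI)
      fix i assume "i \<in> V - E"
      then show "?y i = x i" using uE by (auto simp: T_def)
    next
      fix i assume z: "\<forall>i\<in>V. ?y i = 0" and "i \<in> V"
      have "x v + x w = 0" using bspec[OF z uvw(1)] xu by simp
      then show "x i = 0" using bspec[OF z \<open>i \<in> V\<close>] by simp
    qed (use y x V in auto) }
  { fix x assume x: "\<And>i. i \<in> E \<Longrightarrow> mulv V ?N2 x i = 0"
    have "mulv V ?N2 x u + mulv V ?N2 x v + mulv V ?N2 x w = 0" using x uE by simp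
    then have "(mulv V C x u + mulv V C x v + mulv V C x w) + (x u + x v + x w) = 0" 
      using uvw by (simp add: mulv_J algebra_simps)
    then have xs: "x u + x v + x w = 0" unfolding sum_C by simp
    let ?y = "\<lambda>k. x k + x u * T k"
    have y: "mulv V ?N1 ?y i = mulv V ?N2 x i" if "i \<in> V" for i
      using xs that by (auto simp add: mulv_J mulv_diag mulv_shift)
    show "\<exists>y. (\<forall>i\<in>E. mulv V ?N1 y i = 0) \<and>
          (\<forall>i\<in>V - E. y i = x i \<and> mulv V ?N1 y i = mulv V ?N2 x i + 0 * x i) \<and>
          ((\<forall>i\<in>V. y i = 0) \<longrightarrow> (\<forall>i\<in>V. x i = 0))"
    proof (intro exI[of _ ?y] conjI ballI impI)
      fix i assume "i \<in> V - E"
      then show "?y i = x i" using uE by (auto simp: T_def)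
    next
      fix i assume z: "\<forall>i\<in>V. ?y i = 0" and "i \<in> V"
      have "x u = 0" using bspec[OF z uvw(2)] bspec[OF z uvw(3)] xs by (simp add: bit_add_eq_0)
      then show "x i = 0" using bspec[OF z \<open>i \<in> V\<close>] by simp
    qed (use y x V in auto) }
qed (use V in auto)

text \<open>For both matrices the sum of the equations at \<open>u, v, w\<close> gives
  \<open>x v = x w\<close>. Adding \<open>(x u + x v) * T\<close> then exchanges this common value
  with \<open>x u\<close>, which is just what turns one correction into the other.\<close>

lemma two_vs_one:
  assumes uE: "u \<in> E" "v \<in> E" "w \<in> E"
  shows "obstructed V E (\<lambda>i j. C i j + of_bool (i = j) * of_bool (j = v \<or> j = w))
       = obstructed V E (\<lambda>i j. (C i j + T i * T j) + of_bool (i = j) * of_bool (j = u))"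
proof (rule obstructed_transfer[where d = "\<lambda>_. 0"])
  let ?N1 = "\<lambda>i j. C i j + of_bool (i = j) * of_bool (j = v \<or> j = w)" 
    and ?N2 = "\<lambda>i j. (C i j + T i * T j) + of_bool (i = j) * of_bool (j = u)"
  { fix x assume x: "\<And>i. i \<in> E \<Longrightarrow> mulv V ?N1 x i = 0"
    have "mulv V ?N1 x u + mulv V ?N1 x v + mulv V ?N1 x w = 0" using x uE by simp
    then have "(mulv V C x u + mulv V C x v + mulv V C x w) + (x v + x w) = 0" 
      using uvw by (simp add: mulv_diag algebra_simps)
    then have xs: "x v = x w" unfolding sum_C by (simp add: bit_add_eq_0)
    let ?y = "\<lambda>k. x k + (x u + x v) * T k"
    have y: "mulv V ?N2 ?y i = mulv V ?N1 x i" if "i \<in> V" for i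
      unfolding mulv_diag[OF that] mulv_J mulv_shift[OF that]
      using xs uvw by (cases "i = u"; cases "i = v"; cases "i = w") (simp_all add: algebra_simps)
    show "\<exists>y. (\<forall>i\<in>E. mulv V ?N2 y i = 0) \<and>
          (\<forall>i\<in>V - E. y i = x i \<and> mulv V ?N2 y i = mulv V ?N1 x i + 0 * x i) \<and>
          ((\<forall>i\<in>V. y i = 0) \<longrightarrow> (\<forall>i\<in>V. x i = 0))"
    proof (intro exI[of _ ?y] conjI ballI impI)
      fix i assume "i \<in> V - E"
      then show "?y i = x i" using uE by (auto simp: T_def)
    next
      fix i assume z: "\<forall>i\<in>V. ?y i = 0" and "i \<in> V"
      have "x u = 0" "x v = 0" using bspec[OF z uvw(1)] bspec[OF z uvw(2)] by (simp_all add: algebra_simps)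
      then show "x i = 0" using bspec[OF z \<open>i \<in> V\<close>] by simp
    qed (use y x V in auto) }
  { fix x assume x: "\<And>i. i \<in> E \<Longrightarrow> mulv V ?N2 x i = 0"
    have "mulv V ?N2 x u + mulv V ?N2 x v + mulv V ?N2 x w = 0" using x uE by simp
    then have "(mulv V C x u + mulv V C x v + mulv V C x w) + (x v + x w) = 0" 
      using uvw unfolding mulv_diag[OF uvw(1)] mulv_diag[OF uvw(2)] mulv_diag[OF uvw(3)] mulv_J
      by (simp add: algebra_simps)
    then have xs: "x v = x w" unfolding sum_C by (simp add: bit_add_eq_0)
    let ?y = "\<lambda>k. x k + (x u + x v) * T k"
    have y: "mulv V ?N1 ?y i = mulv V ?N2 x i" if "i \<in> V" for i
      unfolding mulv_diag[OF that] mulv_J mulv_shift[OF that]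
      using xs uvw by (cases "i = u"; cases "i = v"; cases "i = w") (simp_all add: algebra_simps)
    show "\<exists>y. (\<forall>i\<in>E. mulv V ?N1 y i = 0) \<and>
          (\<forall>i\<in>V - E. y i = x i \<and> mulv V ?N1 y i = mulv V ?N2 x i + 0 * x i) \<and>
          ((\<forall>i\<in>V. y i = 0) \<longrightarrow> (\<forall>i\<in>V. x i = 0))"
    proof (intro exI[of _ ?y] conjI ballI impI)
      fix i assume "i \<in> V - E"
      then show "?y i = x i" using uE by (auto simp: T_def)
    next
      fix i assume z: "\<forall>i\<in>V. ?y i = 0" and "i \<in> V"
      have "x u = 0" "x v = 0" using bspec[OF z uvw(1)] bspec[OF z uvw(2)] by (simp_all add: algebra_simps)
      then show "x i = 0" using bspec[OF z \<open>i \<in> V\<close>] by simp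
    qed (use y x V in auto) }
qed (use V in auto)

text \<open>In both matrices the columns of \<open>u, v, w\<close> cancel in every row except those
  of \<open>v\<close> and \<open>w\<close>, so \<open>v\<close> and \<open>w\<close> are twins in
  the Schur complement. Once they are deleted, the two corrections meet only in the entry
  \<open>u, u\<close> and cancel there.\<close>

lemma remove_odd_pair:
  assumes uE: "u \<in> E" "v \<notin> E" "w \<notin> E"
  shows "obstructed V E C = 
    obstructed V E (\<lambda>i j. (C i j + T i * T j) + of_bool (i = j) * of_bool (j = u))"
proof -
  let ?N2 = "\<lambda>i j. (C i j + T i * T j) + of_bool (i = j) * of_bool (j = u)"
  have "obstructed V E C = obstructed (V - {v, w}) E C"
    by (rule obstructed_remove_twins[where T = T]) (use V uvw uE s C in \<open>auto simp: mulv_T T_def\<close>)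
  also have "\<dots> = obstructed (V - {v, w}) E ?N2"
    by (rule obstructed_cong) (use V uE uvw in \<open>auto simp: T_def\<close>)
  also have "\<dots> = obstructed V E ?N2"
  proof (rule obstructed_remove_twins[where T = T, symmetric])
    show "symm V ?N2" using s unfolding symm_def by (auto simp: mult.commute)
    show "mulv V ?N2 T k = 0" if "k \<in> V" "k \<noteq> v" "k \<noteq> w" for k
      using that C[OF that(1)] uvw by (cases "k = u") (simp_all add: mulv_T algebra_simps)
  qed (use V uvw uE in \<open>auto simp: T_def\<close>)
  finally show ?thesis .
qed

text \<open>For the other diagonal entry at \<open>u\<close> the odd vertices survive, and the move
  exchanges them: solutions for \<open>?N1\<close> become solutions for \<open>?N2\<close> with
  \<open>v\<close> and \<open>w\<close> renamed into each other, once \<open>x u\<close> is replaced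
  by \<open>x u + x v + x w\<close>.\<close>

lemma swap_odd_pair:
  assumes uE: "u \<in> E" "v \<notin> E" "w \<notin> E"
  shows "obstructed V E (\<lambda>i j. C i j + of_bool (i = j) * of_bool (j = u))
       = obstructed V E (\<lambda>i j. C i j + T i * T j)"
proof -
  define \<pi> where "\<pi> k = (if k = v then w else if k = w then v else k)" for k
  let ?N1 = "\<lambda>i j. C i j + of_bool (i = j) * of_bool (j = u)" and ?N2 = "\<lambda>i j. C i j + T i * T j"
  let ?N3 = "\<lambda>i j. ?N2 (\<pi> i) (\<pi> j)"
  let ?R = "V - {u, v, w}"
  note split = mulv_remove3[OF V(1) uvw]
  have \<pi>[simp]: "\<pi> u = u" "\<pi> v = w" "\<pi> w = v" "i \<noteq> v \<Longrightarrow> i \<noteq> w \<Longrightarrow> \<pi> i = i" for i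
    using uvw by (auto simp: \<pi>_def)
  have R3: "mulv ?R ?N3 x i = mulv ?R C x (\<pi> i)" for x i
    unfolding mulv_def by (rule sum.cong) auto
  have Cuv: "C u u = C u v + C u w" "C v u = C u v" "C w u = C u w" "C v v = C u v + C v w" 
     "C w w = C u w + C v w" "C w v = C v w"
    using C[OF uvw(1)] C[OF uvw(2)] C[OF uvw(3)] symmD[OF s] uvw by (simp_all add: bit_add_eq_0 add.assoc) 
  have SR: "mulv ?R C x u = mulv ?R C x v + mulv ?R C x w" for x
    using sum_C[of x] unfolding split[of C] Cuv by (simp add: algebra_simps bit_add_eq_0)
  have e1: "mulv V ?N1 x i = C i u * x u + C i v * x v + C i w * x w + mulv ?R C x i + of_bool (i = u) * x i" 
    if "i \<in> V" for x i
    unfolding mulv_diag[OF that] split[of C] ..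
  have e3: "mulv V ?N3 x i = ?N3 i u * x u + ?N3 i v * x v + ?N3 i w * x w + mulv ?R C x (\<pi> i)" for x i
    unfolding split[of ?N3] R3 ..
  have solve: "p + s + q = 0 \<Longrightarrow> s = p + q" for p s q :: bit
    by (cases p; cases s; cases q) auto
  \<comment> \<open>The equation at \<open>u\<close> together with \<open>SR\<close> fixes the
    difference between what the outer coordinates contribute to rows \<open>v\<close> and
    \<open>w\<close>; this is what exchanging the two rows has to make up for.\<close>
  have S: "mulv ?R C x v = mulv ?R C x w + (C u v * x v + C u w * x w + C u v * x u + C u w * x u + x u)"
    if "mulv V ?N1 x u = 0" for x
  proof -
    have "mulv ?R C x u = C u u * x u + C u v * x v + C u w * x w + x u"
      by (rule solve) (use that e1[OF uvw(1), of x] in simp)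
    then show ?thesis using SR[of x] Cuv by (simp add: algebra_simps bit_add_move)
  qed
  have main: "mulv V ?N3 (x(u := x u + x v + x w)) i = mulv V ?N1 x i" 
    if "mulv V ?N1 x u = 0" "i \<in> V" for x i
  proof -
    consider "i = u" | "i = v" | "i = w" | "i \<noteq> u" "i \<noteq> v" "i \<noteq> w" by blast
    then show ?thesis
    proof cases
      case 4
      then have "C i u = C i v + C i w" using C[OF that(2)] by (simp add: bit_add_eq_0 add.assoc)
      then show ?thesis unfolding e3 e1[OF that(2)] using 4 uvw by (simp add: algebra_simps)
    qed (unfold e3 e1[OF that(2)], insert uvw S[OF that(1)] SR[of x] Cuv, simp_all add: algebra_simps)
  qed
  have S': "mulv ?R C x v = mulv ?R C x w + (x u + x v + x w + C u v * x w + C u w * x v + C u v * x u + C u w * x u)"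
    if "mulv V ?N3 x u = 0" for x
  proof -
    have "mulv ?R C x u = (C u u + 1) * x u + (C u w + 1) * x v + (C u v + 1) * x w + 0"
      by (rule solve) (use that e3[of x u] in simp)
    then show ?thesis using SR[of x] Cuv by (simp add: algebra_simps bit_add_move)
  qed
  have main': "mulv V ?N1 (x(u := x u + x v + x w)) i = mulv V ?N3 x i" 
    if "mulv V ?N3 x u = 0" "i \<in> V" for x i
  proof -
    consider "i = u" | "i = v" | "i = w" | "i \<noteq> u" "i \<noteq> v" "i \<noteq> w" by blast
    then show ?thesis
    proof cases
      case 4
      then have "C i u = C i v + C i w" using C[OF that(2)] by (simp add: bit_add_eq_0 add.assoc)
      then show ?thesis unfolding e3 e1[OF that(2)] using 4 uvw by (simp add: algebra_simps)
    qed (unfold e3 e1[OF that(2)], insert uvw S'[OF that(1)] SR[of x] Cuv, simp_all add: algebra_simps)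
  qed
  have "obstructed V E ?N1 = obstructed V E ?N3"
  proof (rule obstructed_transfer[where d = "\<lambda>_. 0"])
    { fix x assume x: "\<And>i. i \<in> E \<Longrightarrow> mulv V ?N1 x i = 0"
      show "\<exists>y. (\<forall>i\<in>E. mulv V ?N3 y i = 0) \<and>
          (\<forall>i\<in>V - E. y i = x i \<and> mulv V ?N3 y i = mulv V ?N1 x i + 0 * x i) \<and>
          ((\<forall>i\<in>V. y i = 0) \<longrightarrow> (\<forall>i\<in>V. x i = 0))"
      proof (intro exI[of _ "x(u := x u + x v + x w)"] conjI ballI impI)
        fix i assume z: "\<forall>i\<in>V. (x(u := x u + x v + x w)) i = 0" and "i \<in> V"
        have "x u = 0" using bspec[OF z uvw(1)] bspec[OF z uvw(2)] bspec[OF z uvw(3)] uvw by simp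
        then show "x i = 0" using bspec[OF z \<open>i \<in> V\<close>] by (cases "i = u") auto
      qed (use x main[of x] uE V uvw in auto) }
    { fix x assume x: "\<And>i. i \<in> E \<Longrightarrow> mulv V ?N3 x i = 0"
      show "\<exists>y. (\<forall>i\<in>E. mulv V ?N1 y i = 0) \<and>
          (\<forall>i\<in>V - E. y i = x i \<and> mulv V ?N1 y i = mulv V ?N3 x i + 0 * x i) \<and>
          ((\<forall>i\<in>V. y i = 0) \<longrightarrow> (\<forall>i\<in>V. x i = 0))"
      proof (intro exI[of _ "x(u := x u + x v + x w)"] conjI ballI impI)
        fix i assume z: "\<forall>i\<in>V. (x(u := x u + x v + x w)) i = 0" and "i \<in> V"
        have "x u = 0" using bspec[OF z uvw(1)] bspec[OF z uvw(2)] bspec[OF z uvw(3)] uvw by simp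
        then show "x i = 0" using bspec[OF z \<open>i \<in> V\<close>] by (cases "i = u") auto
      qed (use x main'[of x] uE V uvw in auto) }
  qed (use V in auto)
  also have "\<dots> = obstructed V (\<pi> ` E) ?N2"
    by (rule obstructed_iso) (use V uvw in \<open>auto simp: \<pi>_def intro!: bij_betw_byWitness[where f' = \<pi>]\<close>)
  also have "\<pi> ` E = E" using uE by (auto simp: \<pi>_def image_iff)
  finally show ?thesis .
qed

end

text \<open>The diagonal at \<open>u, v, w\<close> is given by bits rather than by membership in
  \<open>D\<close>, so that it can be shifted by field elements.\<close>

definition set_diag3 :: "'a \<Rightarrow> 'a \<Rightarrow> 'a \<Rightarrow> ('a \<Rightarrow> 'a \<Rightarrow> bit) \<Rightarrow> 'a set \<Rightarrow> bit \<Rightarrow> bit \<Rightarrow> bit \<Rightarrow> 'a \<Rightarrow> 'a \<Rightarrow> bit"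
  where "set_diag3 u v w h D p q r i j =
    (if i = j then (if i = u then p else if i = v then q else if i = w then r else of_bool (i \<in> D))
     else h i j)"

locale triangle_flip =
  fixes V :: "'a set" and h h' :: "'a \<Rightarrow> 'a \<Rightarrow> bit" and u v w :: 'a
  assumes V: "finite V" and uvw: "u \<in> V" "v \<in> V" "w \<in> V" "u \<noteq> v" "u \<noteq> w" "v \<noteq> w" and s: "symm V h"
    and h: "\<And>t. t \<in> V \<Longrightarrow> t \<notin> {u, v, w} \<Longrightarrow> h t u + h t v + h t w = 0"
    and h': "\<And>i j. i \<in> V \<Longrightarrow> j \<in> V \<Longrightarrow> i \<noteq> j \<Longrightarrow>
       h' i j = h i j + of_bool (i \<in> {u, v, w} \<and> j \<in> {u, v, w})"
begin

text \<open>These are the diagonal entries for which the columns of \<open>u, v, w\<close> also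
  cancel in the rows of the triangle. Complementing the triangle changes two summands in no or both
  terms at once, so \<open>h'\<close> has the same three values (\<open>flip_sums\<close>).\<close>

abbreviation "p0 \<equiv> h u v + h u w"
abbreviation "q0 \<equiv> h u v + h v w"
abbreviation "r0 \<equiv> h u w + h v w"

lemma hs: "h v u = h u v" "h w u = h u w" "h w v = h v w"
  using symmD[OF s] uvw by auto

lemma triangle: "E \<subseteq> V \<Longrightarrow> triangle V E (set_diag3 u v w h D p0 q0 r0) u v w"
proof (unfold_locales)
  show "symm V (set_diag3 u v w h D p0 q0 r0)"
    unfolding symm_def set_diag3_def using symmD[OF s] by auto
  let ?C = "set_diag3 u v w h D p0 q0 r0"
  show "?C i u + ?C i v + ?C i w = 0" if "i \<in> V" for i
    using h[OF that] hs uvw by (cases "i \<in> {u, v, w}") (auto simp: set_diag3_def ac_simps)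
qed (use V uvw in auto)

lemma J: "set_diag3 u v w h D p q r i j + triangle.T u v w i * triangle.T u v w j =
    set_diag3 u v w h' D (p + 1) (q + 1) (r + 1) i j" if "i \<in> V" "j \<in> V" "E \<subseteq> V"
  using h'[OF that(1,2)] uvw by (auto simp: set_diag3_def triangle.T_def[OF triangle[OF that(3)]])

lemma singular_state:
  assumes "E \<subseteq> V" "u \<in> E" "v \<in> E" "w \<in> E"
  shows "\<not> obstructed V E (set_diag3 u v w h D p0 q0 r0)"
  by (rule triangle.singular[OF triangle]) (use assms in auto)

lemma one_state:
  assumes "E \<subseteq> V" "u \<in> E" "v \<in> E" "w \<in> E"
  shows "obstructed V E (set_diag3 u v w h D (p0 + 1) q0 r0) = 
    obstructed V E (set_diag3 u v w h' D (p0 + 1) (q0 + 1) (r0 + 1))"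
proof -
  have "obstructed V E (set_diag3 u v w h D (p0 + 1) q0 r0) = 
    obstructed V E (\<lambda>i j. set_diag3 u v w h D p0 q0 r0 i j + of_bool (i = j) * of_bool (j = u))"
    by (rule obstructed_cong) (use V assms uvw in \<open>auto simp: set_diag3_def\<close>)
  also have "\<dots> = obstructed V E (\<lambda>i j. set_diag3 u v w h D p0 q0 r0 i j + triangle.T u v w i * triangle.T u v w j)"
    by (rule triangle.one_vs_none[OF triangle]) (use assms in auto)
  also have "\<dots> = obstructed V E (set_diag3 u v w h' D (p0 + 1) (q0 + 1) (r0 + 1))"
    by (rule obstructed_cong) (use V assms(1) J[OF _ _ assms(1)] in auto)
  finally show ?thesis .
qed

lemma two_state:
  assumes "E \<subseteq> V" "u \<in> E" "v \<in> E" "w \<in> E"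
  shows "obstructed V E (set_diag3 u v w h D p0 (q0 + 1) (r0 + 1)) = 
    obstructed V E (set_diag3 u v w h' D p0 (q0 + 1) (r0 + 1))"
proof -
  have "obstructed V E (set_diag3 u v w h D p0 (q0 + 1) (r0 + 1)) = 
    obstructed V E (\<lambda>i j. set_diag3 u v w h D p0 q0 r0 i j + of_bool (i = j) * of_bool (j = v \<or> j = w))"
    by (rule obstructed_cong) (use V assms uvw in \<open>auto simp: set_diag3_def\<close>)
  also have "\<dots> = obstructed V E (\<lambda>i j. set_diag3 u v w h D p0 q0 r0 i j + triangle.T u v w i * triangle.T u v w j
      + of_bool (i = j) * of_bool (j = u))"
    by (rule triangle.two_vs_one[OF triangle]) (use assms in auto)
  also have "\<dots> = obstructed V E (set_diag3 u v w h' D p0 (q0 + 1) (r0 + 1))"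
    by (rule obstructed_cong) (use V uvw assms(1) in \<open>auto simp: J[OF _ _ assms(1)]\<close>, auto simp: set_diag3_def)
  finally show ?thesis .
qed

text \<open>The diagonals at \<open>v\<close> and \<open>w\<close> are outside \<open>E\<close> and
  can be normalised freely. That at \<open>u\<close> is either \<open>p0\<close>, when the odd pair
  cancels on both sides, or \<open>p0 + 1\<close>, when the pair is exchanged.\<close>

lemma odd_pair_state:
  assumes "E \<subseteq> V" "u \<in> E" "v \<notin> E" "w \<notin> E"
  shows "obstructed V E (with_diag h D) = obstructed V E (with_diag h' D)"
proof -
  let ?C = "set_diag3 u v w h D p0 q0 r0" and ?TT = "\<lambda>i j. triangle.T u v w i * triangle.T u v w j"
  let ?U = "\<lambda>i j. of_bool (i = j) * of_bool (j = u) :: bit"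
  note cong = obstructed_cong[OF V assms(1)]
  show ?thesis
  proof (cases "of_bool (u \<in> D) = p0")
    case True
    have "obstructed V E (with_diag h D) = obstructed V E ?C"
      by (rule cong) (use True uvw assms in \<open>auto simp: set_diag3_def with_diag_def\<close>)
    also have "\<dots> = obstructed V E (\<lambda>i j. ?C i j + ?TT i j + ?U i j)"
      by (rule triangle.remove_odd_pair[OF triangle]) (use assms in auto)
    also have "\<dots> = obstructed V E (with_diag h' D)"
      by (rule cong) (use True uvw assms in \<open>auto simp: J[OF _ _ assms(1)]\<close>, auto simp: set_diag3_def with_diag_def)
    finally show ?thesis .
  next
    case False
    then have F: "of_bool (u \<in> D) = p0 + 1" by (cases "u \<in> D"; cases p0) auto
    have "obstructed V E (with_diag h D) = obstructed V E (\<lambda>i j. ?C i j + ?U i j)"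
      by (rule cong) (use F uvw assms in \<open>auto simp: set_diag3_def with_diag_def\<close>)
    also have "\<dots> = obstructed V E (\<lambda>i j. ?C i j + ?TT i j)"
      by (rule triangle.swap_odd_pair[OF triangle]) (use assms in auto)
    also have "\<dots> = obstructed V E (with_diag h' D)"
      by (rule cong) (use F uvw assms in \<open>auto simp: J[OF _ _ assms(1)]\<close>, auto simp: set_diag3_def with_diag_def)
    finally show ?thesis .
  qed
qed

lemma permute:
  shows "triangle_flip V h h' v u w" and "triangle_flip V h h' w u v"
proof -
  show "triangle_flip V h h' v u w"
    by unfold_locales (use V uvw s h h' in \<open>auto simp: ac_simps\<close>)
  show "triangle_flip V h h' w u v"
    by unfold_locales (use V uvw s h h' in \<open>auto simp: ac_simps\<close>)
qed

lemma reverse: "triangle_flip V h' h u v w"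
proof unfold_locales
  show "symm V h'"
    unfolding symm_def
  proof (intro ballI)
    fix i j assume "i \<in> V" "j \<in> V"
    then show "h' i j = h' j i" using h' symmD[OF s, of i j] by (cases "i = j") auto
  qed
qed (use V uvw h h' in \<open>auto simp: add.assoc\<close>)

lemma flip_sums: "h' u v + h' u w = p0" "h' u v + h' v w = q0" "h' u w + h' v w = r0"
  using h' uvw by (simp_all add: algebra_simps)

text \<open>Count how many diagonal entries differ from \<open>p0, q0, r0\<close>. With none the
  state is singular. Each of the three states with one difference equals the state of the other
  graph with three, and three equal copies reduce to one modulo 2. States with two differences agree
  between the graphs. \<open>reverse\<close> supplies the same comparison with the graphs exchanged,
  so the totals coincide.\<close>

lemma sum_states:
  fixes D :: "'a set"
  assumes "E \<subseteq> V" "u \<in> E" "v \<in> E" "w \<in> E"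
  defines "f g p q r \<equiv> of_bool (obstructed V E (set_diag3 u v w g D p q r)) :: bit"
  shows "f h 0 0 0 + f h 0 0 1 + f h 0 1 0 + f h 0 1 1 + f h 1 0 0 + f h 1 0 1 + f h 1 1 0 + f h 1 1 1
    = f h' 0 0 0 + f h' 0 0 1 + f h' 0 1 0 + f h' 0 1 1 + f h' 1 0 0 + f h' 1 0 1 + f h' 1 1 0 + f h' 1 1 1"
proof -
  have perm: "set_diag3 v u w g D q p r = set_diag3 u v w g D p q r" 
    "set_diag3 w u v g D r p q = set_diag3 u v w g D p q r" for g p q r
    using uvw by (auto simp: set_diag3_def fun_eq_iff)
  have one: "f g (p0 + 1) q0 r0 = f g' (p0 + 1) (q0 + 1) (r0 + 1)"
      "f g p0 (q0 + 1) r0 = f g' (p0 + 1) (q0 + 1) (r0 + 1)"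
      "f g p0 q0 (r0 + 1) = f g' (p0 + 1) (q0 + 1) (r0 + 1)"
      "f g p0 q0 r0 = 0"
    if g: "triangle_flip V g g' u v w" "g u v + g u w = p0" "g u v + g v w = q0" "g u w + g v w = r0"
    for g g'
  proof -
    note hs' = triangle_flip.hs[OF g(1)]
    have g': "g v w + g u w = r0" "g u w + g u v = p0" "g v w + g u v = q0"
      using g(2-4) by (simp_all add: add.commute)
    show "f g (p0 + 1) q0 r0 = f g' (p0 + 1) (q0 + 1) (r0 + 1)"
      using triangle_flip.one_state[OF g(1) assms(1-4), of D] unfolding f_def g(2-4) by simp
    show "f g p0 (q0 + 1) r0 = f g' (p0 + 1) (q0 + 1) (r0 + 1)"
      using triangle_flip.one_state[OF triangle_flip.permute(1)[OF g(1)] assms(1,3,2,4), of D]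
      unfolding f_def perm hs' g(2-4) g' by simp
    show "f g p0 q0 (r0 + 1) = f g' (p0 + 1) (q0 + 1) (r0 + 1)"
      using triangle_flip.one_state[OF triangle_flip.permute(2)[OF g(1)] assms(1,4,2,3), of D]
      unfolding f_def perm hs' g(2-4) g' by simp
    show "f g p0 q0 r0 = 0"
      using triangle_flip.singular_state[OF g(1) assms(1-4), of D] unfolding f_def g(2-4) by simp
  qed
  have two: "f h p0 (q0 + 1) (r0 + 1) = f h' p0 (q0 + 1) (r0 + 1)"
      "f h (p0 + 1) q0 (r0 + 1) = f h' (p0 + 1) q0 (r0 + 1)"
      "f h (p0 + 1) (q0 + 1) r0 = f h' (p0 + 1) (q0 + 1) r0"
    using two_state[OF assms(1-4), of D] 
      triangle_flip.two_state[OF permute(1) assms(1,3,2,4), of D]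
      triangle_flip.two_state[OF permute(2) assms(1,4,2,3), of D]
    unfolding f_def perm hs by (simp_all add: ac_simps)
  note facts = one[OF triangle_flip_axioms refl refl refl] one[OF reverse flip_sums] two
  show ?thesis
    using facts by (cases p0; cases q0; cases r0) (simp_all add: ac_simps)
qed

lemma state_sum_flip: "state_sum V h' = state_sum V h"
proof -
  let ?T = "{u, v, w}" let ?R = "V - {u, v, w}"
  let ?E = "even_verts V h"
  define d where "d t = (\<Sum>j\<in>V - {t}. h t j)" for t
  have sums: "(\<Sum>j\<in>V - {t}. h' t j) = d t" if t: "t \<in> V" for t
  proof -
    have "(\<Sum>j\<in>V - {t}. h' t j) = (\<Sum>j\<in>V - {t}. h t j + of_bool (t \<in> ?T \<and> j \<in> ?T))"
      by (rule sum.cong) (use h' t in auto)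
    also have "\<dots> = d t + (\<Sum>j\<in>V - {t}. of_bool (t \<in> ?T \<and> j \<in> ?T))"
      unfolding d_def by (rule sum.distrib)
    \<comment> \<open>A vertex of the triangle changes its adjacency to exactly two others, so all
      parities persist.\<close>
    also have "(\<Sum>j\<in>V - {t}. of_bool (t \<in> ?T \<and> j \<in> ?T)) = (0::bit)"
    proof (cases "t \<in> ?T")
      case True
      have "(\<Sum>j\<in>V - {t}. of_bool (t \<in> ?T \<and> j \<in> ?T)) = (\<Sum>j\<in>?T - {t}. 1::bit)"
        by (rule sum.mono_neutral_cong_right) (use V uvw True in auto)
      also have "card (?T - {t}) = 2" using True uvw by (subst card_Diff_singleton) auto
      then have "(\<Sum>j\<in>?T - {t}. 1::bit) = 0" by simp
      finally show ?thesis .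
    qed auto
    finally show ?thesis by simp
  qed
  have E': "even_verts V h' = ?E" unfolding even_verts_def using sums unfolding d_def by auto
  have EV: "?E \<subseteq> V" "finite ?E" using even_verts_subset[of V h] V finite_subset by auto
  have mem: "t \<in> ?E \<longleftrightarrow> d t = 0" if "t \<in> V" for t using that by (simp add: even_verts_def d_def)
  have "d u = h u v + h u w + (\<Sum>j\<in>?R. h u j)" "d v = h u v + h v w + (\<Sum>j\<in>?R. h v j)"
     "d w = h u w + h v w + (\<Sum>j\<in>?R. h w j)"
  proof -
    have "d u = (\<Sum>j\<in>insert v (insert w ?R). h u j)" "d v = (\<Sum>j\<in>insert u (insert w ?R). h v j)"
      "d w = (\<Sum>j\<in>insert u (insert v ?R). h w j)"
      unfolding d_def using uvw by (auto intro!: sum.cong)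
    then show "d u = h u v + h u w + (\<Sum>j\<in>?R. h u j)" "d v = h u v + h v w + (\<Sum>j\<in>?R. h v j)"
     "d w = h u w + h v w + (\<Sum>j\<in>?R. h w j)" using V uvw hs by (simp_all add: add.assoc)
  qed
  moreover have "(\<Sum>j\<in>?R. h u j) + (\<Sum>j\<in>?R. h v j) + (\<Sum>j\<in>?R. h w j) = 0"
  proof -
    have "(\<Sum>j\<in>?R. h u j) + (\<Sum>j\<in>?R. h v j) + (\<Sum>j\<in>?R. h w j) = (\<Sum>j\<in>?R. h j u + h j v + h j w)"
      unfolding sum.distrib[symmetric] by (rule sum.cong) (use symmD[OF s] uvw in auto)
    also have "\<dots> = 0" by (rule sum.neutral) (use h in auto)
    finally show ?thesis .
  qed
  \<comment> \<open>Edges inside the triangle are counted twice and the outer columns cancel by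
    \<open>h\<close>; hence the number of odd vertices among \<open>u, v, w\<close> is 0 or
    2.\<close>
  ultimately have dsum: "d u + d v + d w = 0" 
    by (cases "h u v"; cases "h u w"; cases "h v w") (simp_all add: ac_simps)
  consider "u \<in> ?E" "v \<in> ?E" "w \<in> ?E" | "u \<in> ?E" "v \<notin> ?E" "w \<notin> ?E" 
    | "v \<in> ?E" "u \<notin> ?E" "w \<notin> ?E" | "w \<in> ?E" "u \<notin> ?E" "v \<notin> ?E"
    using dsum mem uvw by (cases "d u"; cases "d v"; cases "d w") auto
  then show ?thesis
  proof cases
    case 1
    define E0 where "E0 = ?E - ?T"
    have E0: "?E = insert u (insert v (insert w E0))" "finite E0" "u \<notin> E0" "v \<notin> E0" "w \<notin> E0"
      using 1 EV unfolding E0_def by auto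
    have sum8: "state_sum V g = (\<Sum>D\<in>Pow E0. 
       (let f = \<lambda>p q r. of_bool (obstructed V ?E (set_diag3 u v w g D p q r)) in
       f 0 0 0 + f 0 0 1 + f 0 1 0 + f 0 1 1 + f 1 0 0 + f 1 0 1 + f 1 1 0 + f 1 1 1))"
      if "even_verts V g = ?E" for g
    proof -
      let ?f = "\<lambda>D. of_bool (obstructed V ?E (with_diag g D)) :: bit"
      have "state_sum V g = (\<Sum>D\<in>Pow (insert u (insert v (insert w E0))). ?f D)"
        unfolding state_sum_def that using E0(1) by simp
      also have "\<dots> = (\<Sum>D\<in>Pow (insert v (insert w E0)). ?f D + ?f (insert u D))"
        by (rule sum_Pow_insert) (use E0 uvw in auto)
      also have "\<dots> = (\<Sum>D\<in>Pow (insert w E0). ?f D + ?f (insert u D) + (?f (insert v D) + ?f (insert u (insert v D))))"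
        by (rule sum_Pow_insert) (use E0 uvw in auto)
      also have "\<dots> = (\<Sum>D\<in>Pow E0. ?f D + ?f (insert u D) + (?f (insert v D) + ?f (insert u (insert v D)))
         + (?f (insert w D) + ?f (insert u (insert w D)) + (?f (insert v (insert w D)) + ?f (insert u (insert v (insert w D))))))"
        by (rule sum_Pow_insert) (use E0 uvw in auto)
      also have "\<dots> = (\<Sum>D\<in>Pow E0. 
       (let f = \<lambda>p q r. of_bool (obstructed V ?E (set_diag3 u v w g D p q r)) in
       f 0 0 0 + f 0 0 1 + f 0 1 0 + f 0 1 1 + f 1 0 0 + f 1 0 1 + f 1 1 0 + f 1 1 1))"
      proof (rule sum.cong[OF refl])
        fix D assume "D \<in> Pow E0"
        then have D: "u \<notin> D" "v \<notin> D" "w \<notin> D" using E0 by auto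
        have "with_diag g D = set_diag3 u v w g D 0 0 0" 
          "with_diag g (insert w D) = set_diag3 u v w g D 0 0 1"
          "with_diag g (insert v D) = set_diag3 u v w g D 0 1 0"
          "with_diag g (insert v (insert w D)) = set_diag3 u v w g D 0 1 1"
          "with_diag g (insert u D) = set_diag3 u v w g D 1 0 0"
          "with_diag g (insert u (insert w D)) = set_diag3 u v w g D 1 0 1"
          "with_diag g (insert u (insert v D)) = set_diag3 u v w g D 1 1 0"
          "with_diag g (insert u (insert v (insert w D))) = set_diag3 u v w g D 1 1 1"
          using D uvw by (auto simp: with_diag_def set_diag3_def fun_eq_iff)
        then show "?f D + ?f (insert u D) + (?f (insert v D) + ?f (insert u (insert v D)))
         + (?f (insert w D) + ?f (insert u (insert w D)) + (?f (insert v (insert w D)) + ?f (insert u (insert v (insert w D)))))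
         = (let f = \<lambda>p q r. of_bool (obstructed V ?E (set_diag3 u v w g D p q r)) in
       f 0 0 0 + f 0 0 1 + f 0 1 0 + f 0 1 1 + f 1 0 0 + f 1 0 1 + f 1 1 0 + f 1 1 1)"
          by (simp add: ac_simps Let_def)
      qed
      finally show ?thesis .
    qed
    show ?thesis unfolding sum8[OF E'] sum8[OF refl] Let_def using sum_states[OF EV(1) 1] by simp
  next
    case 2
    then show ?thesis unfolding state_sum_def E' using odd_pair_state[OF EV(1)] by simp
  next
    case 3
    then show ?thesis unfolding state_sum_def E'
      using triangle_flip.odd_pair_state[OF permute(1) EV(1)] by simp
  next
    case 4
    then show ?thesis unfolding state_sum_def E'
      using triangle_flip.odd_pair_state[OF permute(2) EV(1)] by simp
  qed
qed

end

section \<open>Graph-moves\<close>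

lemma is_invD: "is_inv V M B \<Longrightarrow> i \<in> V \<Longrightarrow> j \<in> V \<Longrightarrow> mulv V M (\<lambda>k. B k j) i = of_bool (i = j)"
  unfolding is_inv_def by blast

lemma nonsingD: "nonsing V M \<Longrightarrow> (\<And>i. i \<in> V \<Longrightarrow> mulv V M x i = 0) \<Longrightarrow> i \<in> V \<Longrightarrow> x i = 0"
  unfolding nonsing_def by blast

lemma nonsingI: "(\<And>x i. (\<And>i. i \<in> V \<Longrightarrow> mulv V M x i = 0) \<Longrightarrow> i \<in> V \<Longrightarrow> x i = 0) \<Longrightarrow> nonsing V M"
  unfolding nonsing_def by blast

text \<open>Inverses are carried forwards only. Backwards it is enough that an inverse exists, since
  the forward half then compares its state sum with the given one; no inverse has to be constructed
  in that direction.\<close>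

definition move_invariant :: "'a set \<Rightarrow> ('a \<Rightarrow> 'a \<Rightarrow> bit) \<Rightarrow> 'b set \<Rightarrow> ('b \<Rightarrow> 'b \<Rightarrow> bit) \<Rightarrow> bool" where
  "move_invariant V M W N \<longleftrightarrow> (nonsing W N \<longrightarrow> nonsing V M) \<and>
     (\<forall>B. is_inv V M B \<longrightarrow> (\<exists>B'. is_inv W N B' \<and> state_sum W B' = state_sum V B))"

lemma move_invariant_trans:
  "move_invariant V M W N \<Longrightarrow> move_invariant W N X P \<Longrightarrow> move_invariant V M X P"
  unfolding move_invariant_def by metis

lemma move_invariant_iso:
  assumes f: "bij_betw f V W" and V: "finite V"
    and N: "\<And>i j. i \<in> V \<Longrightarrow> j \<in> V \<Longrightarrow> N (f i) (f j) = M i j"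
  shows "move_invariant V M W N"
proof -
  define g where "g = inv_into V f"
  have g: "g (f i) = i" if "i \<in> V" for i using f that unfolding g_def bij_betw_def by simp
  have fg: "g i \<in> V" "f (g i) = i" if "i \<in> W" for i
    using f that unfolding g_def by (simp_all add: bij_betw_def inv_into_into f_inv_into_f)
  have fW: "f i \<in> W" if "i \<in> V" for i using f that by (auto simp: bij_betw_def)
  have m: "mulv W N x (f i) = mulv V M (x \<circ> f) i" if "i \<in> V" for x i
    unfolding mulv_def sum.reindex_bij_betw[OF f, symmetric] by (rule sum.cong) (use N that in auto)
  have m': "mulv W N x i = mulv V M (x \<circ> f) (g i)" if "i \<in> W" for x i
    using m[OF fg(1)[OF that], of x] fg(2)[OF that] by simp
  have "nonsing V M" if "nonsing W N"
  proof (rule nonsingI)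
    fix x i assume x: "\<And>i. i \<in> V \<Longrightarrow> mulv V M x i = 0" and i: "i \<in> V"
    have "mulv W N (x \<circ> g) i = 0" if "i \<in> W" for i
    proof -
      have "mulv V M ((x \<circ> g) \<circ> f) (g i) = mulv V M x (g i)" by (rule mulv_cong) (use g in auto)
      then show ?thesis using m'[OF that, of "x \<circ> g"] x fg(1)[OF that] by simp
    qed
    then have "(x \<circ> g) (f i) = 0" by (rule nonsingD[OF that _ fW[OF i]])
    then show "x i = 0" using g i by simp
  qed
  moreover have "is_inv W N (\<lambda>i j. B (g i) (g j))" if B: "is_inv V M B" for B
    unfolding is_inv_def
  proof (intro ballI)
    fix i j assume ij: "i \<in> W" "j \<in> W"
    have "mulv W N (\<lambda>k. B (g k) (g j)) i = mulv V M ((\<lambda>k. B (g k) (g j)) \<circ> f) (g i)"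
      by (rule m'[OF ij(1)])
    also have "\<dots> = mulv V M (\<lambda>k. B k (g j)) (g i)" by (rule mulv_cong) (use g in auto)
    also have "\<dots> = of_bool (g i = g j)" by (rule is_invD[OF B fg(1)[OF ij(1)] fg(1)[OF ij(2)]])
    also have "(g i = g j) = (i = j)" using fg(2) ij by metis
    finally show "mulv W N (\<lambda>k. B (g k) (g j)) i = of_bool (i = j)" .
  qed
  moreover have "state_sum W (\<lambda>i j. B (g i) (g j)) = state_sum V B" for B :: "'a \<Rightarrow> 'a \<Rightarrow> bit"
    by (rule state_sum_iso[OF f V]) (use g in auto)
  ultimately show ?thesis unfolding move_invariant_def by blast
qed

lemma move_invariant_isolated:
  assumes V: "finite V" "v \<in> V" and s: "symm V M" and M: "M v v = 1" "\<And>t. t \<in> V \<Longrightarrow> t \<noteq> v \<Longrightarrow> M v t = 0"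
  shows "move_invariant V M (V - {v}) M"
proof -
  let ?W = "V - {v}"
  have M': "M t v = 0" if "t \<in> ?W" for t using M(2)[of t] symmD[OF s, of t v] V that by auto
  have mv: "mulv V M x v = x v" for x
  proof -
    have "mulv ?W M x v = 0" unfolding mulv_def by (rule sum.neutral) (use M in auto)
    then show ?thesis using mulv_remove[OF V, of M x v] M(1) by simp
  qed
  have mW: "mulv V M x i = mulv ?W M x i" if "i \<in> ?W" for x i
    using mulv_remove[OF V, of M x i] M'[OF that] by simp
  have "nonsing V M" if n: "nonsing ?W M"
  proof (rule nonsingI)
    fix x i assume x: "\<And>i. i \<in> V \<Longrightarrow> mulv V M x i = 0" and i: "i \<in> V"
    show "x i = 0"
    proof (cases "i = v")
      case True then show ?thesis using x[OF V(2)] mv by simp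
    next
      case False
      have "mulv ?W M x i = 0" if "i \<in> ?W" for i using x[of i] mW[OF that] that by simp
      then show ?thesis by (rule nonsingD[OF n]) (use False i in auto)
    qed
  qed
  moreover have "is_inv ?W M B" if B: "is_inv V M B" for B
    unfolding is_inv_def
  proof (intro ballI)
    fix i j assume "i \<in> ?W" "j \<in> ?W"
    then show "mulv ?W M (\<lambda>k. B k j) i = of_bool (i = j)"
      using is_invD[OF B, of i j] mW[of i "\<lambda>k. B k j"] by auto
  qed
  moreover have "state_sum ?W B = state_sum V B" if B: "is_inv V M B" for B
  proof (rule state_sum_isolated[symmetric, OF V is_inv_symm[OF V(1) s B]])
    fix t assume "t \<in> V" "t \<noteq> v"
    then show "B v t = 0" using is_invD[OF B V(2), of t] mv by auto
  qed
  ultimately show ?thesis unfolding move_invariant_def by blast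
qed

text \<open>Rows \<open>u\<close> and \<open>v\<close> of \<open>M\<close> add up to the sum of the
  two unit vectors. Applied to a column \<open>t\<close> of the inverse with \<open>t\<close>
  elsewhere, this gives \<open>B u t = B v t\<close>: the twins reappear in \<open>B\<close>. As
  columns \<open>u\<close> and \<open>v\<close> of \<open>M\<close> agree in the other rows, their
  contributions cancel and the restriction of \<open>B\<close> inverts the restriction of
  \<open>M\<close>.\<close>

lemma move_invariant_twins:
  assumes V: "finite V" "u \<in> V" "v \<in> V" "u \<noteq> v" and s: "symm V M"
    and M: "M u u = M u v + 1" "M v v = M u v + 1" "\<And>t. t \<in> V \<Longrightarrow> t \<noteq> u \<Longrightarrow> t \<noteq> v \<Longrightarrow> M u t = M v t"
  shows "move_invariant V M (V - {u, v}) M"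
proof -
  let ?W = "V - {u, v}"
  have vu: "M v u = M u v" using symmD[OF s] V by auto
  have M': "M t u = M t v" if "t \<in> ?W" for t 
    using M(3)[of t] symmD[OF s, of t v] symmD[OF s, of t u] V that by auto
  have split: "mulv V M x i = M i u * x u + M i v * x v + mulv ?W M x i" for x i
  proof -
    have "mulv V M x i = M i u * x u + mulv (V - {u}) M x i"
      using V by (intro mulv_remove) auto
    also have "mulv (V - {u}) M x i = M i v * x v + mulv (V - {u} - {v}) M x i"
      using V by (intro mulv_remove) auto
    also have "V - {u} - {v} = ?W" by auto
    finally show ?thesis by (simp add: add.assoc)
  qed
  have uv: "mulv V M x u + mulv V M x v = x u + x v" for x
  proof -
    have "mulv ?W M x u = mulv ?W M x v" by (rule mulv_def[THEN trans, OF sum.cong, THEN trans, OF _ _ mulv_def[symmetric]]) (use M in auto)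
    then show ?thesis unfolding split vu M by (simp add: algebra_simps)
  qed
  have mW: "mulv V M x i = mulv ?W M x i" if "i \<in> ?W" "x u = x v" for x i
    unfolding split using M'[OF that(1)] that(2) by simp
  have "nonsing V M" if n: "nonsing ?W M"
  proof (rule nonsingI)
    fix x i assume x: "\<And>i. i \<in> V \<Longrightarrow> mulv V M x i = 0" and i: "i \<in> V"
    have xu: "x u = x v" using uv[of x] x V by (simp add: bit_add_eq_0)
    have "mulv ?W M x i = 0" if "i \<in> ?W" for i using x[of i] mW[OF that xu] that by simp
    then have xW: "x i = 0" if "i \<in> ?W" for i using nonsingD[OF n _ that] by blast
    then have "mulv ?W M x u = 0" unfolding mulv_def by (intro sum.neutral) auto
    then have "x u = 0" using x[OF V(2)] xu unfolding split M by (simp add: algebra_simps)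
    then show "x i = 0" using xW[of i] xu i by auto
  qed
  moreover have eq: "B u t = B v t" if "is_inv V M B" "t \<in> ?W" for B t
    using uv[of "\<lambda>k. B k t"] is_invD[OF that(1) V(2), of t] is_invD[OF that(1) V(3), of t] that(2)
    by (auto simp: bit_add_eq_0)
  moreover have "is_inv ?W M B" if B: "is_inv V M B" for B
    unfolding is_inv_def
  proof (intro ballI)
    fix i j assume "i \<in> ?W" "j \<in> ?W"
    then show "mulv ?W M (\<lambda>k. B k j) i = of_bool (i = j)"
      using is_invD[OF B, of i j] mW[of i "\<lambda>k. B k j"] eq[OF B] by auto
  qed
  moreover have "state_sum ?W B = state_sum V B" if B: "is_inv V M B" for B
    by (rule state_sum_twins[symmetric, OF V is_inv_symm[OF V(1) s B]]) (use eq[OF B] in auto)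
  ultimately show ?thesis unfolding move_invariant_def by blast
qed

lemma state_sum_diag: "finite V \<Longrightarrow> (\<And>i j. i \<in> V \<Longrightarrow> j \<in> V \<Longrightarrow> i \<noteq> j \<Longrightarrow> h' i j = h i j) \<Longrightarrow> state_sum V h' = state_sum V h"
  by (rule state_sum_iso[where f = id]) auto

lemma mulv_scaled_unit:
  assumes "finite V" "j \<in> V"
  shows "mulv V N (\<lambda>k. of_bool (k = j) * c) i = N i j * c"
proof -
  have "mulv V N (\<lambda>k. of_bool (k = j) * c) i = (\<Sum>k\<in>V. of_bool (k = j) * (N i k * c))"
    unfolding mulv_def by (intro sum.cong) (auto simp: ac_simps)
  then show ?thesis using assms by (simp add: sum_unit)
qed

text \<open>Since \<open>M v v = 0\<close>, the rank-one update of \<open>M\<close> adds to the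
  inverse only the matrix unit at \<open>v, v\<close>, and the state sum ignores the
  diagonal.\<close>

lemma move_invariant_local_complement:
  assumes V: "finite V" "v \<in> V" and M: "M v v = 0"
    and N: "\<And>i j. i \<in> V \<Longrightarrow> j \<in> V \<Longrightarrow> N i j = M i j + M i v * M v j"
  shows "move_invariant V M V N"
proof -
  have m: "mulv V N x i = mulv V M x i + M i v * mulv V M x v" if "i \<in> V" for x i
  proof -
    have "mulv V N x i = mulv V (\<lambda>i j. M i j + M i v * M v j) x i"
      by (rule mulv_cong) (use N that in auto)
    then show ?thesis unfolding mulv_mat_add mulv_outer by (simp add: mulv_def)
  qed
  have "nonsing V M" if n: "nonsing V N"
  proof (rule nonsingI)
    fix x i assume x: "\<And>i. i \<in> V \<Longrightarrow> mulv V M x i = 0" and i: "i \<in> V"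
    show "x i = 0" by (rule nonsingD[OF n _ i]) (use m x V in simp)
  qed
  moreover have "is_inv V N (\<lambda>i j. B i j + of_bool (i = v) * of_bool (j = v))" if B: "is_inv V M B" for B
    unfolding is_inv_def
  proof (intro ballI)
    fix i j assume ij: "i \<in> V" "j \<in> V"
    show "mulv V N (\<lambda>k. B k j + of_bool (k = v) * of_bool (j = v)) i = of_bool (i = j)"
      unfolding m[OF ij(1)] mulv_add mulv_scaled_unit[OF V] is_invD[OF B ij] is_invD[OF B V(2) ij(2)]
      using M N[OF ij(1) V(2)] by (cases "j = v") auto
  qed
  moreover have "state_sum V (\<lambda>i j. B i j + of_bool (i = v) * of_bool (j = v)) = state_sum V B" 
    for B :: "'a \<Rightarrow> 'a \<Rightarrow> bit"
    by (rule state_sum_diag) (use V in auto)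
  ultimately show ?thesis unfolding move_invariant_def by blast
qed

text \<open>Since the block of \<open>u\<close> and \<open>v\<close> consists of ones, the rank-two
  update of \<open>M\<close> adds to the inverse only the matrix units at \<open>u, u\<close> and
  \<open>v, v\<close>.\<close>

lemma move_invariant_pivot:
  assumes V: "finite V" "u \<in> V" "v \<in> V" "u \<noteq> v" and M: "M u u = 1" "M v v = 1" "M u v = 1" "M v u = 1"
    and N: "\<And>i j. i \<in> V \<Longrightarrow> j \<in> V \<Longrightarrow> N i j = M i j + M i u * M v j + M i v * M u j"
  shows "move_invariant V M V N"
proof -
  have m: "mulv V N x i = mulv V M x i + M i u * mulv V M x v + M i v * mulv V M x u" if "i \<in> V" for x i
  proof -
    have "mulv V N x i = mulv V (\<lambda>i j. M i j + M i u * M v j + M i v * M u j) x i"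
      by (rule mulv_cong) (use N that in auto)
    then show ?thesis unfolding mulv_mat_add mulv_outer by (simp add: mulv_def)
  qed
  have "nonsing V M" if n: "nonsing V N"
  proof (rule nonsingI)
    fix x i assume x: "\<And>i. i \<in> V \<Longrightarrow> mulv V M x i = 0" and i: "i \<in> V"
    show "x i = 0" by (rule nonsingD[OF n _ i]) (use m x V in simp)
  qed
  moreover have "is_inv V N (\<lambda>i j. B i j + of_bool (i = j) * of_bool (j = u \<or> j = v))" if B: "is_inv V M B" for B
    unfolding is_inv_def
  proof (intro ballI)
    fix i j assume ij: "i \<in> V" "j \<in> V"
    show "mulv V N (\<lambda>k. B k j + of_bool (k = j) * of_bool (j = u \<or> j = v)) i = of_bool (i = j)"
      unfolding m[OF ij(1)] mulv_add mulv_scaled_unit[OF V(1) ij(2)] is_invD[OF B ij] 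
        is_invD[OF B V(2) ij(2)] is_invD[OF B V(3) ij(2)]
      using M V(4) N[OF ij(1) V(2)] N[OF ij(1) V(3)]
      by (cases "j = u"; cases "j = v") (auto simp: algebra_simps)
  qed
  moreover have "state_sum V (\<lambda>i j. B i j + of_bool (i = j) * of_bool (j = u \<or> j = v)) = state_sum V B" 
    for B :: "'a \<Rightarrow> 'a \<Rightarrow> bit"
    by (rule state_sum_diag) (use V in auto)
  ultimately show ?thesis unfolding move_invariant_def by blast
qed

text \<open>Here \<open>N = P M P\<^sup>T\<close> for the involution \<open>P = 1 + e\<^sub>u (e\<^sub>v + e\<^sub>w)\<^sup>T\<close>; after \<open>v\<close> and
  \<open>w\<close> are swapped, its inverse is that of \<open>M\<close> with the triangle \<open>u, v, w\<close> complemented.\<close>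

lemma move_invariant_triangle:
  assumes V: "finite V" and uvw: "u \<in> V" "v \<in> V" "w \<in> V" "u \<noteq> v" "u \<noteq> w" "v \<noteq> w" and s: "symm V M"
    and M: "M v v = 1" "M w w = 1" "M v w = 0"
      "\<And>t. t \<in> V \<Longrightarrow> M u t = of_bool (t = u \<or> t = v \<or> t = w)"
    and N: "\<And>i j. i \<in> V \<Longrightarrow> j \<in> V \<Longrightarrow>
      N i j = M i j + of_bool (i = u) * (M v j + M w j) + of_bool (j = u) * (M v i + M w i)"
  shows "move_invariant V M V N"
proof -
  define q :: "'a \<Rightarrow> bit" where "q k = of_bool (k = v \<or> k = w)" for k
  define s' where "s' i = M i v + M i w" for i
  have wv: "M w v = 0" using symmD[OF s] M(3) uvw by auto
  have s'u: "s' u = 0" "s' v = 1" "s' w = 1" unfolding s'_def using M wv uvw by auto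
  have mq: "mulv V M (\<lambda>k. q k * c) i = s' i * c" for c i
  proof -
    have "mulv V M (\<lambda>k. q k * c) i = mulv V M q i * c" 
      unfolding mulv_def by (simp add: sum_distrib_right mult.assoc)
    then show ?thesis unfolding q_def s'_def using uvw V by (simp add: mulv_pair)
  qed
  have m: "mulv V N x i = mulv V M x i + of_bool (i = u) * (mulv V M x v + mulv V M x w) + s' i * x u" 
    if "i \<in> V" for x i
  proof -
    have "mulv V N x i = mulv V (\<lambda>i j. M i j + of_bool (i = u) * (M v j + M w j) + s' i * of_bool (j = u)) x i"
      by (rule mulv_cong) (use N that symmD[OF s] uvw in \<open>auto simp: s'_def mult.commute\<close>)
    also have "\<dots> = mulv V M x i + of_bool (i = u) * (\<Sum>k\<in>V. (M v k + M w k) * x k) + s' i * (\<Sum>k\<in>V. of_bool (k = u) * x k)"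
      unfolding mulv_mat_add mulv_outer ..
    also have "(\<Sum>k\<in>V. (M v k + M w k) * x k) = mulv V M x v + mulv V M x w"
      unfolding mulv_def by (simp add: distrib_right sum.distrib)
    also have "(\<Sum>k\<in>V. of_bool (k = u) * x k) = x u" using V uvw by (simp add: sum_unit)
    finally show ?thesis .
  qed
  have mu: "mulv V M x u = x u + x v + x w" for x
  proof -
    have "mulv V M x u = mulv V (\<lambda>_. x) (\<lambda>k. of_bool (k = u \<or> k = v \<or> k = w)) u"
      unfolding mulv_def by (rule sum.cong) (use M in auto)
    then show ?thesis using V uvw by (simp add: mulv_triple)
  qed
  have "nonsing V M" if n: "nonsing V N"
  proof (rule nonsingI)
    fix x i assume x: "\<And>i. i \<in> V \<Longrightarrow> mulv V M x i = 0" and i: "i \<in> V"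
    \<comment> \<open>The transpose of \<open>P\<close> applied to \<open>x\<close>; as
      \<open>P\<close> is an involution, \<open>N\<close> maps it to \<open>P M x\<close>.\<close>
    let ?y = "\<lambda>k. x k + q k * x u"
    have "mulv V N ?y i = 0" if "i \<in> V" for i
      unfolding m[OF that] mulv_add mq using x[OF that] x[OF uvw(2)] x[OF uvw(3)] s'u uvw 
      by (simp add: q_def)
    then have y: "?y i = 0" if "i \<in> V" for i using nonsingD[OF n _ that, of ?y] by blast
    have "x u = 0" using y[OF uvw(1)] uvw by (simp add: q_def)
    then show "x i = 0" using y[OF i] by simp
  qed
  moreover have "\<exists>B'. is_inv V N B' \<and> state_sum V B' = state_sum V B" if B: "is_inv V M B" for B
  proof (intro exI conjI)
    \<comment> \<open>The inverse of \<open>N\<close>, namely \<open>B\<close> conjugated by the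
      same involution: multiplied by the transpose of \<open>P\<close> on the left and by
      \<open>P\<close> on the right, then expanded.\<close>
    let ?B' = "\<lambda>i j. B i j + q i * B u j + (B i u * q j + q i * (B u u * q j))"
    note Bs = symmD[OF is_inv_symm[OF V s B]]
    have mB: "mulv V M (\<lambda>k. B k j * c) i = of_bool (i = j) * c" if "i \<in> V" "j \<in> V" for i j c
    proof -
      have "mulv V M (\<lambda>k. B k j * c) i = mulv V M (\<lambda>k. B k j) i * c" 
        unfolding mulv_def by (simp add: sum_distrib_right mult.assoc)
      then show ?thesis using is_invD[OF B that] by simp
    qed
    show "is_inv V N ?B'"
      unfolding is_inv_def
    proof (intro ballI)
      fix i j assume ij: "i \<in> V" "j \<in> V"
      have mm: "mulv V M (\<lambda>k. ?B' k j) i = of_bool (i = j) + s' i * B u j + (of_bool (i = u) * q j + s' i * (B u u * q j))" 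
        if "i \<in> V" for i
        unfolding mulv_add mq mB[OF that uvw(1)] is_invD[OF B that ij(2)] ..
      have qj: "of_bool (v = j) + of_bool (w = j) = q j" using uvw by (auto simp: q_def)
      show "mulv V N (\<lambda>k. ?B' k j) i = of_bool (i = j)"
        unfolding m[OF ij(1)] mm[OF ij(1)] mm[OF uvw(2)] mm[OF uvw(3)] s'u using uvw qj[symmetric]
        by (simp add: algebra_simps q_def)
    qed
    define \<pi> where "\<pi> k = (if k = v then w else if k = w then v else k)" for k
    have "state_sum V ?B' = state_sum V (\<lambda>i j. ?B' (\<pi> i) (\<pi> j))"
      by (rule state_sum_iso[OF _ V, where f = \<pi>]) 
        (use uvw in \<open>auto simp: \<pi>_def intro!: bij_betw_byWitness[where f' = \<pi>]\<close>)
    also have "\<dots> = state_sum V B"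
    proof (rule triangle_flip.state_sum_flip[where u = u and v = v and w = w])
      \<comment> \<open>Row \<open>u\<close> of \<open>M\<close> is the indicator of
        \<open>u, v, w\<close>, so row \<open>u\<close> of \<open>M B = 1\<close> is precisely the
        cancellation of the three columns that \<open>triangle_flip\<close> requires.\<close>
      have R: "B u t + B v t + B w t = of_bool (u = t)" if "t \<in> V" for t
        using is_invD[OF B uvw(1) that] unfolding mu .
      have R': "B t u + B t v + B t w = of_bool (u = t)" if "t \<in> V" for t
        using R[OF that] Bs[of t] uvw that by simp
      show "triangle_flip V B (\<lambda>i j. ?B' (\<pi> i) (\<pi> j)) u v w"
      proof unfold_locales
        show "symm V B" by (rule is_inv_symm[OF V s B])
        show "B t u + B t v + B t w = 0" if "t \<in> V" "t \<notin> {u, v, w}" for t using R'[OF that(1)] that by auto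
        fix i j assume ij: "i \<in> V" "j \<in> V" "i \<noteq> j"
        have sy: "B v u = B u v" "B w u = B u w" "B w v = B v w" "B v i = B i v" "B w i = B i w" "B u i = B i u"
          "B v j = B j v" "B w j = B j w" "B u j = B j u"
          using Bs uvw ij by auto
        have Ru: "B u u = B u v + B u w + 1"
          using R[OF uvw(1)] sy by (simp add: bit_add_move add.assoc)
        have Ri: "B i u = B i v + B i w" if "i \<notin> {u, v, w}"
          using R'[OF ij(1)] that by (auto simp: bit_add_move add.assoc)
        have Rj: "B j u = B j v + B j w" if "j \<notin> {u, v, w}"
          using R'[OF ij(2)] that by (auto simp: bit_add_move add.assoc)
        show "?B' (\<pi> i) (\<pi> j) = B i j + of_bool (i \<in> {u, v, w} \<and> j \<in> {u, v, w})"
        proof (cases "i \<in> {u, v, w}"; cases "j \<in> {u, v, w}")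
          assume "i \<in> {u, v, w}" "j \<in> {u, v, w}"
          then show ?thesis using ij(3) uvw Ru sy(1-3) by (auto simp: \<pi>_def q_def algebra_simps)
        next
          assume "i \<in> {u, v, w}" and j: "j \<notin> {u, v, w}"
          then show ?thesis using uvw sy(7-9) Rj[OF j] by (auto simp: \<pi>_def q_def algebra_simps)
        next
          assume i: "i \<notin> {u, v, w}" and "j \<in> {u, v, w}"
          then show ?thesis using uvw sy(4-6) Ri[OF i] by (auto simp: \<pi>_def q_def algebra_simps)
        next
          assume "i \<notin> {u, v, w}" "j \<notin> {u, v, w}"
          then show ?thesis by (auto simp: \<pi>_def q_def)
        qed
      qed (use V uvw in auto)
    qed
    finally show "state_sum V ?B' = state_sum V B" .
  qed
  ultimately show ?thesis unfolding move_invariant_def by blast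
qed

text \<open>The matrix \<open>A(G) + E\<close>.\<close>

definition state_matrix :: "'v lgraph \<Rightarrow> 'v \<Rightarrow> 'v \<Rightarrow> bit" where
  "state_matrix G i j = (if i = j then framing G i + 1 else of_bool (adj G i j))"

section \<open>The moves on labeled graphs as matrix operations\<close>

lemma labeled_graphD:
  assumes "labeled_graph G"
  shows "finite (verts G)" "adj G x y \<Longrightarrow> x \<in> verts G \<and> y \<in> verts G" "adj G x y = adj G y x" "\<not> adj G x x"
  using assms unfolding labeled_graph_def by blast+

lemma symm_state_matrix:
  assumes "labeled_graph G"
  shows "symm V (state_matrix G)"
  unfolding symm_def
proof (intro ballI)
  fix i j show "state_matrix G i j = state_matrix G j i"
    using labeled_graphD(3)[OF assms, of i j] by (simp add: state_matrix_def)
qed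

lemma of_bool_xor: "(of_bool (a \<noteq> b) :: bit) = of_bool a + of_bool b"
  by auto

lemma move_invariant_same:
  "(\<And>i j. i \<in> V \<Longrightarrow> j \<in> V \<Longrightarrow> M i j = N i j) \<Longrightarrow> move_invariant W P V M \<Longrightarrow> move_invariant W P V N"
proof -
  assume e: "\<And>i j. i \<in> V \<Longrightarrow> j \<in> V \<Longrightarrow> M i j = N i j" and m: "move_invariant W P V M"
  have mv: "mulv V M x i = mulv V N x i" if "i \<in> V" for x i by (rule mulv_cong) (use e that in auto)
  have "nonsing V M = nonsing V N" unfolding nonsing_def using mv by auto
  moreover have "is_inv V M = is_inv V N" unfolding is_inv_def using mv by auto
  ultimately show ?thesis using m unfolding move_invariant_def by simp
qed

lemma lgraph_iso_invariant:
  assumes "labeled_graph G" "lgraph_iso G H"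
  shows "move_invariant (verts G) (state_matrix G) (verts H) (state_matrix H)"
proof -
  obtain f where f: "bij_betw f (verts G) (verts H)"
    "\<And>x y. x \<in> verts G \<Longrightarrow> y \<in> verts G \<Longrightarrow> adj H (f x) (f y) = adj G x y"
    "\<And>x. x \<in> verts G \<Longrightarrow> framing H (f x) = framing G x"
    using assms(2) unfolding lgraph_iso_def by blast
  show ?thesis
  proof (rule move_invariant_iso[OF f(1) labeled_graphD(1)[OF assms(1)]])
    fix i j assume ij: "i \<in> verts G" "j \<in> verts G"
    have "f i = f j \<longleftrightarrow> i = j" using f(1) ij by (auto simp: bij_betw_def inj_on_def)
    then show "state_matrix H (f i) (f j) = state_matrix G i j"
      unfolding state_matrix_def using f ij by auto
  qed
qed

lemma Omega_g1_invariant: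
  assumes G: "labeled_graph G" and "Omega_g1 G H"
  shows "move_invariant (verts G) (state_matrix G) (verts H) (state_matrix H)"
proof -
  obtain v where v: "v \<in> verts G" "nbhd G v = {}" "framing G v = 0" "H = del_verts G {v}"
    using assms(2) unfolding Omega_g1_def by blast
  have "move_invariant (verts G) (state_matrix G) (verts G - {v}) (state_matrix G)"
    by (rule move_invariant_isolated[OF labeled_graphD(1)[OF G] v(1) symm_state_matrix[OF G]])
      (use v in \<open>auto simp: state_matrix_def nbhd_def\<close>)
  then have "move_invariant (verts G) (state_matrix G) (verts H) (state_matrix G)"
    unfolding v(4) del_verts_def by simp
  then show ?thesis
    by (rule move_invariant_same[rotated]) (auto simp: state_matrix_def del_verts_def v(4))
qed

lemma Omega_g2_invariant:
  assumes G: "labeled_graph G" and "Omega_g2 G H"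
  shows "move_invariant (verts G) (state_matrix G) (verts H) (state_matrix H)"
proof -
  obtain u v where uv: "u \<in> verts G" "v \<in> verts G" "u \<noteq> v"
    "\<not> adj G u v \<and> framing G u = 0 \<and> framing G v = 0 \<or> adj G u v \<and> framing G u = 1 \<and> framing G v = 1"
    "\<forall>t\<in>verts G - {u, v}. adj G u t = adj G v t" "H = del_verts G {u, v}"
    using assms(2) unfolding Omega_g2_def by blast
  have "move_invariant (verts G) (state_matrix G) (verts G - {u, v}) (state_matrix G)"
    by (rule move_invariant_twins[OF labeled_graphD(1)[OF G] uv(1-3) symm_state_matrix[OF G]])
      (use uv in \<open>auto simp: state_matrix_def\<close>)
  then have "move_invariant (verts G) (state_matrix G) (verts H) (state_matrix G)"
    unfolding uv(6) del_verts_def by simp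
  then show ?thesis
    by (rule move_invariant_same[rotated]) (auto simp: state_matrix_def del_verts_def uv(6))
qed

lemma Omega_g3_invariant:
  assumes G: "labeled_graph G" and "Omega_g3 G H"
  shows "move_invariant (verts G) (state_matrix G) (verts H) (state_matrix H)"
proof -
  obtain u v w where uvw: "u \<in> verts G" "v \<in> verts G" "w \<in> verts G" "u \<noteq> v" "u \<noteq> w" "v \<noteq> w"
    and fr: "\<forall>x\<in>{u, v, w}. framing G x = 0" and nb: "nbhd G u = {v, w}" "\<not> adj G v w"
    and H: "H = (toggle G (\<lambda>x t. x = u \<and>
               t \<in> {v, w} \<union> (((nbhd G v - nbhd G w) \<union> (nbhd G w - nbhd G v)) - {u})))
            \<lparr>vsign := (vsign G)(v := Plus, w := Plus)\<rparr>"
    using assms(2) unfolding Omega_g3_def by blast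
  note sy = labeled_graphD(3)[OF G]
  have adju: "adj G u t \<longleftrightarrow> t = v \<or> t = w" for t using nb(1) unfolding nbhd_def by blast
  have adjs: "adj G v u" "adj G w u" "\<not> adj G w v" "adj G u v" "adj G u w"
    using adju nb(2) sy by blast+
  note irr = labeled_graphD(4)[OF G]
  \<comment> \<open>The support of the sum of rows \<open>v\<close> and \<open>w\<close>: they enter
    it themselves through their diagonal entries 1, and \<open>u\<close> drops out because it is
    adjacent to both.\<close>
  define T where "T t \<longleftrightarrow> t = v \<or> t = w \<or> (t \<noteq> u \<and> adj G v t \<noteq> adj G w t)" for t
  have adjH: "adj H x y \<longleftrightarrow> adj G x y \<noteq> (x = u \<and> T y \<or> y = u \<and> T x)" for x y
    unfolding H toggle_def T_def nbhd_def by auto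
  have frH: "framing H = framing G" and vH: "verts H = verts G" unfolding H toggle_def by simp_all
  have s: "state_matrix G v t + state_matrix G w t = of_bool (T t)" for t
    using fr nb(2) adjs irr uvw unfolding state_matrix_def T_def
    by (cases "t = u"; cases "t = v"; cases "t = w") (auto)
  show ?thesis
    unfolding vH
  proof (rule move_invariant_triangle[OF labeled_graphD(1)[OF G] uvw symm_state_matrix[OF G]])
    show "state_matrix H i j = state_matrix G i j + of_bool (i = u) * (state_matrix G v j + state_matrix G w j) +
      of_bool (j = u) * (state_matrix G v i + state_matrix G w i)" for i j
      unfolding s using uvw by (auto simp: state_matrix_def adjH frH T_def)
  qed (use fr nb adju uvw in \<open>auto simp: state_matrix_def\<close>)
qed

lemma Omega_g4_invariant:
  assumes G: "labeled_graph G" and "Omega_g4 G H"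
  shows "move_invariant (verts G) (state_matrix G) (verts H) (state_matrix H)"
proof -
  obtain u v where uv: "u \<in> verts G" "v \<in> verts G" "adj G u v" "framing G u = 0" "framing G v = 0"
    and H: "H = (piv G u v)\<lparr>vsign := (vsign G)(u := opp (vsign G v), v := opp (vsign G u))\<rparr>"
    using assms(2) unfolding Omega_g4_def by blast
  note sy = labeled_graphD(3)[OF G] and irr = labeled_graphD(4)[OF G]
  have ne: "u \<noteq> v" using uv irr by auto
  have vu: "adj G v u" using uv sy by blast
  have frH: "framing H = framing G" and vH: "verts H = verts G" unfolding H piv_def toggle_def by simp_all
  \<comment> \<open>The exclusion clause in \<open>piv\<close>, symmetrised by
    \<open>toggle\<close>, turns the two product conditions into an exclusive or, that is, into a
    sum of two products over the field.\<close>
  have adjH: "adj H x y \<longleftrightarrow> adj G x y \<noteq> (x \<notin> {u, v} \<and> y \<notin> {u, v} \<and> 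
      ((adj G x u \<and> adj G v y) \<noteq> (adj G x v \<and> adj G u y)))" for x y
    unfolding H piv_def toggle_def nbhd_def using sy[of u] sy[of v] by auto
  define M1 where "M1 i j = state_matrix G i j + state_matrix G i u * state_matrix G v j + state_matrix G i v * state_matrix G u j" for i j
  \<comment> \<open>The matrix pivot \<open>M1\<close> exchanges the neighbourhoods of
    \<open>u\<close> and \<open>v\<close>, whereas \<open>piv\<close> keeps them; the transposition
    makes up for this.\<close>
  define \<sigma> where "\<sigma> k = (if k = u then v else if k = v then u else k)" for k
  have 1: "move_invariant (verts G) (state_matrix G) (verts G) M1"
    by (rule move_invariant_pivot[OF labeled_graphD(1)[OF G] uv(1,2) ne])
      (use uv vu ne in \<open>auto simp: state_matrix_def M1_def\<close>)
  have 2: "move_invariant (verts G) M1 (verts G) (state_matrix H)"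
  proof (rule move_invariant_iso[where f = \<sigma>])
    show "bij_betw \<sigma> (verts G) (verts G)"
      by (rule bij_betw_byWitness[where f' = \<sigma>]) (use uv in \<open>auto simp: \<sigma>_def\<close>)
    fix i j
    have s: "adj G i u = adj G u i" "adj G i v = adj G v i" "adj G j u = adj G u j" "adj G j v = adj G v j"
      using sy by auto
    have a: "state_matrix G u u = 1" "state_matrix G v v = 1" "state_matrix G u v = 1" "state_matrix G v u = 1"
      using uv vu ne by (auto simp: state_matrix_def)
    have b: "state_matrix G t u = state_matrix G u t" "state_matrix G t v = state_matrix G v t" for t
      using symmD[OF symm_state_matrix[OF G, of UNIV]] by auto
    show "state_matrix H (\<sigma> i) (\<sigma> j) = M1 i j"
    proof (cases "i \<in> {u, v}"; cases "j \<in> {u, v}")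
      assume "i \<in> {u, v}" "j \<in> {u, v}"
      then show ?thesis unfolding M1_def using a ne uv vu
        by (auto simp: \<sigma>_def state_matrix_def adjH frH)
    next
      assume i: "i \<in> {u, v}" and j: "j \<notin> {u, v}"
      then have "M1 i j = state_matrix G (\<sigma> i) j" unfolding M1_def using a
        by (auto simp: \<sigma>_def algebra_simps)
      also have "\<dots> = state_matrix H (\<sigma> i) (\<sigma> j)" using i j
        by (auto simp: \<sigma>_def state_matrix_def adjH frH)
      finally show ?thesis ..
    next
      assume i: "i \<notin> {u, v}" and j: "j \<in> {u, v}"
      then have "M1 i j = state_matrix G i (\<sigma> j)" unfolding M1_def using a
        by (auto simp: \<sigma>_def algebra_simps)
      also have "\<dots> = state_matrix H (\<sigma> i) (\<sigma> j)" using i j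
        by (auto simp: \<sigma>_def state_matrix_def adjH frH)
      finally show ?thesis ..
    next
      assume i: "i \<notin> {u, v}" and j: "j \<notin> {u, v}"
      then have \<sigma>: "\<sigma> i = i" "\<sigma> j = j" by (auto simp: \<sigma>_def)
      show ?thesis
      proof (cases "i = j")
        case True
        then show ?thesis unfolding \<sigma> M1_def b by (simp add: state_matrix_def frH mult.commute)
      next
        case False
        have "adj H i j \<longleftrightarrow> adj G i j \<noteq> ((adj G i u \<and> adj G v j) \<noteq> (adj G i v \<and> adj G u j))"
          using i j by (simp add: adjH)
        then have "of_bool (adj H i j) = of_bool (adj G i j) +
            (of_bool (adj G i u) * of_bool (adj G v j) + of_bool (adj G i v) * of_bool (adj G u j) :: bit)"
          by (simp only: of_bool_xor of_bool_conj)
        moreover have "u \<noteq> j" "v \<noteq> j" "i \<noteq> u" "i \<noteq> v" using i j by auto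
        ultimately show ?thesis unfolding \<sigma> M1_def using False by (simp add: state_matrix_def add.assoc)
      qed
    qed
  qed (use labeled_graphD(1)[OF G] in auto)
  show ?thesis unfolding vH by (rule move_invariant_trans[OF 1 2])
qed

text \<open>The change of framing at the neighbours of \<open>v\<close> is the diagonal part of the
  rank-one update at \<open>v\<close>, whose pivot entry is 0 because framing 1 meets the summand
  \<open>E\<close>.\<close>

lemma Omega_g4'_invariant:
  assumes G: "labeled_graph G" and "Omega_g4' G H"
  shows "move_invariant (verts G) (state_matrix G) (verts H) (state_matrix H)"
proof -
  obtain v where v: "v \<in> verts G" "framing G v = 1"
    and H: "H = (LC G v)\<lparr>framing := (\<lambda>x. if x \<in> nbhd G v then framing G x + 1 else framing G x),
                      vsign := (vsign G)(v := opp (vsign G v))\<rparr>"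
    using assms(2) unfolding Omega_g4'_def by blast
  note sy = labeled_graphD(3)[OF G] and irr = labeled_graphD(4)[OF G]
  have vH: "verts H = verts G" unfolding H LC_def toggle_def by simp
  show ?thesis
    unfolding vH
  proof (rule move_invariant_local_complement[OF labeled_graphD(1)[OF G] v(1)])
    show "state_matrix G v v = 0" using v by (simp add: state_matrix_def)
    show "state_matrix H i j = state_matrix G i j + state_matrix G i v * state_matrix G v j" for i j
    proof (cases "i = j")
      case True
      then show ?thesis using sy[of v i] irr[of v] v unfolding state_matrix_def H LC_def toggle_def nbhd_def
        by (cases "i = v"; cases "adj G v i") auto
    next
      case False
      have adjH: "adj H i j \<longleftrightarrow> adj G i j \<noteq> (adj G i v \<and> adj G v j)"
        using sy[of v i] sy[of v j] False unfolding H LC_def toggle_def nbhd_def by auto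
      have "state_matrix G i v = of_bool (adj G i v)" "state_matrix G v j = of_bool (adj G v j)"
        using irr[of v] v by (auto simp: state_matrix_def)
      then show ?thesis using False by (simp only: state_matrix_def adjH of_bool_xor of_bool_conj if_False)
    qed
  qed
qed

lemma graph_step_invariant:
  assumes "graph_step G H"
  shows "move_invariant (verts G) (state_matrix G) (verts H) (state_matrix H)"
proof -
  have G: "labeled_graph G" using assms unfolding graph_step_def by blast
  have "lgraph_iso G H \<or> Omega_g1 G H \<or> Omega_g2 G H \<or> Omega_g3 G H \<or> Omega_g4 G H \<or> Omega_g4' G H"
    using assms unfolding graph_step_def by blast
  then show ?thesis
    by (elim disjE) (fact lgraph_iso_invariant[OF G] Omega_g1_invariant[OF G] Omega_g2_invariant[OF G]
      Omega_g3_invariant[OF G] Omega_g4_invariant[OF G] Omega_g4'_invariant[OF G])+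
qed

section \<open>The invariant of a graph-link\<close>

definition nontrivial_state_sum :: "'v lgraph \<Rightarrow> bool" where
  "nontrivial_state_sum G \<longleftrightarrow>
     (\<exists>B. is_inv (verts G) (state_matrix G) B \<and> state_sum (verts G) B = 1)"

lemma nontrivial_state_sum_step:
  assumes "graph_step G H"
  shows "nontrivial_state_sum G = nontrivial_state_sum H"
proof
  note inv = graph_step_invariant[OF assms, unfolded move_invariant_def]
  show "nontrivial_state_sum G \<Longrightarrow> nontrivial_state_sum H"
    using inv unfolding nontrivial_state_sum_def by metis
  assume "nontrivial_state_sum H"
  then obtain C where C: "is_inv (verts H) (state_matrix H) C" "state_sum (verts H) C = 1"
    unfolding nontrivial_state_sum_def by blast
  have GH: "labeled_graph G" "labeled_graph H" using assms unfolding graph_step_def by auto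
  note fin = labeled_graphD(1)[OF GH(1)] labeled_graphD(1)[OF GH(2)]
  have n: "nonsing (verts H) (state_matrix H)"
    by (rule is_inv_nonsing[OF fin(2) symm_state_matrix[OF GH(2)] C(1)])
  then have "nonsing (verts G) (state_matrix G)" using inv by blast
  then obtain B where B: "is_inv (verts G) (state_matrix G) B" by (rule nonsing_inverse[OF fin(1)])
  then obtain B' where B': "is_inv (verts H) (state_matrix H) B'" "state_sum (verts H) B' = state_sum (verts G) B"
    using inv by blast
  \<comment> \<open>Two inverses agree on the vertex set, so the sum does not depend on which one is
    used.\<close>
  have "state_sum (verts H) B' = state_sum (verts H) C"
    by (rule state_sum_diag[OF fin(2)]) (use is_inv_unique[OF fin(2) n B'(1) C(1)] in auto)
  then show "nontrivial_state_sum G" unfolding nontrivial_state_sum_def using B B'(2) C(2) by auto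
qed

lemma nontrivial_state_sum_link:
  assumes "nontrivial_state_sum G" "H \<in> graph_link_of G"
  shows "nontrivial_state_sum H" "labeled_graph H"
proof -
  have "equivclp graph_step G H" "labeled_graph H"
    using assms(2) unfolding graph_link_of_def graph_equiv_def by auto
  from this(1) show "nontrivial_state_sum H"
    by (induction rule: equivclp_induct) (use assms(1) nontrivial_state_sum_step in auto)
  show "labeled_graph H" by fact
qed

text \<open>A nonzero vector in the kernel of the matrix, read through the enumeration of the
  vertices, would contradict \<open>nonsing\<close>; hence the determinant is nonzero and the rank
  full.\<close>

lemma nonsing_corank:
  fixes G :: "'v::linorder lgraph"
  assumes G: "labeled_graph G" and n: "nonsing (verts G) (state_matrix G)"
  shows "corank (adj_matrix G + 1\<^sub>m (card (verts G))) = 0"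
proof -
  let ?V = "verts G" let ?n = "card ?V" let ?A = "adj_matrix G + 1\<^sub>m ?n"
  define vs where "vs = sorted_list_of_set ?V"
  have vs: "set vs = ?V" "distinct vs" "length vs = ?n"
    using labeled_graphD(1)[OF G] by (auto simp: vs_def)
  have bij: "bij_betw ((!) vs) {0..<?n} ?V"
    by (rule bij_betw_nth[OF vs(2)]) (simp_all only: vs(1,3) atLeast0LessThan)
  have A: "?A \<in> carrier_mat ?n ?n" unfolding adj_matrix_def Let_def by simp
  have Aij: "?A $$ (i, j) = state_matrix G (vs ! i) (vs ! j)" if "i < ?n" "j < ?n" for i j
  proof -
    have "vs ! i = vs ! j \<longleftrightarrow> i = j" using that vs(2,3) by (simp add: nth_eq_iff_index_eq)
    then show ?thesis
      using that unfolding adj_matrix_def Let_def vs_def[symmetric] by (simp add: state_matrix_def)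
  qed
  have "det ?A \<noteq> 0"
  proof
    assume "det ?A = 0"
    then obtain x where x: "x \<in> carrier_vec ?n" "x \<noteq> 0\<^sub>v ?n" "?A *\<^sub>v x = 0\<^sub>v ?n"
      using det_0_iff_vec_prod_zero_field[OF A] by blast
    define y where "y k = x $ inv_into {0..<?n} ((!) vs) k" for k
    have y: "y (vs ! j) = x $ j" if "j < ?n" for j
      using bij that unfolding y_def bij_betw_def by simp
    have "mulv ?V (state_matrix G) y k = 0" if "k \<in> ?V" for k
    proof -
      obtain i where i: "i < ?n" "k = vs ! i" using \<open>k \<in> ?V\<close> vs by (metis in_set_conv_nth)
      have "mulv ?V (state_matrix G) y k = (\<Sum>j = 0..<?n. state_matrix G (vs ! i) (vs ! j) * y (vs ! j))"
        unfolding mulv_def i(2) by (rule sum.reindex_bij_betw[OF bij, symmetric])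
      also have "\<dots> = (\<Sum>j = 0..<?n. ?A $$ (i, j) * x $ j)"
        by (rule sum.cong) (use Aij y i in auto)
      also have "\<dots> = (?A *\<^sub>v x) $ i"
        using A x(1) i by (auto simp: scalar_prod_def intro!: sum.cong)
      finally show ?thesis using x(3) i by simp
    qed
    then have "y k = 0" if "k \<in> ?V" for k using nonsingD[OF n _ that] by blast
    then have "x $ j = 0" if "j < ?n" for j using y[OF that] vs that by (metis nth_mem)
    then have "x = 0\<^sub>v ?n" using x(1) by (intro eq_vecI) auto
    then show False using x(2) by simp
  qed
  then have "vec_space.rank ?n ?A = ?n" using vec_space.det_rank_iff[OF A] by simp
  then show ?thesis unfolding corank_def using A by simp
qed

section \<open>Chord diagrams and the wheel\<close>

lemma state_sum_naji:
  assumes V: "finite V" "symm V h" and n: "naji V (\<lambda>i j. h i j = 1)"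
  shows "state_sum V h = 0"
proof -
  have "\<not> obstructed V (even_verts V h) (with_diag h D)" for D
  proof
    assume o: "obstructed V (even_verts V h) (with_diag h D)"
    have "naji V (\<lambda>i j. with_diag h D i j = 1)"
      by (rule naji_pull[OF n, where f = id]) (auto simp: with_diag_def)
    then have "naji (V - even_verts V h) (schur V (even_verts V h) (with_diag h D))"
      using o unfolding obstructed_def
      by (intro naji_schur[OF V(1) even_verts_subset]) (auto simp: with_diag_def intro: symmD[OF V(2)])
    then show False using o naji_reducible.base unfolding obstructed_def by blast
  qed
  then show ?thesis unfolding state_sum_def by simp
qed

section \<open>Chords as pairs of angles\<close>

lemma Arg_cis_shift:
  assumes "- pi < s" "s \<le> pi" "s < t" "t < s + 2 * pi"
  shows "Arg (cis t) = (if t \<le> pi then t else t - 2 * pi)"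
proof (cases "t \<le> pi")
  case True
  then show ?thesis using assms by (simp add: cis_Arg_unique)
next
  case False
  have "cis (t - 2 * pi) = cis t" by (simp add: complex_eq_iff cos_diff sin_diff)
  then have "Arg (cis t) = t - 2 * pi" using assms False by (intro cis_Arg_unique) auto
  then show ?thesis using False by simp
qed

text \<open>\<open>Arg\<close> cuts the circle at -1, and the cut may fall into any of the four gaps
  between consecutive points; hence the four rotations.\<close>

lemma ccw_order_Arg:
  assumes "ccw_order z1 z2 z3 z4"
  shows "Arg z1 < Arg z2 \<and> Arg z2 < Arg z3 \<and> Arg z3 < Arg z4 \<or>
         Arg z2 < Arg z3 \<and> Arg z3 < Arg z4 \<and> Arg z4 < Arg z1 \<or>
         Arg z3 < Arg z4 \<and> Arg z4 < Arg z1 \<and> Arg z1 < Arg z2 \<or>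
         Arg z4 < Arg z1 \<and> Arg z1 < Arg z2 \<and> Arg z2 < Arg z3"
proof -
  obtain t1 t2 t3 t4 where t: "t1 < t2" "t2 < t3" "t3 < t4" "t4 < t1 + 2 * pi"
    and z: "z1 = cis t1" "z2 = cis t2" "z3 = cis t3" "z4 = cis t4"
    using assms unfolding ccw_order_def by blast
  have "cis (Arg z1) = cis t1" unfolding z by (simp add: cis_Arg)
  then obtain n :: int where n: "Arg z1 = t1 + 2 * pi * n"
    using sin_cos_eq_iff[of "Arg z1" t1] by (auto simp: complex_eq_iff)
  \<comment> \<open>Whole turns that bring the first lift to its principal argument; the other three
    then pass pi at most once.\<close>
  define c where "c = 2 * pi * real_of_int n"
  have cis: "cis (t + c) = cis t" for t
    unfolding c_def by (simp add: cis_mult[symmetric])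
  have b: "- pi < Arg z1" "Arg z1 \<le> pi" using Arg_bounded[of z1] by auto
  have A: "Arg z1 = t1 + c" using n by (simp add: c_def)
  have "Arg (cis (t2 + c)) = (if t2 + c \<le> pi then t2 + c else t2 + c - 2 * pi)"
    "Arg (cis (t3 + c)) = (if t3 + c \<le> pi then t3 + c else t3 + c - 2 * pi)"
    "Arg (cis (t4 + c)) = (if t4 + c \<le> pi then t4 + c else t4 + c - 2 * pi)"
    by (rule Arg_cis_shift[OF b]; use t A in simp)+
  then have "Arg z2 = (if t2 + c \<le> pi then t2 + c else t2 + c - 2 * pi)"
    "Arg z3 = (if t3 + c \<le> pi then t3 + c else t3 + c - 2 * pi)"
    "Arg z4 = (if t4 + c \<le> pi then t4 + c else t4 + c - 2 * pi)"
    unfolding z cis by auto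
  then show ?thesis using A t by (auto split: if_splits)
qed

lemma chord_angles:
  assumes "chord_diagram D" "c \<in> chords D"
  obtains a b where "a < b" "- pi < a" "b \<le> pi" "endpoints D c = {cis a, cis b}"
    "Arg (cis a) = a" "Arg (cis b) = b"
proof -
  have "card (endpoints D c) = 2" and one: "\<forall>z\<in>endpoints D c. cmod z = 1"
    using assms unfolding chord_diagram_def by auto
  then obtain x y where xy: "endpoints D c = {x, y}" "x \<noteq> y" by (auto simp: card_2_iff)
  have cis: "cis (Arg z) = z" if "z \<in> {x, y}" for z
  proof -
    have "cmod z = 1" using one xy that by auto
    then show ?thesis by (subst cis_Arg) (auto simp: sgn_eq)
  qed
  then have ne: "Arg x \<noteq> Arg y" using xy(2) by (metis insertCI)
  have b: "- pi < Arg z \<and> Arg z \<le> pi" for z by (rule Arg_bounded)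
  show ?thesis
  proof (cases "Arg x < Arg y")
    case True
    show ?thesis by (rule that[of "Arg x" "Arg y"]) (use True b cis xy in auto)
  next
    case False
    show ?thesis by (rule that[of "Arg y" "Arg x"]) (use False ne b cis xy in auto)
  qed
qed

lemma linked_iff_interleaved:
  assumes "endpoints D c = {cis a, cis b}" "endpoints D d = {cis a', cis b'}" "a < b" "a' < b'"
    and A: "Arg (cis a) = a" "Arg (cis b) = b" "Arg (cis a') = a'" "Arg (cis b') = b'"
    and bd: "- pi < a" "b \<le> pi" "- pi < a'" "b' \<le> pi"
  shows "linked D c d \<longleftrightarrow> a < a' \<and> a' < b \<and> b < b' \<or> a' < a \<and> a < b' \<and> b' < b"
proof
  assume "linked D c d"
  then obtain p q r s where pq: "{cis a, cis b} = {p, q}" and rs: "{cis a', cis b'} = {r, s}" and o: "ccw_order p r q s"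
    unfolding linked_def assms(1,2) by metis
  have "p = cis a \<and> q = cis b \<or> p = cis b \<and> q = cis a" using pq by (auto simp: doubleton_eq_iff)
  then have 1: "Arg p = a \<and> Arg q = b \<or> Arg p = b \<and> Arg q = a" using A by auto
  have "r = cis a' \<and> s = cis b' \<or> r = cis b' \<and> s = cis a'" using rs by (auto simp: doubleton_eq_iff)
  then have 2: "Arg r = a' \<and> Arg s = b' \<or> Arg r = b' \<and> Arg s = a'" using A by auto
  show "a < a' \<and> a' < b \<and> b < b' \<or> a' < a \<and> a < b' \<and> b' < b"
    using ccw_order_Arg[OF o] 1 2 assms(3,4) by auto
next
  have cis2: "cis (t + 2 * pi) = cis t" for t by (simp add: cis_mult[symmetric])
  assume "a < a' \<and> a' < b \<and> b < b' \<or> a' < a \<and> a < b' \<and> b' < b"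
  then show "linked D c d"
  proof
    assume h: "a < a' \<and> a' < b \<and> b < b'"
    have "ccw_order (cis a) (cis a') (cis b) (cis b')"
      unfolding ccw_order_def by (intro exI[of _ a] exI[of _ a'] exI[of _ b] exI[of _ b']) (use h bd in auto)
    then show ?thesis unfolding linked_def assms(1,2) by blast
  next
    assume h: "a' < a \<and> a < b' \<and> b' < b"
    \<comment> \<open>Read from \<open>a\<close> the point \<open>a'\<close> comes last, so it is
      lifted by one full turn.\<close>
    have "ccw_order (cis a) (cis b') (cis b) (cis a')"
      unfolding ccw_order_def
      by (intro exI[of _ a] exI[of _ b'] exI[of _ b] exI[of _ "a' + 2 * pi"]) (use h bd assms(4) cis2 in auto)
    then show ?thesis unfolding linked_def assms(1,2) by (metis insert_commute)
  qed
qed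

lemma naji_chord_diagram:
  assumes D: "chord_diagram D"
  shows "naji (chords D) (linked D)"
proof -
  have "\<forall>c\<in>chords D. \<exists>p. fst p < snd p \<and> - pi < fst p \<and> snd p \<le> pi \<and>
     endpoints D c = {cis (fst p), cis (snd p)} \<and> Arg (cis (fst p)) = fst p \<and> Arg (cis (snd p)) = snd p"
  proof
    fix c assume "c \<in> chords D"
    then show "\<exists>p. fst p < snd p \<and> - pi < fst p \<and> snd p \<le> pi \<and>
     endpoints D c = {cis (fst p), cis (snd p)} \<and> Arg (cis (fst p)) = fst p \<and> Arg (cis (snd p)) = snd p"
      by (rule chord_angles[OF D]) (metis fst_conv snd_conv)
  qed
  then obtain p where p: "\<forall>c\<in>chords D. fst (p c) < snd (p c) \<and> - pi < fst (p c) \<and> snd (p c) \<le> pi \<and>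
     endpoints D c = {cis (fst (p c)), cis (snd (p c))} \<and> Arg (cis (fst (p c))) = fst (p c) \<and> Arg (cis (snd (p c))) = snd (p c)"
    by metis
  define a where "a c = fst (p c)" for c
  define b where "b c = snd (p c)" for c
  have ab: "a c < b c" if "c \<in> chords D" for c using p that unfolding a_def b_def by auto
  have link: "linked D c d \<longleftrightarrow> a c < a d \<and> a d < b c \<and> b c < b d \<or> a d < a c \<and> a c < b d \<and> b d < b c"
    if "c \<in> chords D" "d \<in> chords D" for c d
    unfolding a_def b_def by (rule linked_iff_interleaved) (use p that in auto)
  have ne: "a c \<noteq> a d" "a c \<noteq> b d" "b c \<noteq> a d" "b c \<noteq> b d" if "c \<in> chords D" "d \<in> chords D" "c \<noteq> d" for c d
  proof -
    have "{cis (a c), cis (b c)} \<inter> {cis (a d), cis (b d)} = {}"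
      using D p that unfolding chord_diagram_def a_def b_def by metis
    then show "a c \<noteq> a d" "a c \<noteq> b d" "b c \<noteq> a d" "b c \<noteq> b d" by auto
  qed
  \<comment> \<open>With each chord oriented from its smaller angle, its right side can be taken to
    be the arc avoiding the cut at -1; the equations become statements about the order of real
    numbers.\<close>
  have "naji_solution (chords D) (linked D) (\<lambda>x y. a x < a y \<and> a y < b x)"
  proof (rule naji_solutionI)
    fix x y assume xy: "x \<in> chords D" "y \<in> chords D" "x \<noteq> y" "linked D x y"
    then show "(a x < a y \<and> a y < b x) \<noteq> (a y < a x \<and> a x < b y)"
      unfolding link[OF xy(1,2)] using ab by auto
  next
    fix x y z assume S: "x \<in> chords D" "y \<in> chords D" "z \<in> chords D" and n: "x \<noteq> y" "z \<noteq> x" "z \<noteq> y"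
      and l: "linked D x y" "\<not> linked D z x" "\<not> linked D z y"
    show "(a z < a x \<and> a x < b z) = (a z < a y \<and> a y < b z)"
      using l ab[OF S(1)] ab[OF S(2)] ab[OF S(3)] ne[OF S(1,2) n(1)] ne[OF S(3,1) n(2)] ne[OF S(3,2) n(3)]
      unfolding link[OF S(1,2)] link[OF S(3,1)] link[OF S(3,2)] by (smt (verit))
  next
    fix x y z assume S: "x \<in> chords D" "y \<in> chords D" "z \<in> chords D" and n: "x \<noteq> y" "z \<noteq> x" "z \<noteq> y"
      and l: "\<not> linked D x y" "linked D z x" "linked D z y"
    show "((a x < a y \<and> a y < b x) = (a y < a x \<and> a x < b y)) = ((a z < a x \<and> a x < b z) \<noteq> (a z < a y \<and> a y < b z))"
      using l ab[OF S(1)] ab[OF S(2)] ab[OF S(3)] ne[OF S(1,2) n(1)] ne[OF S(3,1) n(2)] ne[OF S(3,2) n(3)]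
      unfolding link[OF S(1,2)] link[OF S(3,1)] link[OF S(3,2)] by (smt (verit))
  qed
  then show ?thesis unfolding naji_def by blast
qed

lemma realisable_naji:
  assumes G: "labeled_graph G" and r: "realisable G"
  shows "naji (verts G) (\<lambda>i j. state_matrix G i j = 1)"
proof -
  obtain D :: "nat chord_diagram" and f where D: "chord_diagram D"
    and f: "bij_betw f (chords D) (verts G)"
    "\<And>x y. x \<in> chords D \<Longrightarrow> y \<in> chords D \<Longrightarrow> adj G (f x) (f y) = linked D x y"
    using r unfolding realisable_def lgraph_iso_def intersection_graph_def by auto
  define g where "g = inv_into (chords D) f"
  have g: "g i \<in> chords D" "f (g i) = i" if "i \<in> verts G" for i
    using f that unfolding g_def by (simp_all add: bij_betw_def inv_into_into f_inv_into_f)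
  show ?thesis
  proof (rule naji_pull[OF naji_chord_diagram[OF D], where f = g])
    show "inj_on g (verts G)" using g by (metis inj_onI)
    show "g ` verts G \<subseteq> chords D" using g by auto
    fix x y assume xy: "x \<in> verts G" "y \<in> verts G" "x \<noteq> y"
    then show "linked D (g x) (g y) = (state_matrix G x y = 1)"
      using f(2)[of "g x" "g y"] g by (simp add: state_matrix_def)
  qed
qed

lemma nontrivial_state_sum_not_realisable:
  assumes G: "labeled_graph G" and n: "nontrivial_state_sum G"
  shows "\<not> realisable G"
proof
  assume r: "realisable G"
  obtain B where B: "is_inv (verts G) (state_matrix G) B" "state_sum (verts G) B = 1"
    using n unfolding nontrivial_state_sum_def by blast
  note fin = labeled_graphD(1)[OF G] and sy = symm_state_matrix[OF G]
  have "naji (verts G) (\<lambda>i j. B i j = 1)"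
    by (rule naji_inverse[OF fin sy B(1) realisable_naji[OF G r]])
  then have "state_sum (verts G) B = 0"
    by (rule state_sum_naji[OF fin is_inv_symm[OF fin sy B(1)]])
  then show False using B(2) by simp
qed

text \<open>The inverse of the adjacency matrix of the wheel: again a wheel, with the complementary
  5-cycle as its rim.\<close>

definition pentagram_wheel :: "nat \<Rightarrow> nat \<Rightarrow> bit" where
  "pentagram_wheel i j = of_bool (i \<noteq> j \<and> (W5_adj i j \<longleftrightarrow> i = 5 \<or> j = 5))"

section \<open>The wheel\<close>

lemma atMost_5: "{..5::nat} = {0, 1, 2, 3, 4, 5}"
  by auto

lemma pentagram_wheel_inverse:
  "is_inv {..5} (\<lambda>i j. of_bool (W5_adj i j)) pentagram_wheel"
  unfolding is_inv_def mulv_def atMost_5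
  by (simp add: pentagram_wheel_def W5_adj_def)

lemma pentagram_wheel_odd: "even_verts {..5} pentagram_wheel = {}"
  unfolding even_verts_def atMost_5
  by (auto simp: pentagram_wheel_def W5_adj_def insert_Diff_if)

lemma pentagram_wheel_no_twins:
  "\<not> twins (\<lambda>i j. pentagram_wheel i j = 1) {..5} u v"
proof
  assume t: "twins (\<lambda>i j. pentagram_wheel i j = 1) {..5} u v"
  have uv: "u \<in> {..5}" "v \<in> {..5}" "u \<noteq> v" using t by (simp_all add: twins_def)
  have e: "pentagram_wheel u t = pentagram_wheel v t" if "t \<le> 5" "t \<noteq> u" "t \<noteq> v" for t
  proof -
    have "t \<in> {..5} - {u, v}" using that by simp
    then have "pentagram_wheel u t = 1 \<longleftrightarrow> pentagram_wheel v t = 1" using t unfolding twins_def by meson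
    then show ?thesis by (metis bit_not_one_iff)
  qed
  have cases: "n = 0 \<or> n = 1 \<or> n = 2 \<or> n = 3 \<or> n = 4 \<or> n = 5" if "n \<in> {..5}" for n :: nat
    using that by auto
  show False
    using cases[OF uv(1)] cases[OF uv(2)] uv(3) e[of 0] e[of 1] e[of 2] e[of 3] e[of 4]
    by (elim disjE; simp add: pentagram_wheel_def W5_adj_def)
qed

text \<open>Write the equations over the field with two elements. For each rim vertex
  \<open>i\<close> the second kind gives equal values of \<open>\<beta> i\<close> at
  \<open>i - 1\<close> and \<open>i + 1\<close> (modulo 5), which are joined in the pentagram and
  not joined to \<open>i\<close>. For each of the five pairs \<open>i, i + 1\<close> the third kind,
  centred at the hub, carries a constant 1. In the total every hub value occurs twice and the rim
  values cancel by the first group, leaving five ones: the odd length of the rim is the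
  contradiction.\<close>

lemma pentagram_wheel_not_naji: "\<not> naji {..5} (\<lambda>i j. pentagram_wheel i j = 1)"
proof
  assume "naji {..5} (\<lambda>i j. pentagram_wheel i j = 1)"
  then obtain \<beta> where b: "naji_solution {..5} (\<lambda>i j. pentagram_wheel i j = 1) \<beta>"
    unfolding naji_def by blast
  note b2 = naji_solutionD(2)[OF b] and b3 = naji_solutionD(3)[OF b]
  note d = pentagram_wheel_def W5_adj_def
  have "\<beta> 1 0 = \<beta> 1 2" "\<beta> 4 0 = \<beta> 4 3" "\<beta> 3 2 = \<beta> 3 4" "\<beta> 0 4 = \<beta> 0 1" "\<beta> 2 1 = \<beta> 2 3"
    using b2[of 0 2 1] b2[of 0 3 4] b2[of 2 4 3] b2[of 4 1 0] b2[of 1 3 2] by (simp_all add: d)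
  moreover have "(\<beta> 0 4 = \<beta> 4 0) = (\<beta> 5 0 \<noteq> \<beta> 5 4)" "(\<beta> 0 1 = \<beta> 1 0) = (\<beta> 5 0 \<noteq> \<beta> 5 1)"
    "(\<beta> 2 1 = \<beta> 1 2) = (\<beta> 5 2 \<noteq> \<beta> 5 1)" "(\<beta> 2 3 = \<beta> 3 2) = (\<beta> 5 2 \<noteq> \<beta> 5 3)"
    "(\<beta> 4 3 = \<beta> 3 4) = (\<beta> 5 4 \<noteq> \<beta> 5 3)"
    using b3[of 0 4 5] b3[of 0 1 5] b3[of 2 1 5] b3[of 2 3 5] b3[of 4 3 5] by (simp_all add: d)
  ultimately show False by argo
qed

lemma state_sum_pentagram_wheel: "state_sum {..5} pentagram_wheel = 1"
proof -
  let ?a = "\<lambda>i j. pentagram_wheel i j = 1"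
  have "\<not> naji_reducible ?a {..5}"
    using pentagram_wheel_not_naji pentagram_wheel_no_twins by (auto elim: naji_reducible.cases)
  moreover have "naji_reducible (schur {..5} {} (with_diag pentagram_wheel {})) {..5} = naji_reducible ?a {..5}"
    by (rule naji_reducible_cong) (auto simp: schur_empty with_diag_def)
  ultimately have "obstructed {..5} {} (with_diag pentagram_wheel {})"
    unfolding obstructed_def by (simp add: nonsing_def)
  then show ?thesis unfolding state_sum_def pentagram_wheel_odd by simp
qed

text \<open>Framing 1 makes the summand \<open>E\<close> cancel the diagonal, so the matrix is the
  plain adjacency matrix of the wheel; \<open>move_invariant_iso\<close> carries the computation
  from the model on \<open>{..5}\<close> to \<open>G\<close>.\<close>

lemma W5_nontrivial:
  assumes G: "labeled_graph G" and W: "underlying_W5 G" and fr: "\<forall>v\<in>verts G. framing G v = 1"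
  shows "nontrivial_state_sum G"
proof -
  obtain f where f: "bij_betw f {..5::nat} (verts G)"
    "\<And>i j. i \<le> 5 \<Longrightarrow> j \<le> 5 \<Longrightarrow> adj G (f i) (f j) = W5_adj i j"
    using W unfolding underlying_W5_def by blast
  have "move_invariant {..5} (\<lambda>i j. of_bool (W5_adj i j)) (verts G) (state_matrix G)"
  proof (rule move_invariant_iso[OF f(1)])
    fix i j :: nat assume ij: "i \<in> {..5}" "j \<in> {..5}"
    have eq: "f i = f j \<longleftrightarrow> i = j" using f(1) ij by (auto simp: bij_betw_def inj_on_def)
    have "f i \<in> verts G" using f(1) ij by (auto simp: bij_betw_def)
    then have "framing G (f i) = 1" using fr by blast
    moreover have "\<not> W5_adj i i" using f(2)[of i i] ij labeled_graphD(4)[OF G] by auto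
    ultimately show "state_matrix G (f i) (f j) = of_bool (W5_adj i j)"
      using f(2) ij by (auto simp: state_matrix_def eq)
  qed simp
  then show ?thesis
    unfolding move_invariant_def nontrivial_state_sum_def
    using pentagram_wheel_inverse state_sum_pentagram_wheel by metis
qed

theorem corollary3p2:
  fixes G :: "nat lgraph"
  assumes "labeled_graph G"
    and "underlying_W5 G"
    and "\<forall>v\<in>verts G. framing G v = 1"
  shows "graph_knot (graph_link_of G) \<and> non_realisable (graph_link_of G)"
proof -
  have link: "labeled_graph H" "nontrivial_state_sum H" if "H \<in> graph_link_of G" for H
    using nontrivial_state_sum_link[OF W5_nontrivial[OF assms] that] by auto
  have "graph_link_of G \<in> graph_links"
    using assms(1) unfolding graph_links_def graph_link_of_def by (intro quotientI) simp
  moreover have "corank (adj_matrix H + 1\<^sub>m (card (verts H))) = 0" if "H \<in> graph_link_of G" for H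
  proof -
    note H = link[OF that]
    obtain B where "is_inv (verts H) (state_matrix H) B"
      using H(2) unfolding nontrivial_state_sum_def by blast
    then show ?thesis
      by (intro nonsing_corank[OF H(1)] is_inv_nonsing[OF labeled_graphD(1)[OF H(1)] symm_state_matrix[OF H(1)]])
  qed
  ultimately show ?thesis
    unfolding graph_knot_def non_realisable_def
    using link nontrivial_state_sum_not_realisable by blast
qed

end
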